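(* Let $F$ be a field of characteristic zero, $n=n_1+\cdots+n_t$, and let $M_n(F)$ carry the idempotents $e_1,\dots,e_t$ (with $tr(e_a)=n_a$). The ideal of mixed $E$-trace identities of $M_n(F)$ is generated, as an ideal closed under substitution of mixed $E$-trace polynomials for the variables, by the mixed Cayley–Hamilton polynomials restricted to the diagonal components: $$MCH_{n_a+1}(E_aX_1E_a,\ldots,E_aX_{n_a}E_a),\qquad a=1,\dots,t.$$
   Context: $e_a$ is the diagonal idempotent of $M_n(F)$ which is the sum of the matrix units $e_{ii}$ with $i$ in the $a$-th block of indices of size $n_a$; $E$-polynomials and (pure/mixed) $E$-trace polynomials are as follows: $F\langle X,E\rangle$ is the free algebra on $X\cup\{E_1,\dots,E_t\}$ modulo $E_aE_b=\delta_{ab}E_a$, $\sum_aE_a=1$; $E$-trace polynomials add a formal trace (linear, cyclic, central values, $tr(tr(u)v)=tr(u)tr(v)$) with $tr(E_a)=n_a$; pure ones are polynomials in traces of $E$-monomials, mixed ones are combinations of pure ones times $E$-monomials; evaluation sends $E_a\mapsto e_a$. For $\sigma\in S_m$ with $\sigma^{-1}=(i_1,\dots,i_a)(j_1,\dots,j_b)\cdots$ (all cycles, including 1-cycles), $tr_\sigma(x_1,\dots,x_m)=tr(x_{i_1}\cdots x_{i_a})tr(x_{j_1}\cdots x_{j_b})\cdots$. The multilinear Cayley–Hamilton polynomial is $CH_m(x_1,\dots,x_m)=\sum_{\sigma\in S_m}\mathrm{sgn}(\sigma)\,tr_\sigma(x_1,\dots,x_m)$, and the mixed trace polynomial $MCH_m(x_1,\dots,x_{m-1})$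 is defined by $tr(MCH_m(x_1,\dots,x_{m-1})x_m)=CH_m(x_1,\dots,x_m)$.
   Formalization: The generators are taken as E_a MCH_{n_a+1}(E_aX_1E_a,...,E_aX_{n_a}E_a) E_a, since without the outer E_a they are not identities when t>1; and "ideal" means one also closed under the formal trace, without which the claim fails for t>1. *)

theory Defs
  imports "Jordan_Normal_Form.Matrix" "HOL-Combinatorics.Permutations"
    "HOL-Combinatorics.Multiset_Permutations"
begin

text \<open>Terms of the free algebra with trace on the variables X = {Var 0, Var 1, ...}
  and the idempotents E 0, ..., E (t-1) (0-based indices), with scalars from 'f.
  The actual free object (mixed E-trace polynomials) is the quotient of these terms
  by the congruence etp_eqv below.\<close>

datatype 'f etp =
    Var nat
  | E nat
  | Const 'f
  | Add "'f etp" "'f etp"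
  | Mult "'f etp" "'f etp"
  | Tr "'f etp"

definition sumT :: "'f::zero etp list \<Rightarrow> 'f etp" where
  "sumT xs = foldr Add xs (Const 0)"

definition prodT :: "'f::one etp list \<Rightarrow> 'f etp" where
  "prodT xs = foldr Mult xs (Const 1)"

primrec subst :: "(nat \<Rightarrow> 'f etp) \<Rightarrow> 'f etp \<Rightarrow> 'f etp" where
  "subst s (Var i) = s i"
| "subst s (E a) = E a"
| "subst s (Const c) = Const c"
| "subst s (Add u v) = Add (subst s u) (subst s v)"
| "subst s (Mult u v) = Mult (subst s u) (subst s v)"
| "subst s (Tr u) = Tr (subst s u)"

text \<open>Equality in the free E-trace algebra (ns = [n_1,...,n_t]): the congruence generated
  by the axioms of a unital associative 'f-algebra, the trace axioms (linear, cyclic,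
  central values, tr(tr(u)v) = tr(u)tr(v)), the relations E_a E_b = delta_ab E_a,
  sum_a E_a = 1, tr(E_a) = n_a.  Out-of-range indices E a with a >= t are identified
  with 0 (a harmless convention making every term meaningful).\<close>

inductive etp_eqv :: "nat list \<Rightarrow> 'f::field etp \<Rightarrow> 'f etp \<Rightarrow> bool" for ns where
  refl: "etp_eqv ns u u"
| sym: "etp_eqv ns u v \<Longrightarrow> etp_eqv ns v u"
| trans: "etp_eqv ns u v \<Longrightarrow> etp_eqv ns v w \<Longrightarrow> etp_eqv ns u w"
| cong_add: "etp_eqv ns u u' \<Longrightarrow> etp_eqv ns v v' \<Longrightarrow> etp_eqv ns (Add u v) (Add u' v')"
| cong_mult: "etp_eqv ns u u' \<Longrightarrow> etp_eqv ns v v' \<Longrightarrow> etp_eqv ns (Mult u v) (Mult u' v')"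
| cong_tr: "etp_eqv ns u u' \<Longrightarrow> etp_eqv ns (Tr u) (Tr u')"
| add_assoc: "etp_eqv ns (Add (Add u v) w) (Add u (Add v w))"
| add_comm: "etp_eqv ns (Add u v) (Add v u)"
| add_zero: "etp_eqv ns (Add (Const 0) u) u"
| add_inv: "etp_eqv ns (Add u (Mult (Const (-1)) u)) (Const 0)"
| mult_assoc: "etp_eqv ns (Mult (Mult u v) w) (Mult u (Mult v w))"
| mult_one_left: "etp_eqv ns (Mult (Const 1) u) u"
| mult_one_right: "etp_eqv ns (Mult u (Const 1)) u"
| distrib_left: "etp_eqv ns (Mult u (Add v w)) (Add (Mult u v) (Mult u w))"
| distrib_right: "etp_eqv ns (Mult (Add u v) w) (Add (Mult u w) (Mult v w))"
| const_add: "etp_eqv ns (Const (c + d)) (Add (Const c) (Const d))"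
| const_mult: "etp_eqv ns (Const (c * d)) (Mult (Const c) (Const d))"
| const_central: "etp_eqv ns (Mult (Const c) u) (Mult u (Const c))"
| tr_add: "etp_eqv ns (Tr (Add u v)) (Add (Tr u) (Tr v))"
| tr_smult: "etp_eqv ns (Tr (Mult (Const c) u)) (Mult (Const c) (Tr u))"
| tr_cyclic: "etp_eqv ns (Tr (Mult u v)) (Tr (Mult v u))"
| tr_central: "etp_eqv ns (Mult (Tr u) v) (Mult v (Tr u))"
| tr_tr: "etp_eqv ns (Tr (Mult (Tr u) v)) (Mult (Tr u) (Tr v))"
| E_mult: "a < length ns \<Longrightarrow> b < length ns \<Longrightarrow>
           etp_eqv ns (Mult (E a) (E b)) (if a = b then E a else Const 0)"
| E_sum: "etp_eqv ns (sumT (map E [0..<length ns])) (Const 1)"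
| E_tr: "a < length ns \<Longrightarrow> etp_eqv ns (Tr (E a)) (Const (of_nat (ns ! a)))"
| E_out: "length ns \<le> a \<Longrightarrow> etp_eqv ns (E a) (Const 0)"

inductive_set etp_Tideal :: "nat list \<Rightarrow> 'f::field etp set \<Rightarrow> 'f etp set" for ns G where
  gen: "g \<in> G \<Longrightarrow> g \<in> etp_Tideal ns G"
| zero: "Const 0 \<in> etp_Tideal ns G"
| add: "u \<in> etp_Tideal ns G \<Longrightarrow> v \<in> etp_Tideal ns G \<Longrightarrow> Add u v \<in> etp_Tideal ns G"
| mult_left: "u \<in> etp_Tideal ns G \<Longrightarrow> Mult p u \<in> etp_Tideal ns G"
| mult_right: "u \<in> etp_Tideal ns G \<Longrightarrow> Mult u p \<in> etp_Tideal ns G"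
| tr: "u \<in> etp_Tideal ns G \<Longrightarrow> Tr u \<in> etp_Tideal ns G"
| subst: "u \<in> etp_Tideal ns G \<Longrightarrow> subst s u \<in> etp_Tideal ns G"
| eqv: "u \<in> etp_Tideal ns G \<Longrightarrow> etp_eqv ns u v \<Longrightarrow> v \<in> etp_Tideal ns G"

definition mtrace :: "'f::comm_ring_1 mat \<Rightarrow> 'f" where
  "mtrace A = (\<Sum>i<dim_row A. A $$ (i, i))"

definition eblock :: "nat list \<Rightarrow> nat \<Rightarrow> 'f::comm_ring_1 mat" where
  "eblock ns a = mat (sum_list ns) (sum_list ns)
     (\<lambda>(i, j). if i = j \<and> a < length ns \<and> sum_list (take a ns) \<le> i
                 \<and> i < sum_list (take (Suc a) ns) then 1 else 0)"

primrec etp_eval :: "nat list \<Rightarrow> (nat \<Rightarrow> 'f::comm_ring_1 mat) \<Rightarrow> 'f etp \<Rightarrow> 'f mat" where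
  "etp_eval ns \<rho> (Var i) = \<rho> i"
| "etp_eval ns \<rho> (E a) = eblock ns a"
| "etp_eval ns \<rho> (Const c) = c \<cdot>\<^sub>m 1\<^sub>m (sum_list ns)"
| "etp_eval ns \<rho> (Add u v) = etp_eval ns \<rho> u + etp_eval ns \<rho> v"
| "etp_eval ns \<rho> (Mult u v) = etp_eval ns \<rho> u * etp_eval ns \<rho> v"
| "etp_eval ns \<rho> (Tr u) = mtrace (etp_eval ns \<rho> u) \<cdot>\<^sub>m 1\<^sub>m (sum_list ns)"

definition is_etp_identity :: "nat list \<Rightarrow> 'f::comm_ring_1 etp \<Rightarrow> bool" where
  "is_etp_identity ns f \<longleftrightarrow>
     (\<forall>\<rho>. (\<forall>i. \<rho> i \<in> carrier_mat (sum_list ns) (sum_list ns)) \<longrightarrow>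
           etp_eval ns \<rho> f = 0\<^sub>m (sum_list ns) (sum_list ns))"

definition perm_of_list :: "nat list \<Rightarrow> nat \<Rightarrow> nat" where
  "perm_of_list p i = (if i < length p then p ! i else i)"

definition cyc_len :: "(nat \<Rightarrow> nat) \<Rightarrow> nat \<Rightarrow> nat" where
  "cyc_len tau i = (LEAST k. 0 < k \<and> (tau ^^ k) i = i)"

definition cyc :: "(nat \<Rightarrow> nat) \<Rightarrow> nat \<Rightarrow> nat list" where
  "cyc tau i = map (\<lambda>k. (tau ^^ k) i) [0..<cyc_len tau i]"

definition cyc_leaders :: "(nat \<Rightarrow> nat) \<Rightarrow> nat \<Rightarrow> nat list" where
  "cyc_leaders tau m = filter (\<lambda>i. \<forall>k. i \<le> (tau ^^ k) i) [0..<m]"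

definition tr_sigma :: "(nat \<Rightarrow> nat) \<Rightarrow> 'f::one etp list \<Rightarrow> 'f etp" where
  "tr_sigma sg xs = (let tau = inv_into UNIV sg in
     prodT (map (\<lambda>i. Tr (prodT (map (\<lambda>j. xs ! j) (cyc tau i)))) (cyc_leaders tau (length xs))))"

definition CH :: "'f::comm_ring_1 etp list \<Rightarrow> 'f etp" where
  "CH xs = sumT (map (\<lambda>p. Mult (Const (of_int (sign (perm_of_list p)))) (tr_sigma (perm_of_list p) xs))
                   (permutations_of_set_list [0..<length xs]))"

text \<open>MCH_m(x_1,...,x_{m-1}) with tr(MCH_m(x_1..x_{m-1}) x_m) = CH_m(x_1..x_m): for each
  sigma, if the cycle of sigma^{-1} through m is (m, j_1, ..., j_k), the term
  sgn(sigma) * (traces of the other cycles) * x_{j_1} ... x_{j_k}.  Here the argument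
  list ys has length m-1 and the index of x_m is length ys.\<close>
definition MCH :: "'f::comm_ring_1 etp list \<Rightarrow> 'f etp" where
  "MCH ys = (let l = length ys in
     sumT (map (\<lambda>p. let tau = inv_into UNIV (perm_of_list p) in
       Mult (Const (of_int (sign (perm_of_list p))))
         (Mult (prodT (map (\<lambda>i. Tr (prodT (map (\<lambda>j. ys ! j) (cyc tau i))))
                          (filter (\<lambda>i. l \<notin> set (cyc tau i)) (cyc_leaders tau (Suc l)))))
               (prodT (map (\<lambda>j. ys ! j) (tl (cyc tau l))))))
       (permutations_of_set_list [0..<Suc l])))"

text \<open>Generators: MCH_{n_a+1}(E_a X_1 E_a, ..., E_a X_{n_a} E_a) restricted to the diagonal
  component E_a M_n E_a, i.e. with the unit of that corner (E_a) in place of 1;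
  equivalently E_a MCH(...) E_a.\<close>
definition MCH_gens :: "nat list \<Rightarrow> 'f::comm_ring_1 etp set" where
  "MCH_gens ns = {Mult (E a) (Mult (MCH (map (\<lambda>i. Mult (E a) (Mult (Var i) (E a))) [0..<ns ! a])) (E a))
                  | a. a < length ns}"

end

theory Submission
  imports Defs "HOL-Combinatorics.Cycles" "HOL-Computational_Algebra.Polynomial" "HOL-Library.Nat_Bijection"
begin

text \<open>Modulo the generators, an E-trace polynomial is a linear combination of mixed trace monomials,
  one for each permutation of a set of slots, where every slot carries a letter \<open>E_a X_i E_b\<close>.
  In characteristic zero, substituting sums of scalar multiples of generic elements and extracting
  coefficients makes the letters of an identity distinct.  Evaluating at matrix units then says
  that the coefficients of the combination, as an element of the group algebra of the symmetric group,
  act as zero on a product of tensor powers of the block spaces.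

  Any permutation that decreases on \<open>n_a + 1\<close> slots of colour \<open>a\<close> is, modulo the antisymmetrizer on
  these slots, a combination of lexicographically smaller ones.  A permutation with no such decreasing
  subsequence admits a labelling of each colour class by \<open>n_a\<close> basis vectors along which it is
  increasing, and the matrix coefficients for these labellings are triangular.  Hence the antisymmetrizers
  span the kernel.  Eliminating the remaining slots turns an antisymmetrizer on \<open>n_a + 1\<close> slots of
  colour \<open>a\<close> into \<open>E_a MCH E_a\<close> in the words merged along the eliminated slots.\<close>

text \<open>A mixed polynomial has one open word next to closed traces. Regarding that word as the
  cycle through a distinguished slot puts both under a single formula, and a colour is needed on
  each side of every slot because \<open>E_a\<close> and \<open>E_b\<close> at the two ends of a
  letter may differ. The kernel statement is the second fundamental theorem of invariant theory for
  a product of general linear groups; the decreasing subsequences used for it belong to the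
  combinatorics of Robinson-Schensted. The constant n_a + 1 is the least number of vectors that
  antisymmetrize to zero in dimension n_a. The argument runs in an abstract ring with trace in which
  the generators vanish and which still maps to matrices. The quotient of the free object by the
  T-ideal is such a ring: closure under substitution makes the generators vanish at all elements,
  and evaluation at matrices descends to it because the generators are identities. An identity
  evaluated at the classes of the variables is its own class, so its vanishing there is membership
  in the T-ideal. That the generators are identities has to come before this; it is shown in the
  quotient by the empty set of generators.\<close>

unbundle no m_inv_syntax

\<comment> \<open>The introduction rules of the inductive definitions would hide library facts of the same name.\<close>
hide_fact (open) etp_eqv.refl etp_eqv.sym etp_eqv.trans etp_eqv.distrib_left etp_eqv.distrib_right
  etp_eqv.add_assoc etp_eqv.mult_assoc etp_Tideal.subst etp_Tideal.add etp_Tideal.zero etp_Tideal.tr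
  etp_eqv.const_add etp_eqv.cong_mult
declare fun_upd_apply [simp del] fun_upd_same [simp] fun_upd_other [simp]

subsection \<open>Straightening of permutations\<close>

text \<open>Pigeonhole: \<open>q\<close> repeats a value on \<open>D\<close>, and right
  multiplication by the transposition of the two slots keeps every indicator but flips every sign,
  so the sum equals its own negative. The indicator is the matrix coefficient of
  \<open>\<tau> \<circ> \<rho>\<close> on tensor space between the basis tensors indexed by
  \<open>p\<close> and \<open>q\<close>.\<close>

lemma antisymmetrizer_in_kernel:
  fixes p q :: "nat \<Rightarrow> nat"
  assumes "finite D" "D \<subseteq> S" "q ` D \<subseteq> Q" "finite Q" "card Q < card D"
  shows "(\<Sum>\<rho> | \<rho> permutes D. of_int (sign \<rho>) * (if \<forall>j\<in>S. q j = p (\<tau> (\<rho> j)) then 1 else 0)) = (0::'f::field_char_0)"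
proof -
  have "card (q ` D) < card D"
    using assms by (meson card_mono le_less_trans)
  then have "\<not> inj_on q D" using card_image[of q D] by auto
  then obtain d d' where d: "d \<in> D" "d' \<in> D" "d \<noteq> d'" "q d = q d'" by (auto simp: inj_on_def)
  define t where "t = transpose d d'"
  define f where "f \<rho> = (of_int (sign \<rho>) * (if \<forall>j\<in>S. q j = p (\<tau> (\<rho> j)) then 1 else 0) :: 'f)" for \<rho>
  have t: "t permutes D" unfolding t_def using d by (intro permutes_swap_id)
  have tS: "t permutes S" using t assms(2) by (rule permutes_subset)
  have qt: "q (t j) = q j" for j using d by (simp add: t_def transpose_def)
  have tt: "t (t j) = j" for j by (simp add: t_def)
  have "f (\<rho> \<circ> t) = - f \<rho>" if "\<rho> permutes D" for \<rho>
  proof -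
    have "sign (\<rho> \<circ> t) = sign \<rho> * sign t"
      using that t assms(1) by (intro sign_compose) (auto simp: permutation_permutes)
    also have "\<dots> = - sign \<rho>" using d by (simp add: t_def sign_swap_id)
    finally have "sign (\<rho> \<circ> t) = - sign \<rho>" .
    moreover have "(\<forall>j\<in>S. q j = p (\<tau> ((\<rho> \<circ> t) j))) \<longleftrightarrow> (\<forall>j\<in>S. q j = p (\<tau> (\<rho> j)))"
      using permutes_in_image[OF tS] qt tt by (metis comp_apply)
    ultimately show ?thesis by (simp add: f_def)
  qed
  then have "sum f {\<rho>. \<rho> permutes D} = - sum f {\<rho>. \<rho> permutes D}"
    using sum_permutations_compose_right[OF t, of f] by (simp add: sum_negf)
  then have "sum f {\<rho>. \<rho> permutes D} = 0" by simp
  then show ?thesis by (simp add: f_def)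
qed

text \<open>Each slot is labelled by the length of the longest decreasing subsequence of its own
  colour that ends there. A label beyond the bound exhibits the set \<open>D\<close>. Otherwise a
  descent between two slots of equal colour and label is impossible, since the later slot would
  extend the sequence ending at the earlier one.\<close>

lemma decreasing_or_labelled:
  fixes \<tau> :: "nat \<Rightarrow> nat"
  assumes "finite S"
  obtains (dec) D c where "D \<subseteq> S" "card D = Suc (N c)" "\<And>d. d \<in> D \<Longrightarrow> b d = c"
      "\<And>i j. i \<in> D \<Longrightarrow> j \<in> D \<Longrightarrow> i < j \<Longrightarrow> \<tau> j < \<tau> i"
  | (lab) h where "\<And>j. j \<in> S \<Longrightarrow> h j < N (b j)"
      "\<And>i j. i \<in> S \<Longrightarrow> j \<in> S \<Longrightarrow> i < j \<Longrightarrow> b i = b j \<Longrightarrow> h i = h j \<Longrightarrow> \<not> \<tau> j < \<tau> i"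
proof -
  define A where "A j = {D. D \<subseteq> S \<and> j \<in> D \<and> (\<forall>d\<in>D. d \<le> j \<and> b d = b j) \<and>
    (\<forall>i\<in>D. \<forall>k\<in>D. i < k \<longrightarrow> \<tau> k < \<tau> i)}" for j
  have fin: "finite (A j)" for j
    by (rule finite_subset[of _ "Pow S"]) (use assms in \<open>auto simp: A_def\<close>)
  define l where "l j = Max (card ` A j)" for j
  have in_A: "{j} \<in> A j" if "j \<in> S" for j using that by (auto simp: A_def)
  have lA: "\<exists>D\<in>A j. card D = l j" if "j \<in> S" for j
    using Max_in[of "card ` A j"] fin in_A[OF that] unfolding l_def by (metis empty_iff finite_imageI imageE image_is_empty)
  have le: "card D \<le> l j" if "D \<in> A j" for D j
    unfolding l_def using fin that by (intro Max_ge) auto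
  show thesis
  proof (cases "\<exists>j\<in>S. N (b j) < l j")
    case True
    then obtain j where j: "j \<in> S" "N (b j) < l j" by auto
    then obtain D where D: "D \<in> A j" "card D = l j" using lA by auto
    then obtain D' where D': "D' \<subseteq> D" "card D' = Suc (N (b j))"
      using j(2) obtain_subset_with_card_n[of "Suc (N (b j))" D] by auto
    have D_props: "D \<subseteq> S" "\<forall>d\<in>D. b d = b j" "\<forall>i\<in>D. \<forall>k\<in>D. i < k \<longrightarrow> \<tau> k < \<tau> i"
      using D(1) unfolding A_def by blast+
    show thesis
    proof (rule dec[of D' "b j"])
      show "D' \<subseteq> S" using D' D_props by blast
      show "b d = b j" if "d \<in> D'" for d using D'(1) D_props that by blast
      show "\<tau> k < \<tau> i" if "i \<in> D'" "k \<in> D'" "i < k" for i k using D'(1) D_props that by blast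
    qed (fact D'(2))
  next
    case False
    have pos: "1 \<le> l j" if "j \<in> S" for j using le[OF in_A[OF that]] by simp
    \<comment> \<open>Lengths run from 1 to \<open>N (b j)\<close>; subtracting one turns them into
      basis indices starting at 0.\<close>
    show thesis
    proof (rule lab[of "\<lambda>j. l j - 1"])
      show "l j - 1 < N (b j)" if "j \<in> S" for j using pos[OF that] False that by force
    next
      fix i j assume ij: "i \<in> S" "j \<in> S" "i < j" "b i = b j" and leq: "l i - 1 = l j - 1"
      show "\<not> \<tau> j < \<tau> i"
      proof
        assume lt: "\<tau> j < \<tau> i"
        obtain D where D: "D \<in> A i" "card D = l i" using lA ij by auto
        have ord: "\<tau> j < \<tau> d" if "d \<in> D" for d
        proof (cases "d = i")
          case False
          have "d \<le> i" "i \<in> D" "\<forall>i\<in>D. \<forall>k\<in>D. i < k \<longrightarrow> \<tau> k < \<tau> i"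
            using D(1) that unfolding A_def by blast+
          then have "\<tau> i < \<tau> d" using that False by (meson le_neq_implies_less)
          then show ?thesis using lt by simp
        qed (use lt in simp)
        have "insert j D \<in> A j"
        proof -
          have *: "D \<subseteq> S" "\<forall>d\<in>D. d \<le> i \<and> b d = b i" "\<forall>i\<in>D. \<forall>k\<in>D. i < k \<longrightarrow> \<tau> k < \<tau> i"
            using D(1) unfolding A_def by blast+
          have "\<tau> k' < \<tau> k" if "k \<in> insert j D" "k' \<in> insert j D" "k < k'" for k k'
          proof -
            have "k \<noteq> j"
            proof
              assume "k = j"
              then have "k' \<le> i" using that *(2) by auto
              then show False using that(3) \<open>k = j\<close> ij(3) by simp
            qed
            then show ?thesis using that *(3) ord by (cases "k' = j") auto
          qed
          moreover have "d \<le> j \<and> b d = b j" if "d \<in> insert j D" for d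
          proof (cases "d = j")
            case False
            then have "d \<le> i \<and> b d = b i" using that *(2) by blast
            then show ?thesis using ij(3,4) by simp
          qed simp
          ultimately show ?thesis using *(1) ij(2) unfolding A_def by blast
        qed
        moreover have "D \<subseteq> S" "\<forall>d\<in>D. d \<le> i" using D(1) unfolding A_def by blast+
        then have "j \<notin> D" "finite D" using ij(3) assms finite_subset by auto
        ultimately have "Suc (l i) \<le> l j" using le[of "insert j D" j] D(2) by simp
        then show False using leq pos[OF ij(1)] by simp
      qed
    qed
  qed
qed

definition lex_less :: "(nat \<Rightarrow> nat) \<Rightarrow> (nat \<Rightarrow> nat) \<Rightarrow> bool" where
  "lex_less \<sigma> \<tau> \<longleftrightarrow> (\<exists>i. (\<forall>k<i. \<sigma> k = \<tau> k) \<and> \<sigma> i < \<tau> i)"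

lemma lex_less_irrefl: "\<not> lex_less \<tau> \<tau>"
  by (simp add: lex_less_def)

lemma lex_less_trans: "lex_less \<rho> \<sigma> \<Longrightarrow> lex_less \<sigma> \<tau> \<Longrightarrow> lex_less \<rho> \<tau>"
proof -
  assume "lex_less \<rho> \<sigma>" "lex_less \<sigma> \<tau>"
  then obtain i j where i: "\<forall>k<i. \<rho> k = \<sigma> k" "\<rho> i < \<sigma> i" and j: "\<forall>k<j. \<sigma> k = \<tau> k" "\<sigma> j < \<tau> j"
    by (auto simp: lex_less_def)
  show ?thesis
    unfolding lex_less_def
    using i j by (intro exI[of _ "min i j"]) (cases i j rule: linorder_cases; auto)
qed

lemma lex_less_total: "\<sigma> \<noteq> \<tau> \<Longrightarrow> lex_less \<sigma> \<tau> \<or> lex_less \<tau> \<sigma>"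
proof -
  assume "\<sigma> \<noteq> \<tau>"
  then have ex: "\<exists>i. \<sigma> i \<noteq> \<tau> i" by auto
  define i where "i = (LEAST i. \<sigma> i \<noteq> \<tau> i)"
  have "\<sigma> i \<noteq> \<tau> i" unfolding i_def using ex by (rule LeastI_ex)
  moreover have "\<sigma> k = \<tau> k" if "k < i" for k using not_less_Least that unfolding i_def by auto
  ultimately show ?thesis unfolding lex_less_def by (metis linorder_neqE_nat)
qed

text \<open>The position of a permutation in the lexicographic order, so that straightening becomes
  an induction over natural numbers.\<close>

definition lex_rank :: "nat set \<Rightarrow> (nat \<Rightarrow> nat) \<Rightarrow> nat" where
  "lex_rank S \<tau> = card {\<sigma>. \<sigma> permutes S \<and> lex_less \<sigma> \<tau>}"

lemma lex_rank_less:
  assumes "finite S" "\<sigma> permutes S" "lex_less \<sigma> \<tau>"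
  shows "lex_rank S \<sigma> < lex_rank S \<tau>"
  unfolding lex_rank_def
proof (rule psubset_card_mono)
  show "finite {\<sigma>. \<sigma> permutes S \<and> lex_less \<sigma> \<tau>}"
    by (rule finite_subset[OF _ finite_permutations[OF assms(1)]]) auto
  have "\<sigma> \<in> {\<sigma>. \<sigma> permutes S \<and> lex_less \<sigma> \<tau>}" "\<sigma> \<notin> {\<sigma>'. \<sigma>' permutes S \<and> lex_less \<sigma>' \<sigma>}"
    using assms by (auto simp: lex_less_irrefl)
  then show "{\<sigma>'. \<sigma>' permutes S \<and> lex_less \<sigma>' \<sigma>} \<subset> {\<sigma>. \<sigma> permutes S \<and> lex_less \<sigma> \<tau>}"
    using lex_less_trans[OF _ assms(3)] by blast
qed

lemma lex_rank_inj:
  assumes "finite S" "\<sigma> permutes S" "\<tau> permutes S" "lex_rank S \<sigma> = lex_rank S \<tau>"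
  shows "\<sigma> = \<tau>"
  using lex_less_total[of \<sigma> \<tau>] lex_rank_less[OF assms(1,2), of \<tau>] lex_rank_less[OF assms(1,3), of \<sigma>] assms(4)
  by auto

text \<open>A permutation that is increasing on each label class is the lexicographically least one
  inducing the same relabelling.\<close>

lemma labelled_lex_least:
  fixes \<tau> :: "nat \<Rightarrow> nat"
  assumes "\<tau> permutes S" "\<sigma> permutes S"
    and inc: "\<And>i j. i \<in> S \<Longrightarrow> j \<in> S \<Longrightarrow> i < j \<Longrightarrow> q i = q j \<Longrightarrow> \<not> \<tau> j < \<tau> i"
    and eq: "\<And>j. j \<in> S \<Longrightarrow> q j = q (inv \<tau> (\<sigma> j))"
    and "\<not> lex_less \<tau> \<sigma>"
  shows "\<sigma> = \<tau>"
proof (rule ccontr)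
  assume "\<sigma> \<noteq> \<tau>"
  then have "lex_less \<sigma> \<tau>" using lex_less_total assms(5) by blast
  then obtain i where i: "\<forall>k<i. \<sigma> k = \<tau> k" "\<sigma> i < \<tau> i" by (auto simp: lex_less_def)
  have "i \<in> S" using i(2) assms(1,2) by (metis less_irrefl permutes_not_in)
  \<comment> \<open>\<open>k\<close> is the slot at which \<open>\<tau>\<close> takes the value of
    \<open>\<sigma>\<close> at the first difference \<open>i\<close>. It shares the label of
    \<open>i\<close>, so \<open>i < k\<close> would be a descent of \<open>\<tau>\<close> inside a
    label class, while \<open>k < i\<close> contradicts injectivity of
    \<open>\<sigma>\<close>.\<close>
  define k where "k = inv \<tau> (\<sigma> i)"
  have \<tau>k: "\<tau> k = \<sigma> i" using assms(1) by (simp add: k_def permutes_inverses)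
  then have "k \<in> S" using \<open>i \<in> S\<close> assms(1,2) by (metis permutes_in_image)
  have "q i = q k" using eq \<open>i \<in> S\<close> by (simp add: k_def)
  then have "\<not> i < k" using inc[of i k] \<open>i \<in> S\<close> \<open>k \<in> S\<close> \<tau>k i(2) by auto
  moreover have "k \<noteq> i" using \<tau>k i(2) by auto
  ultimately have "\<sigma> k = \<sigma> i" using i(1) \<tau>k by simp
  then show False using \<open>k \<noteq> i\<close> permutes_inj[OF assms(2)] by (simp add: inj_eq)
qed

section \<open>Matrix indices and the diagonal blocks\<close>

definition in_block :: "nat list \<Rightarrow> nat \<Rightarrow> nat \<Rightarrow> bool" where
  "in_block ns a P \<longleftrightarrow> a < length ns \<and> sum_list (take a ns) \<le> P \<and> P < sum_list (take (Suc a) ns)"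

lemma in_block_iff:
  "in_block ns a P \<longleftrightarrow> a < length ns \<and> (\<exists>h < ns ! a. P = sum_list (take a ns) + h)"
  by (auto simp: in_block_def take_Suc_conv_app_nth less_iff_Suc_add le_iff_add)

lemma sum_list_take_mono: "a \<le> b \<Longrightarrow> sum_list (take a ns) \<le> sum_list (take b (ns :: nat list))"
  by (metis le_add1 le_iff_add sum_list_append take_add)

lemma in_block_unique: "in_block ns a P \<Longrightarrow> in_block ns b P \<Longrightarrow> a = b"
proof (rule ccontr)
  assume *: "in_block ns a P" "in_block ns b P" "a \<noteq> b"
  then consider "Suc a \<le> b" | "Suc b \<le> a" by linarith
  then show False
    using sum_list_take_mono[of "Suc a" b ns] sum_list_take_mono[of "Suc b" a ns] *
    by cases (auto simp: in_block_def)
qed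

lemma in_block_less: "in_block ns a P \<Longrightarrow> P < sum_list ns"
  using sum_list_take_mono[of "Suc a" "length ns" ns] by (auto simp: in_block_def)

lemma card_in_block: "a < length ns \<Longrightarrow> card {P. in_block ns a P} = ns ! a"
proof -
  assume "a < length ns"
  then have "{P. in_block ns a P} = {sum_list (take a ns)..<sum_list (take a ns) + ns ! a}"
    by (auto simp: in_block_def take_Suc_conv_app_nth)
  then show ?thesis by simp
qed

lemma finite_in_block: "finite {P. in_block ns a P}"
  by (rule finite_subset[of _ "{..<sum_list ns}"]) (auto dest: in_block_less)

subsection \<open>Trace monomials of permutations\<close>

text \<open>Cuts \<open>j\<close> out of its cycle: the predecessor of \<open>j\<close> is sent to
  \<open>\<tau> j\<close> and \<open>j\<close> becomes fixed. Written as multiplication by a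
  transposition on the left, it visibly commutes with right multiplication by permutations that fix
  \<open>j\<close>.\<close>

definition skip :: "'a \<Rightarrow> ('a \<Rightarrow> 'a) \<Rightarrow> 'a \<Rightarrow> 'a" where
  "skip j \<tau> = transpose j (\<tau> j) \<circ> \<tau>"

lemma skip_apply: "skip j \<tau> i = (if \<tau> i = j then \<tau> j else if \<tau> i = \<tau> j then j else \<tau> i)"
  by (auto simp: skip_def transpose_def)

lemma inj_skip [simp]: "inj \<tau> \<Longrightarrow> inj (skip j \<tau>)"
  unfolding skip_def by (intro inj_compose) auto

lemma skip_self [simp]: "inj \<tau> \<Longrightarrow> skip j \<tau> i = j \<longleftrightarrow> i = j"
  by (auto simp: skip_apply inj_eq)

lemma skip_fixed: "\<tau> j = j \<Longrightarrow> skip j \<tau> = \<tau>"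
  by (auto simp: skip_def)

text \<open>Commutation of \<open>skip j\<close> and \<open>skip k\<close> at one point
  \<open>i\<close>, with \<open>a\<close>, \<open>b\<close>, \<open>c\<close> standing for \<tau> i,
  \<tau> j, \<tau> k.\<close>

lemma transpose_transpose_skip:
  assumes "b \<noteq> c" "j \<noteq> k"
  shows "transpose k (transpose j b c) (transpose j b a) = transpose j (transpose k c b) (transpose k c a)"
  using assms by (cases "a = j"; cases "a = b"; cases "a = k"; cases "a = c"; cases "c = j"; cases "b = k")
    (simp_all add: transpose_def)

lemma skip_commute:
  assumes "inj \<tau>" "j \<noteq> k"
  shows "skip k (skip j \<tau>) = skip j (skip k \<tau>)"
  using transpose_transpose_skip[of "\<tau> j" "\<tau> k" j k] assms
  by (simp add: skip_def fun_eq_iff inj_eq)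

lemma skip_comp: "\<rho> j = j \<Longrightarrow> skip j (\<tau> \<circ> \<rho>) = skip j \<tau> \<circ> \<rho>"
  by (simp add: skip_def comp_assoc)

lemma skip_conj:
  assumes "bij \<pi>"
  shows "skip (\<pi> j) (\<pi> \<circ> \<tau> \<circ> inv \<pi>) = \<pi> \<circ> skip j \<tau> \<circ> inv \<pi>"
proof
  fix i
  have "\<And>u v. \<pi> u = \<pi> v \<longleftrightarrow> u = v" "inv \<pi> (\<pi> j) = j"
    using assms by (simp_all add: bij_is_inj inj_eq)
  then show "skip (\<pi> j) (\<pi> \<circ> \<tau> \<circ> inv \<pi>) i = (\<pi> \<circ> skip j \<tau> \<circ> inv \<pi>) i"
    by (simp add: skip_apply)
qed

lemma skip_permutes:
  assumes "\<tau> permutes S" "j \<in> S"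
  shows "skip j \<tau> permutes S - {j}"
proof -
  have "\<tau> j \<in> S" using assms by (simp add: permutes_in_image)
  then have *: "skip j \<tau> permutes S"
    unfolding skip_def using assms by (intro permutes_compose permutes_swap_id)
  have "skip j \<tau> j = j" using assms by (simp add: permutes_inj)
  then show ?thesis
    by (intro permutes_superset[OF *]) auto
qed

text \<open>The trace takes its values in the ring itself, as for the formal trace of mixed trace
  polynomials. Scalars enter only later.\<close>

locale trace_ring =
  fixes tr :: "'r::{ring,monoid_mult} \<Rightarrow> 'r"
  assumes tr_add: "tr (x + y) = tr x + tr y"
    and tr_comm: "tr (x * y) = tr (y * x)"
    and tr_central: "tr x * y = y * tr x"
    and tr_tr: "tr (tr x * y) = tr x * tr y"
begin

text \<open>The mixed trace monomial of a permutation, computed by eliminating the slots of a list one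
  by one.  For \<^term>\<open>\<tau> permutes insert r (set js)\<close> the value is the product of the traces of the
  cycles of \<^term>\<open>\<tau>\<close> avoiding \<^term>\<open>r\<close>, times the word read along the cycle through
  the open slot, which ends with \<^term>\<open>x r\<close>.  Multiplying an eliminated slot into
  its successor makes elimination commute with right multiplication of \<^term>\<open>\<tau>\<close>
  by permutations of the other slots.\<close>

primrec tmon :: "nat \<Rightarrow> nat list \<Rightarrow> (nat \<Rightarrow> nat) \<Rightarrow> (nat \<Rightarrow> 'r) \<Rightarrow> 'r" where
  "tmon r [] = (\<lambda>\<tau> x. x r)"
| "tmon r (j # js) = (\<lambda>\<tau> x.
      if \<tau> j = j then tr (x j) * tmon r js \<tau> x
      else tmon r js (skip j \<tau>) (x(\<tau> j := x j * x (\<tau> j))))"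

lemma tmon_Nil [simp]: "tmon r [] \<tau> x = x r"
  by simp

lemma tmon_Cons [simp]: "tmon r (j # js) \<tau> x =
    (if \<tau> j = j then tr (x j) * tmon r js \<tau> x
     else tmon r js (skip j \<tau>) (x(\<tau> j := x j * x (\<tau> j))))"
  by simp

declare tmon.simps [simp del]

lemma tr_0 [simp]: "tr 0 = 0"
  using tr_add[of 0 0] by simp

lemma tr_sum: "tr (sum f A) = (\<Sum>i\<in>A. tr (f i))"
  by (induction A rule: infinite_finite_induct) (auto simp: tr_add)

lemma tr_left_comm: "tr x * (tr y * z) = tr y * (tr x * z)"
  by (metis mult.assoc tr_central)

lemma tr_commute_left: "y * (tr x * z) = tr x * (y * z)"
  by (metis mult.assoc tr_central)

text \<open>Elimination never reads \<open>\<tau> r\<close>: the open slot is not eliminated, and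
  nothing depends on where its cycle continues beyond the values on \<open>js\<close>.\<close>

lemma tmon_cong:
  assumes "\<And>i. i \<in> set js \<Longrightarrow> \<tau> i = \<tau>' i" "\<And>i. i \<in> insert r (set js) \<Longrightarrow> x i = x' i"
  shows "tmon r js \<tau> x = tmon r js \<tau>' x'"
  using assms
proof (induction js arbitrary: \<tau> \<tau>' x x')
  case (Cons j js)
  have "tmon r js \<tau> x = tmon r js \<tau>' x'"
    using Cons.prems by (intro Cons.IH) auto
  moreover have "tmon r js (skip j \<tau>) (x(\<tau> j := x j * x (\<tau> j))) =
      tmon r js (skip j \<tau>') (x'(\<tau>' j := x' j * x' (\<tau>' j)))"
    using Cons.prems by (intro Cons.IH) (auto simp: skip_apply fun_upd_apply)
  ultimately show ?case using Cons.prems by simp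
qed simp

text \<open>The cases list how \<open>j\<close> and \<open>k\<close> can be adjacent in cycles of
  \<open>\<tau>\<close>. Consecutive slots of a longer cycle cost associativity only, two fixed
  points use centrality of traces, and the two-cycle is the one place where cyclicity of the trace
  enters.\<close>

lemma tmon_swap:
  assumes "inj \<tau>" "j \<noteq> k" "r \<noteq> j" "r \<noteq> k" "j \<notin> set js" "k \<notin> set js"
  shows "tmon r (j # k # js) \<tau> x = tmon r (k # j # js) \<tau> x"
proof -
  have ne: "\<tau> j \<noteq> \<tau> k" using assms by (simp add: inj_eq)
  have comm: "skip k (skip j \<tau>) = skip j (skip k \<tau>)"
    using assms(1,2) by (rule skip_commute)
  consider (a) "\<tau> j = j" "\<tau> k = k" | (b) "\<tau> j = j" "\<tau> k \<noteq> k" | (c) "\<tau> j \<noteq> j" "\<tau> k = k"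
    | (d) "\<tau> j = k" "\<tau> k = j" | (e) "\<tau> j = k" "\<tau> k \<noteq> j" "\<tau> k \<noteq> k"
    | (f) "\<tau> k = j" "\<tau> j \<noteq> j" "\<tau> j \<noteq> k"
    | (g) "\<tau> j \<notin> {j, k}" "\<tau> k \<notin> {j, k}"
    by auto
  then show ?thesis
  proof cases
    case a
    then show ?thesis by (simp add: tr_left_comm)
  next
    case b
    then have "\<tau> k \<noteq> j" using ne by auto
    with b assms show ?thesis
      by (auto simp: skip_apply)
  next
    case c
    then have "\<tau> j \<noteq> k" using ne by auto
    with c assms show ?thesis by (auto simp: skip_apply)
  next
    case d
    then have "skip j \<tau> = skip k \<tau>"
      by (simp add: skip_def transpose_commute)
    moreover have "skip j \<tau> k = k" "skip j \<tau> j = j"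
      using d assms by (auto simp: skip_apply)
    ultimately have "tmon r (j # k # js) \<tau> x =
        tr (x j * x k) * tmon r js (skip j \<tau>) (x(k := x j * x k))"
      "tmon r (k # j # js) \<tau> x = tr (x k * x j) * tmon r js (skip j \<tau>) (x(j := x k * x j))"
      using d assms by auto
    moreover have "tmon r js (skip j \<tau>) (x(k := x j * x k)) =
        tmon r js (skip j \<tau>) (x(j := x k * x j))"
      using assms by (intro tmon_cong) (auto simp: fun_upd_apply)
    ultimately show ?thesis by (simp add: tr_comm)
  next
    case e
    define l where "l = \<tau> k"
    have l: "l \<noteq> j" "l \<noteq> k" using e by (auto simp: l_def)
    have "tmon r (k # j # js) \<tau> x = tmon r js (skip j (skip k \<tau>)) (x(l := x j * (x k * x l)))"
      using e l assms by (simp add: skip_apply flip: l_def)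
    moreover have "tmon r (j # k # js) \<tau> x =
        tmon r js (skip k (skip j \<tau>)) (x(k := x j * x k, l := x j * (x k * x l)))"
      using e l assms by (simp add: skip_apply mult.assoc flip: l_def)
    moreover have "\<dots> = tmon r js (skip k (skip j \<tau>)) (x(l := x j * (x k * x l)))"
      using assms l by (intro tmon_cong) (auto simp: fun_upd_apply)
    ultimately show ?thesis by (simp add: comm)
  next
    case f
    define l where "l = \<tau> j"
    have l: "l \<noteq> j" "l \<noteq> k" using f by (auto simp: l_def)
    have "tmon r (j # k # js) \<tau> x = tmon r js (skip k (skip j \<tau>)) (x(l := x k * (x j * x l)))"
      using f l assms by (simp add: skip_apply flip: l_def)
    moreover have "tmon r (k # j # js) \<tau> x =
        tmon r js (skip j (skip k \<tau>)) (x(j := x k * x j, l := x k * (x j * x l)))"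
      using f l assms by (simp add: skip_apply mult.assoc flip: l_def)
    moreover have "\<dots> = tmon r js (skip j (skip k \<tau>)) (x(l := x k * (x j * x l)))"
      using assms l by (intro tmon_cong) (auto simp: fun_upd_apply)
    ultimately show ?thesis by (simp add: comm)
  next
    case g
    then show ?thesis using assms ne comm by (auto simp: skip_apply fun_upd_twist)
  qed
qed

lemma tmon_move:
  assumes "inj \<tau>" "distinct (xs @ j # ys)" "r \<notin> set (xs @ j # ys)"
  shows "tmon r (xs @ j # ys) \<tau> x = tmon r (j # xs @ ys) \<tau> x"
  using assms
proof (induction xs arbitrary: \<tau> x)
  case (Cons i xs)
  have "tmon r (i # xs @ j # ys) \<tau> x = tmon r (i # j # xs @ ys) \<tau> x"
    using Cons by simp
  also have "\<dots> = tmon r (j # i # xs @ ys) \<tau> x"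
    using Cons.prems by (intro tmon_swap) auto
  finally show ?case by simp
qed simp

lemma tmon_perm:
  assumes "inj \<tau>" "distinct js" "distinct js'" "set js = set js'" "r \<notin> set js"
  shows "tmon r js \<tau> x = tmon r js' \<tau> x"
  using assms
proof (induction js arbitrary: js' \<tau> x)
  case (Cons j js)
  obtain xs ys where js': "js' = xs @ j # ys"
    using Cons.prems by (metis list.set_intros(1) split_list)
  have "set js = set (xs @ ys)" "distinct (xs @ ys)"
    using Cons.prems js' by auto
  then have "tmon r (j # js) \<tau> x = tmon r (j # xs @ ys) \<tau> x"
    using Cons.prems Cons.IH[of \<tau> "xs @ ys"] Cons.IH[of "skip j \<tau>" "xs @ ys"] js' by auto
  also have "\<dots> = tmon r js' \<tau> x"
    unfolding js' using Cons.prems js' by (intro tmon_move[symmetric]) auto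
  finally show ?case .
qed simp

text \<open>Renaming of slots. It moves the slots of an antisymmetrizer to standard positions and
  brings all terms of an identity to a common arrangement of letters.\<close>

lemma tmon_conj:
  assumes "bij \<pi>"
  shows "tmon (\<pi> r) (map \<pi> js) (\<pi> \<circ> \<tau> \<circ> inv \<pi>) (x \<circ> inv \<pi>) = tmon r js \<tau> x"
proof (induction js arbitrary: \<tau> x)
  case (Cons j js)
  have inj: "\<pi> u = \<pi> v \<longleftrightarrow> u = v" "inv \<pi> (\<pi> u) = u" for u v
    using assms by (simp_all add: bij_is_inj inj_eq)
  have upd: "(x \<circ> inv \<pi>)(\<pi> k := v) = x(k := v) \<circ> inv \<pi>" for k v
  proof -
    have "inv \<pi> i = k \<longleftrightarrow> i = \<pi> k" for i
      using bij_inv_eq_iff[OF assms, of k i] by auto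
    then show ?thesis by (auto simp: fun_eq_iff fun_upd_apply)
  qed
  have pj: "(\<pi> \<circ> \<tau> \<circ> inv \<pi>) (\<pi> j) = \<pi> (\<tau> j)" "(x \<circ> inv \<pi>) (\<pi> i) = x i" for i
    by (simp_all add: inj)
  show ?case
  proof (cases "\<tau> j = j")
    case True
    then show ?thesis
      by (simp only: list.map tmon_Cons pj inj if_True refl Cons.IH)
  next
    case False
    have "tmon (\<pi> r) (map \<pi> (j # js)) (\<pi> \<circ> \<tau> \<circ> inv \<pi>) (x \<circ> inv \<pi>) =
        tmon (\<pi> r) (map \<pi> js) (skip (\<pi> j) (\<pi> \<circ> \<tau> \<circ> inv \<pi>))
          ((x \<circ> inv \<pi>)(\<pi> (\<tau> j) := x j * x (\<tau> j)))"
      unfolding list.map tmon_Cons pj inj using False by (simp only: if_False)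
    also have "\<dots> = tmon r js (skip j \<tau>) (x(\<tau> j := x j * x (\<tau> j)))"
      by (simp only: upd skip_conj[OF assms] Cons.IH)
    also have "\<dots> = tmon r (j # js) \<tau> x" using False by simp
    finally show ?thesis .
  qed
qed (use assms in \<open>simp add: bij_is_inj\<close>)

text \<open>The open slot stands last in the open word, so a right factor of its letter leaves the
  monomial on the right. This is how a monomial with 1 in the open slot is recovered from one with
  an arbitrary letter there.\<close>

lemma tmon_mult_right:
  assumes "r \<notin> set js"
  shows "tmon r js \<tau> (x(r := x r * y)) = tmon r js \<tau> x * y"
  using assms
proof (induction js arbitrary: \<tau> x)
  case (Cons j js)
  have upd: "tmon r js (skip j \<tau>) (x(r := x r * y, \<tau> j := x j * (x(r := x r * y)) (\<tau> j))) =
      tmon r js (skip j \<tau>) (x(\<tau> j := x j * x (\<tau> j))) * y"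
  proof (cases "\<tau> j = r")
    case True
    have "r \<notin> set js" "j \<noteq> r" using Cons.prems by auto
    have "tmon r js (skip j \<tau>) (x(r := x j * x r * y)) = tmon r js (skip j \<tau>) (x(r := x j * x r)) * y"
      using Cons.IH[of "skip j \<tau>" "x(r := x j * x r)"] \<open>r \<notin> set js\<close>
      by (simp only: fun_upd_upd fun_upd_same not_False_eq_True)
    then show ?thesis using True \<open>j \<noteq> r\<close> by (simp add: mult.assoc)
  next
    case False
    then show ?thesis using Cons.prems Cons.IH[of "skip j \<tau>" "x(\<tau> j := x j * x (\<tau> j))"]
      by (simp add: fun_upd_twist)
  qed
  then show ?case using Cons by (auto simp: mult.assoc)
qed simp

text \<open>Every slot occurs exactly once in the traces and the open word. This needs
  \<open>\<tau>\<close> to permute the slots, since otherwise a letter could be merged into a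
  position that is never read.\<close>

lemma tmon_add:
  assumes "i \<in> insert r (set js)" "distinct js" "r \<notin> set js" "\<tau> permutes insert r (set js)"
  shows "tmon r js \<tau> (x(i := u + v)) = tmon r js \<tau> (x(i := u)) + tmon r js \<tau> (x(i := v))"
  using assms
proof (induction js arbitrary: \<tau> x i u v)
  case (Cons j js)
  have j: "j \<notin> insert r (set js)" and "\<tau> j \<in> insert r (set (j # js))"
    using Cons.prems(2,3) permutes_in_image[OF Cons.prems(4), of j] by auto
  have "insert r (set (j # js)) - {j} = insert r (set js)" using Cons.prems by auto
  then have perm: "skip j \<tau> permutes insert r (set js)"
    using skip_permutes[OF Cons.prems(4), of j] by simp
  have IH: "tmon r js (skip j \<tau>) (y(k := u + v)) =
      tmon r js (skip j \<tau>) (y(k := u)) + tmon r js (skip j \<tau>) (y(k := v))"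
    if "k \<in> insert r (set js)" for y k u v
    using Cons.prems perm that by (intro Cons.IH) auto
  have irrel: "tmon r js \<sigma> (y(j := w)) = tmon r js \<sigma> y" for \<sigma> y w
    using j by (intro tmon_cong) (auto simp: fun_upd_apply)
  show ?case
  proof (cases "\<tau> j = j")
    case True
    show ?thesis
    proof (cases "i = j")
      case i: True
      show ?thesis using True by (simp add: i irrel tr_add distrib_right)
    next
      case i: False
      then have "i \<in> insert r (set js)" using Cons.prems(1) by simp
      from IH[OF this] True i show ?thesis by (simp add: skip_fixed distrib_left)
    qed
  next
    case False
    then have k: "\<tau> j \<in> insert r (set js)" using \<open>\<tau> j \<in> _\<close> by auto
    consider "i = j" | "i = \<tau> j" | "i \<noteq> j" "i \<noteq> \<tau> j" by auto
    then show ?thesis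
    proof cases
      case 1
      have "tmon r js (skip j \<tau>) (x(j := w, \<tau> j := z)) = tmon r js (skip j \<tau>) (x(\<tau> j := z))" for w z
        using irrel[of _ "x(\<tau> j := z)"] False by (simp add: fun_upd_twist)
      moreover have "(u + v) * x (\<tau> j) = u * x (\<tau> j) + v * x (\<tau> j)" by (rule distrib_right)
      ultimately show ?thesis using 1 False IH[OF k] by simp
    next
      case 2
      then show ?thesis using False IH[OF k] by (simp add: distrib_left)
    next
      case 3
      then have i: "i \<in> insert r (set js)" using Cons.prems(1) by simp
      have "x(i := w, \<tau> j := z) = x(\<tau> j := z, i := w)" for w z
        using 3 by (intro fun_upd_twist) auto
      then show ?thesis using 3 False IH[OF i] by simp
    qed
  qed
qed simp

lemma tmon_zero:
  assumes "i \<in> insert r (set js)" "distinct js" "r \<notin> set js" "\<tau> permutes insert r (set js)" "x i = 0"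
  shows "tmon r js \<tau> x = 0"
  using tmon_add[OF assms(1-4), of x 0 0] assms(5)
  by (metis add_cancel_right_right fun_upd_triv add.left_neutral)

text \<open>If the open slot is alone in its cycle, all other slots lie in closed cycles. Cutting
  open the cycle through the last slot \<open>k\<close> exhibits their product as the trace of a
  mixed monomial with open slot \<open>k\<close>. This serves antisymmetrizers that do not involve
  the open slot.\<close>

lemma tmon_open_fixed:
  assumes "k \<notin> set js" "r \<notin> set js" "k \<noteq> r" "distinct js" "\<tau> permutes insert r (insert k (set js))" "\<tau> r = r"
  shows "tmon r (js @ [k]) \<tau> x = tr (tmon k js \<tau> x) * x r"
  using assms
proof (induction js arbitrary: \<tau> x)
  case Nil
  have "\<tau> k \<in> {r, k}" using permutes_in_image[OF Nil(5), of k] by auto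
  moreover have "\<tau> k \<noteq> \<tau> r" using permutes_inj[OF Nil(5)] Nil(3) by (simp add: inj_eq)
  ultimately show ?case using Nil by auto
next
  case (Cons j js)
  have "insert r (insert k (set (j # js))) - {j} = insert r (insert k (set js))" using Cons.prems by auto
  then have perm: "skip j \<tau> permutes insert r (insert k (set js))"
    using skip_permutes[OF Cons.prems(5), of j] by simp
  have "\<tau> j \<noteq> \<tau> r" using permutes_inj[OF Cons.prems(5)] Cons.prems(2) by (auto simp: inj_eq)
  then have "\<tau> j \<noteq> r" using Cons.prems(6) by simp
  moreover from this have "skip j \<tau> r = r"
    using Cons.prems by (auto simp: skip_apply)
  ultimately have IH: "tmon r (js @ [k]) (skip j \<tau>) y = tr (tmon k js (skip j \<tau>) y) * y r" for y
    using Cons.prems perm by (intro Cons.IH) auto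
  show ?case
  proof (cases "\<tau> j = j")
    case True
    then show ?thesis using IH[of x] by (simp add: skip_fixed tr_tr mult.assoc)
  next
    case False
    then show ?thesis using IH \<open>\<tau> j \<noteq> r\<close> by simp
  qed
qed

text \<open>The open word starts with the letter of \<open>\<tau> r\<close>. After removing that
  letter, the rest of the word can be read with \<open>k\<close> as open slot, provided
  \<open>k\<close> takes over the letter of \<open>r\<close> as last letter. This moves the open
  slot into the support of an antisymmetrizer.\<close>

lemma tmon_open_move:
  assumes "k \<notin> set js" "r \<notin> set js" "k \<noteq> r" "distinct js" "\<tau> permutes insert r (insert k (set js))" "\<tau> r = k"
  shows "tmon r (js @ [k]) \<tau> x = x k * tmon k js (skip r \<tau>) (x(k := x r))"
  using assms
proof (induction js arbitrary: \<tau> x)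
  case Nil
  have "\<tau> k \<in> {r, k}" using permutes_in_image[OF Nil(5), of k] by auto
  moreover have "\<tau> k \<noteq> \<tau> r" using permutes_inj[OF Nil(5)] Nil(3) by (simp add: inj_eq)
  ultimately show ?case using Nil by auto
next
  case (Cons j js)
  have inj: "inj \<tau>" using Cons.prems by (auto intro: permutes_inj)
  have "insert r (insert k (set (j # js))) - {j} = insert r (insert k (set js))" using Cons.prems by auto
  then have perm: "skip j \<tau> permutes insert r (insert k (set js))"
    using skip_permutes[OF Cons.prems(5), of j] by simp
  have jr: "j \<noteq> r" "j \<noteq> k" using Cons.prems by auto
  have "\<tau> j \<noteq> \<tau> r" using inj jr by (simp add: inj_eq)
  then have jk: "\<tau> j \<noteq> k" using Cons.prems(6) by simp
  have "skip j \<tau> r = k"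
    using Cons.prems jk jr by (auto simp: skip_apply)
  then have IH: "tmon r (js @ [k]) (skip j \<tau>) y = y k * tmon k js (skip r (skip j \<tau>)) (y(k := y r))" for y
    using Cons.prems perm by (intro Cons.IH) auto
  have comm: "skip r (skip j \<tau>) = skip j (skip r \<tau>)" using inj jr by (intro skip_commute) auto
  show ?case
  proof (cases "\<tau> j = j")
    case True
    then have "skip r \<tau> j = j" using Cons.prems jr by (auto simp: skip_apply)
    moreover have "tmon k (j # js) (skip r \<tau>) (x(k := x r)) = tr (x j) * tmon k js (skip r \<tau>) (x(k := x r))"
      using \<open>skip r \<tau> j = j\<close> jr by simp
    ultimately show ?thesis using True IH[of x] comm jr
      by (simp add: skip_fixed tr_commute_left)
  next
    case False
    show ?thesis
    proof (cases "\<tau> j = r")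
      case True
      then have "skip r \<tau> j = k" using Cons.prems by (simp add: skip_apply)
      have "tmon k js \<sigma> (x(r := y, k := w)) = tmon k js \<sigma> (x(k := w))" for \<sigma> y w
        using Cons.prems by (intro tmon_cong) (auto simp: fun_upd_apply)
      then show ?thesis using \<open>skip r \<tau> j = k\<close> True jr jk IH comm Cons.prems by simp
    next
      case f: False
      then have *: "skip r \<tau> j = \<tau> j" using Cons.prems jk by (simp add: skip_apply)
      have "tmon k (j # js) (skip r \<tau>) (x(k := x r)) =
          tmon k js (skip j (skip r \<tau>)) (x(k := x r, \<tau> j := x j * x (\<tau> j)))"
        using False jr jk * by simp
      also have "x(k := x r, \<tau> j := x j * x (\<tau> j)) = x(\<tau> j := x j * x (\<tau> j), k := x r)"
        using jk by (intro fun_upd_twist) auto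
      finally show ?thesis using False f jk IH comm by simp
    qed
  qed
qed

end

section \<open>Transport of signed sums over permutations to another set of slots\<close>

lemma ex_permutes_image:
  assumes "finite A" "finite B" "card A = card B" "a \<in> A" "b \<in> B"
  obtains \<pi> where "\<pi> permutes A \<union> B" "\<pi> ` A = B" "\<pi> a = b"
proof -
  have "card (A - {a}) = card (B - {b})" using assms by simp
  then obtain f where f: "bij_betw f (A - {a}) (B - {b})"
    using assms by (metis finite_Diff finite_same_card_bij)
  have "card (A \<union> B - A) = card (A \<union> B - B)"
    using assms by (simp add: card_Diff_subset)
  then obtain g where g: "bij_betw g (A \<union> B - A) (A \<union> B - B)"
    using assms by (metis finite_Diff finite_UnI finite_same_card_bij)
  define \<pi> where "\<pi> x = (if x = a then b else if x \<in> A then f x else if x \<in> B then g x else x)" for x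
  have "bij_betw \<pi> (A - {a}) (B - {b})"
    using f bij_betw_cong[of "A - {a}" \<pi> f "B - {b}"] by (simp add: \<pi>_def)
  moreover have "bij_betw \<pi> {a} {b}" by (auto simp: \<pi>_def bij_betw_def)
  ultimately have "bij_betw \<pi> ((A - {a}) \<union> {a}) ((B - {b}) \<union> {b})"
    by (rule bij_betw_combine) auto
  then have A: "bij_betw \<pi> A B" using assms by (simp add: insert_absorb)
  moreover have "bij_betw \<pi> (A \<union> B - A) (A \<union> B - B)"
  proof -
    have "\<pi> x = g x" if "x \<in> A \<union> B - A" for x
      using that assms(4) by (auto simp: \<pi>_def)
    then show ?thesis using g bij_betw_cong[of "A \<union> B - A" \<pi> g] by blast
  qed
  ultimately have "bij_betw \<pi> (A \<union> (A \<union> B - A)) (B \<union> (A \<union> B - B))"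
    by (rule bij_betw_combine) auto
  then have "bij_betw \<pi> (A \<union> B) (A \<union> B)" by (simp add: Un_commute Un_left_commute)
  then have "\<pi> permutes A \<union> B"
    by (rule bij_imp_permutes) (use assms in \<open>auto simp: \<pi>_def\<close>)
  moreover have "\<pi> ` A = B" using A by (simp add: bij_betw_def)
  moreover have "\<pi> a = b" by (simp add: \<pi>_def)
  ultimately show thesis by (rule that)
qed

lemma sum_permutes_conj:
  fixes \<pi> :: "nat \<Rightarrow> nat" and F :: "(nat \<Rightarrow> nat) \<Rightarrow> 'b::comm_monoid_add"
  assumes "bij \<pi>" "\<pi> ` D = D'"
  shows "(\<Sum>\<sigma> | \<sigma> permutes D'. F \<sigma>) = (\<Sum>\<sigma> | \<sigma> permutes D. F (\<pi> \<circ> \<sigma> \<circ> inv \<pi>))"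
proof (rule sum.reindex_bij_witness[of _ "\<lambda>\<sigma>. \<pi> \<circ> \<sigma> \<circ> inv \<pi>" "\<lambda>\<sigma>. inv \<pi> \<circ> \<sigma> \<circ> \<pi>"])
  have simps: "\<pi> (inv \<pi> i) = i" "inv \<pi> (\<pi> i) = i" for i
    using assms(1) by (simp_all add: bij_is_inj bij_is_surj surj_f_inv_f)
  have conj: "f \<circ> \<sigma> \<circ> g permutes f ` S"
    if "\<And>i. f (g i) = i" "\<And>i. g (f i) = i" "\<sigma> permutes S" for f g \<sigma> :: "nat \<Rightarrow> nat" and S
  proof (rule bij_imp_permutes)
    have "bij f" "bij g" using that by (auto intro: bij_betw_byWitness[of _ g] bij_betw_byWitness[of _ f])
    then have "bij (f \<circ> \<sigma> \<circ> g)" using permutes_bij[OF that(3)] by (intro bij_comp)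
    moreover have "(f \<circ> \<sigma> \<circ> g) ` f ` S = f ` \<sigma> ` S"
      by (simp add: image_image that(2))
    then have "(f \<circ> \<sigma> \<circ> g) ` f ` S = f ` S"
      by (simp only: permutes_image[OF that(3)])
    ultimately show "bij_betw (f \<circ> \<sigma> \<circ> g) (f ` S) (f ` S)"
      by (auto simp: bij_betw_def intro: inj_on_subset)
  next
    fix i assume "i \<notin> f ` S"
    then have "g i \<notin> S" by (metis imageI that(1))
    then show "(f \<circ> \<sigma> \<circ> g) i = i" using that by (simp add: permutes_not_in)
  qed
  have comp: "\<pi> \<circ> (inv \<pi> \<circ> \<sigma> \<circ> \<pi>) \<circ> inv \<pi> = \<sigma>" "inv \<pi> \<circ> (\<pi> \<circ> \<sigma> \<circ> inv \<pi>) \<circ> \<pi> = \<sigma>" for \<sigma>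
    by (simp_all add: fun_eq_iff simps)
  then show "F (\<pi> \<circ> (inv \<pi> \<circ> \<sigma> \<circ> \<pi>) \<circ> inv \<pi>) = F \<sigma>" for \<sigma> by simp
  show "\<pi> \<circ> (inv \<pi> \<circ> \<sigma> \<circ> \<pi>) \<circ> inv \<pi> = \<sigma>" "inv \<pi> \<circ> (\<pi> \<circ> \<sigma> \<circ> inv \<pi>) \<circ> \<pi> = \<sigma>" for \<sigma>
    by (fact comp)+
  have "inv \<pi> ` D' = D" using assms(2) simps by (auto simp: image_iff)
  then show "inv \<pi> \<circ> \<sigma> \<circ> \<pi> \<in> {\<sigma>. \<sigma> permutes D}" if "\<sigma> \<in> {\<sigma>. \<sigma> permutes D'}" for \<sigma>
    using conj[of "inv \<pi>" \<pi> \<sigma> D'] that simps by simp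
  show "\<pi> \<circ> \<sigma> \<circ> inv \<pi> \<in> {\<sigma>. \<sigma> permutes D'}" if "\<sigma> \<in> {\<sigma>. \<sigma> permutes D}" for \<sigma>
    using conj[of \<pi> "inv \<pi>" \<sigma> D] that simps assms(2) by simp
qed

lemma sign_conj:
  assumes "permutation \<pi>" "permutation \<sigma>"
  shows "sign (\<pi> \<circ> \<sigma> \<circ> inv \<pi>) = sign \<sigma>"
  using assms by (simp add: sign_compose permutation_compose permutation_inverse sign_inverse)

subsection \<open>Antisymmetrizers and the kernel on tensor space\<close>

text \<open>The relations for the sum of the \<open>E_a\<close> and for \<open>tr (E_a)\<close> hold
  with a central idempotent \<open>eps\<close> in place of 1, because the intended instance is one
  factor of a product algebra and \<open>eps\<close> is the unit of that factor.\<close>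

locale etrace_alg = trace_ring tr for tr :: "'r::{ring,monoid_mult} \<Rightarrow> 'r" +
  fixes sc :: "'f::field_char_0 \<Rightarrow> 'r" and ns :: "nat list" and E :: "nat \<Rightarrow> 'r" and eps :: 'r
  assumes sc_add: "sc (c + d) = sc c + sc d"
    and sc_mult: "sc (c * d) = sc c * sc d"
    and sc_one [simp]: "sc 1 = 1"
    and sc_comm: "sc c * x = x * sc c"
    and tr_sc: "tr (sc c * x) = sc c * tr x"
    and E_mult: "E a * E b = (if a = b then E a else 0)"
    and E_out: "length ns \<le> a \<Longrightarrow> E a = 0"
    and eps_sum: "eps = (\<Sum>a<length ns. E a)"
    and eps_comm: "eps * x = x * eps"
    and tr_eps: "tr (eps * x) = eps * tr x"
    and tr_E: "a < length ns \<Longrightarrow> tr (E a) = sc (of_nat (ns ! a)) * eps"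
begin

lemma sc_zero [simp]: "sc 0 = 0"
  using sc_add[of 0 0] by simp

lemma sc_minus: "sc (- c) = - sc c"
  using sc_add[of c "- c"] by (simp add: eq_neg_iff_add_eq_0 add.commute)

lemma sc_sum: "sc (sum f A) = (\<Sum>i\<in>A. sc (f i))"
  by (induction A rule: infinite_finite_induct) (auto simp: sc_add)

lemma sc_left_comm: "x * (sc c * y) = sc c * (x * y)"
  by (metis mult.assoc sc_comm)

lemma sc_cancel:
  assumes "c \<noteq> 0" "sc c * x = 0"
  shows "x = 0"
proof -
  have "sc (inverse c) * (sc c * x) = sc (inverse c * c) * x"
    by (simp add: sc_mult mult.assoc del: left_inverse)
  then show ?thesis using assms by simp
qed

lemma sum_sign_compose_left:
  assumes "finite D" "\<tau> permutes D"
  shows "(\<Sum>\<rho> | \<rho> permutes D. sc (of_int (sign \<rho>)) * F (\<tau> \<circ> \<rho>)) =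
    sc (of_int (sign \<tau>)) * (\<Sum>\<sigma> | \<sigma> permutes D. sc (of_int (sign \<sigma>)) * F \<sigma>)"
proof -
  have "sc (of_int (sign \<rho>)) = sc (of_int (sign \<tau>)) * sc (of_int (sign (\<tau> \<circ> \<rho>)))" if "\<rho> permutes D" for \<rho>
  proof -
    have "sign (\<tau> \<circ> \<rho>) = sign \<tau> * sign \<rho>"
      using that assms by (intro sign_compose) (auto simp: permutation_permutes)
    then show ?thesis by (simp flip: sc_mult of_int_mult)
  qed
  then have "(\<Sum>\<rho> | \<rho> permutes D. sc (of_int (sign \<rho>)) * F (\<tau> \<circ> \<rho>)) =
      sc (of_int (sign \<tau>)) * (\<Sum>\<rho> | \<rho> permutes D. sc (of_int (sign (\<tau> \<circ> \<rho>))) * F (\<tau> \<circ> \<rho>))"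
    unfolding sum_distrib_left by (intro sum.cong) (simp_all add: mult.assoc)
  then show ?thesis
    using setum_permutations_compose_left[OF assms(2), of "\<lambda>\<sigma>. sc (of_int (sign \<sigma>)) * F \<sigma>"] by simp
qed

lemma E_mult_left: "E a * (E b * x) = (if a = b then E a * x else 0)"
  by (simp add: mult.assoc[symmetric] E_mult)

end

text \<open>The assumption expresses the vanishing of the generators through \<open>tmon\<close>:
  the open slot \<open>ns ! a\<close> carries 1, so the sum is the mixed Cayley-Hamilton polynomial
  in the letters of the remaining n_a slots.\<close>

locale ch_alg = etrace_alg tr sc ns E eps
  for tr :: "'r::{ring,monoid_mult} \<Rightarrow> 'r" and sc :: "'f::field_char_0 \<Rightarrow> 'r" and ns E eps +
  assumes CH: "a < length ns \<Longrightarrow> (\<And>i. i < ns ! a \<Longrightarrow> x i = E a * x i * E a) \<Longrightarrow>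
    E a * (\<Sum>\<rho> | \<rho> permutes {..ns ! a}. sc (of_int (sign \<rho>)) *
      tmon (ns ! a) [0..<ns ! a] \<rho> (x(ns ! a := 1))) * E a = 0"
begin

text \<open>The Cayley-Hamilton relation on an arbitrary set of n_a + 1 slots, transported by a
  bijection that sends the open slot to the last position. The open letter is arbitrary up to its
  left colour; it multiplies the relation from the right.\<close>

lemma CH_on:
  assumes a: "a < length ns" and D: "finite D" "r \<in> D" "card D = Suc (ns ! a)"
    and ds: "distinct ds" "set ds = D - {r}"
    and x: "\<And>d. d \<in> D \<Longrightarrow> x d = E a * x d" "\<And>d. d \<in> set ds \<Longrightarrow> x d = x d * E a"
  shows "E a * (\<Sum>\<sigma> | \<sigma> permutes D. sc (of_int (sign \<sigma>)) * tmon r ds \<sigma> x) = 0"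
proof -
  let ?n = "ns ! a"
  obtain \<pi> where \<pi>: "\<pi> permutes D \<union> {..?n}" "\<pi> ` D = {..?n}" "\<pi> r = ?n"
    using ex_permutes_image[of D "{..?n}" r ?n] D by auto
  have bij: "bij \<pi>" using \<pi>(1) by (rule permutes_bij)
  have permn: "permutation \<pi>" 
    unfolding permutation_permutes using \<pi>(1) D(1) by (intro exI[of _ "D \<union> {..?n}"]) simp
  define y where "y = x \<circ> inv \<pi>"
  have y: "y i = E a * y i" if "i \<le> ?n" for i
  proof -
    obtain d where "d \<in> D" "i = \<pi> d" using \<pi>(2) \<open>i \<le> ?n\<close> by (metis atMost_iff imageE)
    then show ?thesis using x(1) bij by (simp add: y_def bij_is_inj)
  qed
  have y': "y i = y i * E a" if "i < ?n" for i
  proof -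
    obtain d where d: "d \<in> D" "i = \<pi> d" using \<pi>(2) \<open>i < ?n\<close> by (metis atMost_iff imageE less_imp_le)
    then have "d \<noteq> r" using \<pi>(3) that by auto
    then have "x d = x d * E a" using d ds x(2) by simp
    then show ?thesis using d bij by (simp add: y_def bij_is_inj)
  qed
  have set: "set (map \<pi> ds) = {..<?n}"
  proof -
    have "\<pi> ` (D - {r}) = {..?n} - {?n}"
      using \<pi> bij by (simp add: image_set_diff bij_is_inj)
    then show ?thesis using ds by (auto simp: lessThan_Suc_atMost[symmetric] lessThan_Suc)
  qed
  have T: "tmon r ds \<sigma> x = tmon ?n [0..<?n] (\<pi> \<circ> \<sigma> \<circ> inv \<pi>) y" if "\<sigma> permutes D" for \<sigma>
  proof -
    have "tmon r ds \<sigma> x = tmon ?n (map \<pi> ds) (\<pi> \<circ> \<sigma> \<circ> inv \<pi>) y"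
      using tmon_conj[OF bij, of r ds \<sigma> x] \<pi>(3) by (simp add: y_def)
    also have "\<dots> = tmon ?n [0..<?n] (\<pi> \<circ> \<sigma> \<circ> inv \<pi>) y"
    proof (rule tmon_perm)
      show "inj (\<pi> \<circ> \<sigma> \<circ> inv \<pi>)"
        using bij that by (intro inj_compose) (auto simp: bij_is_inj bij_imp_bij_inv permutes_inj)
      show "distinct (map \<pi> ds)" using ds bij
        by (simp add: distinct_map inj_on_subset[OF bij_is_inj[OF bij]])
      show "set (map \<pi> ds) = set [0..<?n]" using set by auto
      show "?n \<notin> set (map \<pi> ds)" by (simp only: set) simp
    qed simp
    finally show ?thesis .
  qed
  have "(\<Sum>\<sigma> | \<sigma> permutes D. sc (of_int (sign \<sigma>)) * tmon r ds \<sigma> x) =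
      (\<Sum>\<sigma> | \<sigma> permutes D. sc (of_int (sign (\<pi> \<circ> \<sigma> \<circ> inv \<pi>))) *
        tmon ?n [0..<?n] (\<pi> \<circ> \<sigma> \<circ> inv \<pi>) y)"
  proof (intro sum.cong refl)
    fix \<sigma> assume "\<sigma> \<in> {\<sigma>. \<sigma> permutes D}"
    then have \<sigma>: "\<sigma> permutes D" by simp
    then have "permutation \<sigma>" using D(1) by (auto simp: permutation_permutes)
    from sign_conj[OF permn this] T[OF \<sigma>]
    show "sc (of_int (sign \<sigma>)) * tmon r ds \<sigma> x = sc (of_int (sign (\<pi> \<circ> \<sigma> \<circ> inv \<pi>))) *
        tmon ?n [0..<?n] (\<pi> \<circ> \<sigma> \<circ> inv \<pi>) y"
      by simp
  qed
  also have "\<dots> = (\<Sum>\<rho> | \<rho> permutes {..?n}. sc (of_int (sign \<rho>)) * tmon ?n [0..<?n] \<rho> y)"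
    by (rule sum_permutes_conj[OF bij \<pi>(2), symmetric])
  also have "\<dots> = (\<Sum>\<rho> | \<rho> permutes {..?n}. sc (of_int (sign \<rho>)) *
      tmon ?n [0..<?n] \<rho> (y(?n := 1))) * E a * y ?n"
  proof -
    \<comment> \<open>The left colour of the open letter supplies the right-hand factor
      \<open>E a\<close> of the generator.\<close>
    have "tmon ?n [0..<?n] \<rho> y = tmon ?n [0..<?n] \<rho> (y(?n := 1)) * (E a * y ?n)" for \<rho>
      using tmon_mult_right[of ?n "[0..<?n]" \<rho> "y(?n := 1)" "E a * y ?n"] y[of ?n] by simp
    then show ?thesis by (simp add: sum_distrib_right mult.assoc)
  qed
  finally have sum_eq: "(\<Sum>\<sigma> | \<sigma> permutes D. sc (of_int (sign \<sigma>)) * tmon r ds \<sigma> x) =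
    (\<Sum>\<rho> | \<rho> permutes {..?n}. sc (of_int (sign \<rho>)) * tmon ?n [0..<?n] \<rho> (y(?n := 1))) * E a * y ?n" .
  have "y i = E a * y i * E a" if "i < ?n" for i
    using y[of i, symmetric] y'[OF that, symmetric] that by (simp only: less_imp_le simp_thms)
  from CH[OF a this] have "E a * (\<Sum>\<rho> | \<rho> permutes {..?n}. sc (of_int (sign \<rho>)) *
      tmon ?n [0..<?n] \<rho> (y(?n := 1))) * E a * y ?n = 0"
    by (simp only: mult_zero_left)
  then show ?thesis by (simp only: sum_eq mult.assoc)
qed

text \<open>Eliminating all slots outside \<^term>\<open>D\<close> commutes with the right multiplication by
  permutations of \<^term>\<open>D\<close> and leaves a Cayley-Hamilton polynomial in the merged words.\<close>

lemma antisymmetrizer_eq_0: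
  assumes a: "a < length ns" and D: "finite D" "D \<subseteq> insert r (set js)" "card D = Suc (ns ! a)"
    and js: "distinct js" "r \<notin> set js" "\<tau> permutes insert r (set js)"
    and b: "\<And>d. d \<in> D \<Longrightarrow> b d = a"
    and x: "\<And>j. j \<in> insert r (set js) \<Longrightarrow> x (\<tau> j) = E (b j) * x (\<tau> j)"
      "\<And>j. j \<in> set js \<Longrightarrow> x j = x j * E (b j)"
  shows "E (b r) * (\<Sum>\<rho> | \<rho> permutes D. sc (of_int (sign \<rho>)) * tmon r js (\<tau> \<circ> \<rho>) x) = 0"
proof -
  \<comment> \<open>Slots outside \<open>D\<close> are eliminated before those in \<open>D\<close>.
    Both \<open>\<tau>\<close> and \<open>x\<close> vary in the induction, since each elimination
    changes them.\<close>
  have main: "E (b r) * (\<Sum>\<rho> | \<rho> permutes D. sc (of_int (sign \<rho>)) * tmon r (es @ ds) (\<tau> \<circ> \<rho>) x) = 0"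
    if ds: "set ds = D - {r}" and es: "set es \<inter> D = {}" and dist: "distinct (es @ ds)" "r \<notin> set (es @ ds)"
      and D': "D \<subseteq> insert r (set (es @ ds))"
      and \<tau>: "\<tau> permutes insert r (set (es @ ds))"
      and x1: "\<And>j. j \<in> insert r (set (es @ ds)) \<Longrightarrow> x (\<tau> j) = E (b j) * x (\<tau> j)"
      and x2: "\<And>j. j \<in> set (es @ ds) \<Longrightarrow> x j = x j * E (b j)"
    for es ds \<tau> x
    using es dist D' \<tau> x1 x2
  proof (induction es arbitrary: \<tau> x)
    case (Cons e es)
    \<comment> \<open>Hence \<tau> and \<tau> \<circ> \<rho> agree at \<open>e\<close>, and all
      summands take the same branch of the elimination.\<close>
    have e: "\<rho> e = e" if "\<rho> permutes D" for \<rho>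
      using that Cons.prems(1) by (auto intro: permutes_not_in)
    have set_eq: "insert r (set ((e # es) @ ds)) - {e} = insert r (set (es @ ds))"
      using Cons.prems by auto
    have perm: "skip e \<tau> permutes insert r (set (es @ ds))"
      using skip_permutes[OF Cons.prems(5), of e] set_eq by simp
    show ?case
    proof (cases "\<tau> e = e")
      case True
      have "E (b r) * (\<Sum>\<rho> | \<rho> permutes D. sc (of_int (sign \<rho>)) * tmon r (es @ ds) (\<tau> \<circ> \<rho>) x) = 0"
      proof (rule Cons.IH)
        show "\<tau> permutes insert r (set (es @ ds))" using perm True by (simp add: skip_fixed)
      qed (use Cons.prems in auto)
      then have "tr (x e) * (E (b r) * (\<Sum>\<rho> | \<rho> permutes D.
          sc (of_int (sign \<rho>)) * tmon r (es @ ds) (\<tau> \<circ> \<rho>) x)) = 0" by simp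
      then have "E (b r) * (tr (x e) * (\<Sum>\<rho> | \<rho> permutes D.
          sc (of_int (sign \<rho>)) * tmon r (es @ ds) (\<tau> \<circ> \<rho>) x)) = 0"
        by (simp only: tr_commute_left)
      moreover have "(\<Sum>\<rho> | \<rho> permutes D. sc (of_int (sign \<rho>)) * tmon r ((e # es) @ ds) (\<tau> \<circ> \<rho>) x) =
          tr (x e) * (\<Sum>\<rho> | \<rho> permutes D. sc (of_int (sign \<rho>)) * tmon r (es @ ds) (\<tau> \<circ> \<rho>) x)"
        unfolding sum_distrib_left by (intro sum.cong) (simp_all add: e True tr_commute_left)
      ultimately show ?thesis by (simp only:)
    next
      case False
      let ?k = "\<tau> e"
      define y where "y = x(?k := x e * x ?k)"
      have inj: "inj \<tau>" using Cons.prems(5) by (rule permutes_inj)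
      have "E (b r) * (\<Sum>\<rho> | \<rho> permutes D. sc (of_int (sign \<rho>)) *
          tmon r (es @ ds) (skip e \<tau> \<circ> \<rho>) y) = 0"
      proof (rule Cons.IH[OF _ _ _ _ perm])
        fix j assume j: "j \<in> insert r (set (es @ ds))"
        then have je: "j \<noteq> e" using Cons.prems by auto
        \<comment> \<open>Left colours are attached to predecessors. The merged letter begins with
          the letter of \<open>e\<close>, and the former predecessor of \<open>e\<close> now
          precedes it, so the colours still fit.\<close>
        show "y (skip e \<tau> j) = E (b j) * y (skip e \<tau> j)"
        proof (cases "\<tau> j = e")
          case True
          then have "x e = E (b j) * x e" using Cons.prems(6)[of j] j by auto
          moreover have "y (skip e \<tau> j) = x e * x ?k" using True by (simp add: skip_apply y_def)
          ultimately show ?thesis by (metis mult.assoc)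
        next
          case False
          moreover have "\<tau> j \<noteq> ?k" using je inj by (simp add: inj_eq)
          ultimately have "y (skip e \<tau> j) = x (\<tau> j)" by (simp add: skip_apply y_def)
          then show ?thesis using Cons.prems(6)[of j] j by auto
        qed
      next
        fix j assume j: "j \<in> set (es @ ds)"
        then have "x j = x j * E (b j)" using Cons.prems(7) by auto
        then show "y j = y j * E (b j)"
          by (cases "j = ?k") (simp_all add: y_def mult.assoc)
      qed (use Cons.prems in auto)
      moreover have "tmon r ((e # es) @ ds) (\<tau> \<circ> \<rho>) x = tmon r (es @ ds) (skip e \<tau> \<circ> \<rho>) y"
        if "\<rho> permutes D" for \<rho>
        using e[OF that] False by (simp add: skip_comp y_def)
      then have "(\<Sum>\<rho> | \<rho> permutes D. sc (of_int (sign \<rho>)) * tmon r ((e # es) @ ds) (\<tau> \<circ> \<rho>) x) =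
          (\<Sum>\<rho> | \<rho> permutes D. sc (of_int (sign \<rho>)) * tmon r (es @ ds) (skip e \<tau> \<circ> \<rho>) y)"
        by (intro sum.cong) (simp_all only: mem_Collect_eq)
      ultimately show ?thesis by (simp only:)
    qed
  next
    case Nil
    have dist: "distinct ds" "r \<notin> set ds" using Nil by auto
    have D_sub: "D \<subseteq> insert r (set ([] @ ds))" using Nil by simp
    have xl: "x (\<tau> d) = E a * x (\<tau> d)" if "d \<in> D" for d
      using Nil.prems(6)[OF subsetD[OF D_sub that]] unfolding b[OF that] .
    have xr: "x d = x d * E a" if "d \<in> D" "d \<noteq> r" for d
    proof -
      have "d \<in> set ([] @ ds)" using D_sub that by auto
      from Nil.prems(7)[OF this] show ?thesis unfolding b[OF that(1)] .
    qed
    show ?case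
    proof (cases "r \<in> D")
      case True
      then have D_eq: "insert r (set ds) = D" using ds by auto
      then have \<tau>D: "\<tau> permutes D" using Nil.prems(5) by simp
      have xl': "x d = E a * x d" if "d \<in> D" for d
      proof -
        obtain j where j: "j \<in> D" "d = \<tau> j" using permutes_image[OF \<tau>D] \<open>d \<in> D\<close> by blast
        show ?thesis unfolding j(2) by (rule xl[OF j(1)])
      qed
      have xr': "x d = x d * E a" if "d \<in> set ds" for d
        by (rule xr) (use that ds in auto)
      show ?thesis
        unfolding append_Nil sum_sign_compose_left[OF D(1) \<tau>D, of "\<lambda>\<sigma>. tmon r ds \<sigma> x"]
        using CH_on[OF a D(1) True D(3) dist(1) ds xl' xr'] b[OF True]
        by (simp add: sc_left_comm)
    next
      case False
      then have D_eq: "set ds = D" using ds by auto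
      have \<rho>r: "\<rho> r = r" if "\<rho> permutes D" for \<rho> using that False by (rule permutes_not_in)
      have \<tau>\<rho>: "\<tau> \<circ> \<rho> permutes insert r D" if "\<rho> permutes D" for \<rho>
        using that Nil.prems(5) D_eq by (auto intro!: permutes_compose permutes_subset[OF that])
      have xr': "x d = x d * E a" if "d \<in> D" for d
        by (rule xr) (use that False in auto)
      show ?thesis
      proof (cases "\<tau> r = r")
        case True
        \<comment> \<open>Here the open word is just \<open>x r\<close> in every summand, and the
          slots of \<open>D\<close> form closed cycles. The sum is the trace of a Cayley-Hamilton
          relation, opened at some \<open>k\<close> in \<open>D\<close>, times
          \<open>x r\<close>.\<close>
        have "D \<noteq> {}" using D(3) by auto
        then obtain k where k: "k \<in> D" by auto
        obtain ks where ks: "distinct ks" "set ks = D - {k}"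
          using D(1) finite_distinct_list[of "D - {k}"] by auto
        have \<tau>D: "\<tau> permutes D"
          using Nil.prems(5) D_eq True by (auto intro: permutes_superset[of _ "insert r D"])
        have xl': "x d = E a * x d" if "d \<in> D" for d
        proof -
          obtain j where j: "j \<in> D" "d = \<tau> j" using permutes_image[OF \<tau>D] \<open>d \<in> D\<close> by blast
          show ?thesis unfolding j(2) by (rule xl[OF j(1)])
        qed
        define S where "S = (\<Sum>\<rho> | \<rho> permutes D. sc (of_int (sign \<rho>)) * tmon k ks (\<tau> \<circ> \<rho>) x)"
        have xr'': "x d = x d * E a" if "d \<in> set ks" for d
          by (rule xr') (use that ks in auto)
        \<comment> \<open>The right colour of \<open>x k\<close> gives \<open>S\<close> a right
          factor \<open>E a\<close>; by cyclicity it becomes the left factor required by the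
          relation.\<close>
        have "x(k := x k * E a) = x" unfolding xr'[OF k, symmetric] by simp
        then have "tmon k ks \<sigma> x * E a = tmon k ks \<sigma> x" for \<sigma>
          using tmon_mult_right[of k ks \<sigma> x "E a"] ks by simp
        then have "tr S = tr (S * E a)" by (simp add: S_def sum_distrib_right mult.assoc)
        also have "\<dots> = tr (E a * S)" by (rule tr_comm)
        also have "E a * S = 0"
          using CH_on[OF a D(1) k D(3) ks xl' xr'']
          unfolding S_def sum_sign_compose_left[OF D(1) \<tau>D, of "\<lambda>\<sigma>. tmon k ks \<sigma> x"]
          by (simp add: sc_left_comm)
        finally have "tr S * x r = 0" by simp
        moreover have "tmon r ds (\<tau> \<circ> \<rho>) x = tr (tmon k ks (\<tau> \<circ> \<rho>) x) * x r" if \<rho>: "\<rho> permutes D" for \<rho>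
        proof -
          have "insert r (insert k (set ks)) = insert r D" using k ks by auto
          moreover have "tmon r ds (\<tau> \<circ> \<rho>) x = tmon r (ks @ [k]) (\<tau> \<circ> \<rho>) x"
            using \<tau>\<rho>[OF \<rho>] ks k D_eq dist by (intro tmon_perm) (auto intro: permutes_inj)
          ultimately show ?thesis
            using \<tau>\<rho>[OF \<rho>] ks k False \<rho>r[OF \<rho>] True
            by (subst tmon_open_fixed[symmetric]) auto
        qed
        then have "(\<Sum>\<rho> | \<rho> permutes D. sc (of_int (sign \<rho>)) * tmon r ([] @ ds) (\<tau> \<circ> \<rho>) x) =
            (\<Sum>\<rho> | \<rho> permutes D. sc (of_int (sign \<rho>)) * (tr (tmon k ks (\<tau> \<circ> \<rho>) x) * x r))"
          by (intro sum.cong) (simp_all only: mem_Collect_eq append_Nil)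
        moreover have "tr S * x r = (\<Sum>\<rho> | \<rho> permutes D. sc (of_int (sign \<rho>)) * (tr (tmon k ks (\<tau> \<circ> \<rho>) x) * x r))"
          by (simp only: S_def tr_sum tr_sc sum_distrib_right mult.assoc)
        ultimately show ?thesis by (simp only: mult_zero_right)
      next
        case f: False
        \<comment> \<open>All permutations of \<open>D\<close> fix \<open>r\<close>, so every open
          word starts with the same letter \<open>x (\<tau> r)\<close>. Its removal leaves a
          relation on \<open>D\<close> with open slot \<open>\<tau> r\<close>, and the right colour
          of the removed letter provides the factor \<open>E a\<close> on the left.\<close>
        let ?k = "\<tau> r" and ?\<tau> = "skip r \<tau>" and ?y = "x(\<tau> r := x r)"
        have k: "?k \<in> D" using f permutes_in_image[OF Nil.prems(5), of r] D_eq by auto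
        obtain ks where ks: "distinct ks" "set ks = D - {?k}"
          using D(1) finite_distinct_list[of "D - {?k}"] by auto
        have "insert r D - {r} = D" using False by auto
        then have \<tau>D: "?\<tau> permutes D" using skip_permutes[OF Nil.prems(5), of r] D_eq by simp
        have pre: "\<exists>j\<in>D. d = \<tau> j" if "d \<in> insert r D" "d \<noteq> ?k" for d
        proof -
          have "\<tau> ` insert r D = insert r D" using permutes_image[OF Nil.prems(5)] D_eq by simp
          then show ?thesis using that by auto
        qed
        have yl: "?y d = E a * ?y d" if "d \<in> D" for d
        proof (cases "d = ?k")
          case True
          obtain j where j: "j \<in> D" "r = \<tau> j" using pre[of r] f by auto
          have "x r = E a * x r" using xl[OF j(1)] unfolding j(2)[symmetric] .
          then show ?thesis unfolding True fun_upd_same .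
        next
          case False
          obtain j where j: "j \<in> D" "d = \<tau> j" using pre[of d] False \<open>d \<in> D\<close> by auto
          have "x d = E a * x d" using xl[OF j(1)] unfolding j(2)[symmetric] .
          then show ?thesis unfolding fun_upd_other[OF False] .
        qed
        have yr: "?y d = ?y d * E a" if "d \<in> set ks" for d
        proof -
          have "d \<noteq> ?k" "d \<in> D" using that ks by auto
          then show ?thesis using xr'[of d] by (simp only: fun_upd_other not_False_eq_True)
        qed
        have "E a * (\<Sum>\<rho> | \<rho> permutes D. sc (of_int (sign \<rho>)) * tmon ?k ks (?\<tau> \<circ> \<rho>) ?y) = 0"
          using CH_on[OF a D(1) k D(3) ks yl yr]
          unfolding sum_sign_compose_left[OF D(1) \<tau>D, of "\<lambda>\<sigma>. tmon ?k ks \<sigma> ?y"]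
          by (simp add: sc_left_comm)
        then have "x ?k * E a * (\<Sum>\<rho> | \<rho> permutes D. sc (of_int (sign \<rho>)) * tmon ?k ks (?\<tau> \<circ> \<rho>) ?y) = 0"
          by (simp add: mult.assoc)
        then have "x ?k * (\<Sum>\<rho> | \<rho> permutes D. sc (of_int (sign \<rho>)) * tmon ?k ks (?\<tau> \<circ> \<rho>) ?y) = 0"
          unfolding xr'[OF k, symmetric] .
        moreover have "tmon r ds (\<tau> \<circ> \<rho>) x = x ?k * tmon ?k ks (?\<tau> \<circ> \<rho>) ?y" if \<rho>: "\<rho> permutes D" for \<rho>
        proof -
          have "insert r (insert ?k (set ks)) = insert r D" using k ks by auto
          moreover have "tmon r ds (\<tau> \<circ> \<rho>) x = tmon r (ks @ [?k]) (\<tau> \<circ> \<rho>) x"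
            using \<tau>\<rho>[OF \<rho>] ks k D_eq dist by (intro tmon_perm) (auto intro: permutes_inj)
          moreover have "r \<notin> set ks" using ks False by auto
          ultimately show ?thesis
            using \<tau>\<rho>[OF \<rho>] ks k f \<rho>r[OF \<rho>] tmon_open_move[of ?k ks r "\<tau> \<circ> \<rho>" x]
            by (simp add: skip_comp)
        qed
        then have "(\<Sum>\<rho> | \<rho> permutes D. sc (of_int (sign \<rho>)) * tmon r ([] @ ds) (\<tau> \<circ> \<rho>) x) =
            (\<Sum>\<rho> | \<rho> permutes D. sc (of_int (sign \<rho>)) * (x ?k * tmon ?k ks (?\<tau> \<circ> \<rho>) ?y))"
          by (intro sum.cong) (simp_all only: mem_Collect_eq append_Nil)
        moreover have "\<dots> = x ?k * (\<Sum>\<rho> | \<rho> permutes D. sc (of_int (sign \<rho>)) * tmon ?k ks (?\<tau> \<circ> \<rho>) ?y)"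
          by (simp only: sum_distrib_left sc_left_comm)
        ultimately show ?thesis by (simp only: mult_zero_right)
      qed
    qed
 qed
  obtain ds where ds: "distinct ds" "set ds = D - {r}"
    using D(1) finite_distinct_list[of "D - {r}"] by auto
  obtain es where es: "distinct es" "set es = set js - D"
    using finite_distinct_list[of "set js - D"] by auto
  have set: "set (es @ ds) = set js" using ds es D(2) js(2) by auto
  have eq: "tmon r js (\<tau> \<circ> \<rho>) x = tmon r (es @ ds) (\<tau> \<circ> \<rho>) x" if "\<rho> permutes D" for \<rho>
    using that js ds es set by (intro tmon_perm) (auto intro!: inj_compose dest: permutes_inj)
  have "E (b r) * (\<Sum>\<rho> | \<rho> permutes D. sc (of_int (sign \<rho>)) * tmon r (es @ ds) (\<tau> \<circ> \<rho>) x) = 0"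
    by (rule main) (use ds es set js D x in auto)
  moreover have "(\<Sum>\<rho> | \<rho> permutes D. sc (of_int (sign \<rho>)) * tmon r js (\<tau> \<circ> \<rho>) x) =
      (\<Sum>\<rho> | \<rho> permutes D. sc (of_int (sign \<rho>)) * tmon r (es @ ds) (\<tau> \<circ> \<rho>) x)"
    by (intro sum.cong) (simp_all only: mem_Collect_eq eq)
  ultimately show ?thesis by (simp only:)
qed

end

section \<open>Monomials with clashing colours, and vanishing of kernel elements\<close>

context etrace_alg
begin

text \<open>Two neighbouring letters meet in \<open>E (b j) * E (a (\<tau> j))\<close>, a product of
  distinct idempotents. For the open slot, the left neighbour of the first letter of the open word
  is the external factor \<open>E (b r)\<close>.\<close>

lemma tmon_incompatible:
  assumes js: "distinct js" "r \<notin> set js" "\<tau> permutes insert r (set js)"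
    and x: "\<And>k. k \<in> insert r (set js) \<Longrightarrow> x k = E (a k) * x k"
      "\<And>k. k \<in> set js \<Longrightarrow> x k = x k * E (b k)"
    and j: "j \<in> insert r (set js)" "b j \<noteq> a (\<tau> j)"
  shows "E (b r) * tmon r js \<tau> x = 0"
proof -
  have E0: "E (b j) * x (\<tau> j) = 0"
  proof -
    have "x (\<tau> j) = E (a (\<tau> j)) * x (\<tau> j)"
      using x(1) permutes_in_image[OF js(3)] j(1) by blast
    then have "E (b j) * x (\<tau> j) = E (b j) * (E (a (\<tau> j)) * x (\<tau> j))" by simp
    also have "\<dots> = 0" using j(2) by (simp only: E_mult_left if_False)
    finally show ?thesis .
  qed
  have inj: "inj \<tau>" using js(3) by (rule permutes_inj)
  show ?thesis
  proof (cases "j = r")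
    case True
    then have Er: "E (b r) * x (\<tau> r) = 0" using E0 by simp
    show ?thesis
    proof (cases "\<tau> r = r")
      case True
      then have Er: "E (b r) * x r = 0" using Er by simp
      show ?thesis
      proof (cases js)
        case (Cons k ks)
        have "tmon r js \<tau> x = tmon r (ks @ [k]) \<tau> x"
          using js Cons inj by (intro tmon_perm) auto
        also have "\<dots> = tr (tmon k ks \<tau> x) * x r"
          using js Cons True by (intro tmon_open_fixed) (auto simp: insert_commute)
        finally show ?thesis by (simp only: tr_commute_left Er mult_zero_right)
      qed (use Er in simp)
    next
      case False
      let ?k = "\<tau> r"
      have k: "?k \<in> set js" using False permutes_in_image[OF js(3), of r] by auto
      obtain ks where ks: "distinct ks" "set ks = set js - {?k}"
        using finite_distinct_list[of "set js - {?k}"] by auto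
      have set: "insert r (insert ?k (set ks)) = insert r (set js)" using ks k by auto
      have "tmon r js \<tau> x = tmon r (ks @ [?k]) \<tau> x"
        using js k ks inj by (intro tmon_perm) auto
      also have "\<dots> = x ?k * tmon ?k ks (skip r \<tau>) (x(?k := x r))"
        using js ks False set by (intro tmon_open_move) auto
      finally have "E (b r) * tmon r js \<tau> x = E (b r) * x ?k * tmon ?k ks (skip r \<tau>) (x(?k := x r))"
        by (simp only: mult.assoc)
      then show ?thesis by (simp only: Er mult_zero_left)
    qed
  next
    case False
    then have j': "j \<in> set js" using j(1) by auto
    obtain ks where ks: "distinct ks" "set ks = set js - {j}"
      using finite_distinct_list[of "set js - {j}"] by auto
    have perm: "tmon r js \<tau> x = tmon r (j # ks) \<tau> x"
      using js j' ks inj by (intro tmon_perm) auto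
    have xx: "x j * x (\<tau> j) = 0"
    proof -
      have "x j * x (\<tau> j) = x j * E (b j) * x (\<tau> j)" using x(2)[OF j'] by simp
      then show ?thesis by (simp only: mult.assoc E0 mult_zero_right)
    qed
    have "tmon r (j # ks) \<tau> x = 0"
    proof (cases "\<tau> j = j")
      case True
      have "tr (x j) = tr (x j * E (b j))" using x(2)[OF j'] by simp
      also have "\<dots> = tr (E (b j) * x j)" by (rule tr_comm)
      also have "\<dots> = 0" using E0 True by simp
      finally show ?thesis using True by simp
    next
      case f: False
      have S: "insert r (set js) - {j} = insert r (set ks)" using js ks False by auto
      have "tmon r ks (skip j \<tau>) (x(\<tau> j := x j * x (\<tau> j))) = 0"
      proof (rule tmon_zero[of "\<tau> j"])
        show "\<tau> j \<in> insert r (set ks)" using permutes_in_image[OF js(3), of j] j(1) f S by auto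
        show "skip j \<tau> permutes insert r (set ks)" using skip_permutes[OF js(3) j(1)] S by simp
      qed (use ks js xx in auto)
      then show ?thesis using f by simp
    qed
    then show ?thesis using perm by simp
  qed
qed

end

text \<open>\<open>p j\<close> and \<open>q j\<close> are the row and the column of a matrix unit
  placed in slot \<open>j\<close>, whose letter has left colour \<open>a j\<close> and right colour
  \<open>b j\<close>.\<close>

definition good_pair :: "nat list \<Rightarrow> nat set \<Rightarrow> (nat \<Rightarrow> nat) \<Rightarrow> (nat \<Rightarrow> nat) \<Rightarrow> (nat \<Rightarrow> nat) \<Rightarrow> (nat \<Rightarrow> nat) \<Rightarrow> bool" where
  "good_pair ns S a b p q \<longleftrightarrow> (\<forall>j\<in>S. in_block ns (a j) (p j) \<and> in_block ns (b j) (q j))"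

text \<open>This says that the element of the group algebra with coefficients \<^term>\<open>\<beta>\<close> acts as zero between
  the tensor products of the column spaces of the blocks prescribed by \<^term>\<open>a\<close> and \<^term>\<open>b\<close>.\<close>

definition in_kernel :: "nat list \<Rightarrow> nat set \<Rightarrow> (nat \<Rightarrow> nat) \<Rightarrow> (nat \<Rightarrow> nat) \<Rightarrow> ((nat \<Rightarrow> nat) \<Rightarrow> 'f::field_char_0) \<Rightarrow> bool" where
  "in_kernel ns S a b \<beta> \<longleftrightarrow> (\<forall>p q. good_pair ns S a b p q \<longrightarrow>
     (\<Sum>\<tau> | \<tau> permutes S. \<beta> \<tau> * (if \<forall>j\<in>S. q j = p (\<tau> j) then 1 else 0)) = 0)"

context ch_alg
begin

lemma kernel_eq_0:
  fixes \<beta> :: "(nat \<Rightarrow> nat) \<Rightarrow> 'f"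
  assumes js: "distinct js" "r \<notin> set js"
    and x: "\<And>k. k \<in> insert r (set js) \<Longrightarrow> x k = E (a k) * x k"
      "\<And>k. k \<in> set js \<Longrightarrow> x k = x k * E (b k)"
    and b: "\<And>k. k \<in> insert r (set js) \<Longrightarrow> b k < length ns"
    and \<beta>: "in_kernel ns (insert r (set js)) a b \<beta>"
  shows "E (b r) * (\<Sum>\<tau> | \<tau> permutes insert r (set js). sc (\<beta> \<tau>) * tmon r js \<tau> x) = 0"
proof -
  define S where "S = insert r (set js)"
  have finS: "finite S" by (simp add: S_def)
  have finP: "finite {\<tau>. \<tau> permutes S}" using finS by (rule finite_permutations)
  define T where "T \<tau> = E (b r) * tmon r js \<tau> x" for \<tau>
  define ind where "ind p q \<tau> = (if \<forall>j\<in>S. q j = p (\<tau> j) then 1 else 0 :: 'f)" for p q :: "nat \<Rightarrow> nat" and \<tau>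
  have kerD: "(\<Sum>\<tau> | \<tau> permutes S. \<beta> \<tau> * ind p q \<tau>) = 0"
    if "in_kernel ns S a b \<beta>" "good_pair ns S a b p q" for \<beta> p q
    using that unfolding in_kernel_def ind_def by blast
  have kerI: "in_kernel ns S a b \<beta>"
    if "\<And>p q. good_pair ns S a b p q \<Longrightarrow> (\<Sum>\<tau> | \<tau> permutes S. \<beta> \<tau> * ind p q \<tau>) = 0" for \<beta>
    using that unfolding in_kernel_def ind_def by blast
  have main: "(\<Sum>\<tau> | \<tau> permutes S. sc (\<beta> \<tau>) * T \<tau>) = 0"
    if "in_kernel ns S a b \<beta>" "\<And>\<tau>. \<tau> permutes S \<Longrightarrow> \<beta> \<tau> \<noteq> 0 \<Longrightarrow> lex_rank S \<tau> < M" for M \<beta>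
    using that
  proof (induction M arbitrary: \<beta>)
    case 0
    then have "\<beta> \<tau> = 0" if "\<tau> permutes S" for \<tau> using that by auto
    then show ?case by (intro sum.neutral) auto
  next
    case (Suc M)
    show ?case
    proof (cases "\<exists>\<tau>. \<tau> permutes S \<and> \<beta> \<tau> \<noteq> 0 \<and> lex_rank S \<tau> = M")
      case False
      show ?thesis
        by (rule Suc.IH) (use Suc.prems False less_Suc_eq in blast)+
    next
      case True
      then obtain \<tau> where \<tau>: "\<tau> permutes S" "\<beta> \<tau> \<noteq> 0" "lex_rank S \<tau> = M" by auto
      have other: "lex_rank S \<sigma> < M" if "\<sigma> permutes S" "\<beta> \<sigma> \<noteq> 0" "\<sigma> \<noteq> \<tau>" for \<sigma>
        using Suc.prems(2)[OF that(1,2)] lex_rank_inj[OF finS that(1) \<tau>(1)] \<tau>(3) that(3) by force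
      show ?thesis
      proof (cases "\<exists>j\<in>S. b j \<noteq> a (\<tau> j)")
        case True
        then obtain j where j: "j \<in> S" "b j \<noteq> a (\<tau> j)" by auto
        have T0: "T \<tau> = 0"
          unfolding T_def using tmon_incompatible[of js r \<tau> x a b j] js \<tau>(1) x j unfolding S_def by blast
        define \<beta>' where "\<beta>' = \<beta>(\<tau> := 0)"
        have "(\<Sum>\<sigma> | \<sigma> permutes S. sc (\<beta>' \<sigma>) * T \<sigma>) = 0"
        proof (rule Suc.IH)
          show "in_kernel ns S a b \<beta>'"
          proof (rule kerI)
            fix p q assume pq: "good_pair ns S a b p q"
            have "\<tau> j \<in> S" using \<tau>(1) j(1) by (simp add: permutes_in_image)
            \<comment> \<open>The two indices lie in different blocks, so \<tau> contributes to none
              of the kernel equations either.\<close>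
            then have "q j \<noteq> p (\<tau> j)"
              using pq j in_block_unique[of ns "b j" "q j" "a (\<tau> j)"] unfolding good_pair_def by metis
            then have "ind p q \<tau> = 0" using j(1) by (auto simp: ind_def)
            then have "(\<Sum>\<sigma> | \<sigma> permutes S. \<beta>' \<sigma> * ind p q \<sigma>) = (\<Sum>\<sigma> | \<sigma> permutes S. \<beta> \<sigma> * ind p q \<sigma>)"
              by (intro sum.cong) (auto simp: \<beta>'_def fun_upd_apply)
            then show "(\<Sum>\<sigma> | \<sigma> permutes S. \<beta>' \<sigma> * ind p q \<sigma>) = 0"
              using kerD[OF Suc.prems(1) pq] by simp
          qed
          show "lex_rank S \<sigma> < M" if "\<sigma> permutes S" "\<beta>' \<sigma> \<noteq> 0" for \<sigma>
            using other[of \<sigma>] that by (auto simp: \<beta>'_def fun_upd_apply split: if_splits)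
        qed
        moreover have "(\<Sum>\<sigma> | \<sigma> permutes S. sc (\<beta>' \<sigma>) * T \<sigma>) = (\<Sum>\<sigma> | \<sigma> permutes S. sc (\<beta> \<sigma>) * T \<sigma>)"
          using T0 by (intro sum.cong) (auto simp: \<beta>'_def fun_upd_apply)
        ultimately show ?thesis by simp
      next
        case False
        then have compat: "b j = a (\<tau> j)" if "j \<in> S" for j using that by auto
        from finS show ?thesis
        proof (cases rule: decreasing_or_labelled[where N = "\<lambda>c. ns ! c" and b = b and \<tau> = \<tau>])
          case (dec D c)
          have c: "c < length ns"
          proof -
            have "D \<noteq> {}" using dec(2) by auto
            then show ?thesis using b dec(1,3) unfolding S_def by blast
          qed
          have finD: "finite D" using dec(1) finS finite_subset by blast
          have \<tau>\<rho>: "\<tau> \<circ> \<rho> permutes S" if "\<rho> permutes D" for \<rho>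
            using permutes_subset[OF that dec(1)] \<tau>(1) by (rule permutes_compose)
          \<comment> \<open>The coefficients of \<tau> times the antisymmetrizer on
            \<open>D\<close>, as an element of the group algebra of all permutations of
            \<open>S\<close>.\<close>
          define coef where "coef \<sigma> = (\<Sum>\<rho> | \<rho> permutes D. if \<sigma> = \<tau> \<circ> \<rho> then of_int (sign \<rho>) else 0 :: 'f)" for \<sigma>
          have finD': "finite {\<rho>. \<rho> permutes D}" using finD by (rule finite_permutations)
          have coef_sum: "(\<Sum>\<sigma> | \<sigma> permutes S. coef \<sigma> * F \<sigma>) = (\<Sum>\<rho> | \<rho> permutes D. of_int (sign \<rho>) * F (\<tau> \<circ> \<rho>))"
            for F :: "_ \<Rightarrow> 'f"
          proof -
            have "(\<Sum>\<sigma> | \<sigma> permutes S. coef \<sigma> * F \<sigma>) =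
                (\<Sum>\<rho> | \<rho> permutes D. \<Sum>\<sigma> | \<sigma> permutes S. if \<sigma> = \<tau> \<circ> \<rho> then of_int (sign \<rho>) * F \<sigma> else 0)"
              unfolding coef_def sum_distrib_right by (subst sum.swap) (intro sum.cong, auto)
            also have "\<dots> = (\<Sum>\<rho> | \<rho> permutes D. of_int (sign \<rho>) * F (\<tau> \<circ> \<rho>))"
              using \<tau>\<rho> finP by (intro sum.cong) (auto simp: sum.delta)
            finally show ?thesis .
          qed
          have coef_sum': "(\<Sum>\<sigma> | \<sigma> permutes S. sc (coef \<sigma>) * F \<sigma>) = (\<Sum>\<rho> | \<rho> permutes D. sc (of_int (sign \<rho>)) * F (\<tau> \<circ> \<rho>))"
            for F :: "_ \<Rightarrow> 'r"
          proof -
            have "(\<Sum>\<sigma> | \<sigma> permutes S. sc (coef \<sigma>) * F \<sigma>) =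
                (\<Sum>\<rho> | \<rho> permutes D. \<Sum>\<sigma> | \<sigma> permutes S. if \<sigma> = \<tau> \<circ> \<rho> then sc (of_int (sign \<rho>)) * F \<sigma> else 0)"
              unfolding coef_def sc_sum sum_distrib_right by (subst sum.swap) (intro sum.cong, auto)
            also have "\<dots> = (\<Sum>\<rho> | \<rho> permutes D. sc (of_int (sign \<rho>)) * F (\<tau> \<circ> \<rho>))"
              using \<tau>\<rho> finP by (intro sum.cong) (auto simp: sum.delta)
            finally show ?thesis .
          qed
          have rel: "(\<Sum>\<sigma> | \<sigma> permutes S. sc (coef \<sigma>) * T \<sigma>) = 0"
          proof -
            have "E (b r) * (\<Sum>\<rho> | \<rho> permutes D. sc (of_int (sign \<rho>)) * tmon r js (\<tau> \<circ> \<rho>) x) = 0"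
            proof (rule antisymmetrizer_eq_0[OF c finD _ dec(2) js])
              show "D \<subseteq> insert r (set js)" using dec(1) by (simp add: S_def)
              show "\<tau> permutes insert r (set js)" using \<tau>(1) by (simp add: S_def)
              show "x (\<tau> j) = E (b j) * x (\<tau> j)" if "j \<in> insert r (set js)" for j
              proof -
                have "\<tau> j \<in> insert r (set js)" using that \<tau>(1) unfolding S_def by (simp only: permutes_in_image)
                from x(1)[OF this] show ?thesis using compat[of j] that unfolding S_def by simp
              qed
            qed (use dec(3) x(2) in blast)+
            then show ?thesis
              unfolding coef_sum' T_def by (simp only: sum_distrib_left sc_left_comm)
          qed
          define \<beta>' where "\<beta>' \<sigma> = \<beta> \<sigma> - \<beta> \<tau> * coef \<sigma>" for \<sigma>
          have "(\<Sum>\<sigma> | \<sigma> permutes S. sc (\<beta>' \<sigma>) * T \<sigma>) = 0"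
          proof (rule Suc.IH)
            show "in_kernel ns S a b \<beta>'"
            proof (rule kerI)
              fix p q assume pq: "good_pair ns S a b p q"
              have "q ` D \<subseteq> {P. in_block ns c P}" using pq dec(1,3) unfolding good_pair_def by auto
              moreover have "card {P. in_block ns c P} < card D" using card_in_block[OF c] dec(2) by simp
              ultimately have "(\<Sum>\<rho> | \<rho> permutes D. of_int (sign \<rho>) * ind p q (\<tau> \<circ> \<rho>)) = 0"
                using antisymmetrizer_in_kernel[OF finD dec(1) _ finite_in_block, of q ns c p \<tau>]
                unfolding ind_def comp_apply by blast
              then have "(\<Sum>\<sigma> | \<sigma> permutes S. coef \<sigma> * ind p q \<sigma>) = 0" by (simp only: coef_sum)
              then have "(\<Sum>\<sigma> | \<sigma> permutes S. \<beta> \<tau> * coef \<sigma> * ind p q \<sigma>) = 0"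
                by (simp only: mult.assoc flip: sum_distrib_left) simp
              then show "(\<Sum>\<sigma> | \<sigma> permutes S. \<beta>' \<sigma> * ind p q \<sigma>) = 0"
                using kerD[OF Suc.prems(1) pq] by (simp add: \<beta>'_def left_diff_distrib sum_subtractf)
            qed
            fix \<sigma> assume \<sigma>: "\<sigma> permutes S" "\<beta>' \<sigma> \<noteq> 0"
            \<comment> \<open>Only the identity contributes to the coefficient at \<tau>, so
              subtracting \<open>\<beta> \<tau>\<close> times \<open>coef\<close> cancels the
              leading term exactly.\<close>
            have coef\<tau>: "coef \<tau> = 1"
            proof -
              have "\<tau> = \<tau> \<circ> \<rho> \<longleftrightarrow> \<rho> = id" for \<rho>
                using permutes_inj[OF \<tau>(1)] by (auto simp: fun_eq_iff inj_eq)
              then show ?thesis using finD' by (simp add: coef_def sum.delta permutes_id)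
            qed
            then have "\<sigma> \<noteq> \<tau>" using \<sigma>(2) by (auto simp: \<beta>'_def)
            show "lex_rank S \<sigma> < M"
            proof (cases "\<beta> \<sigma> = 0")
              case True
              then have "coef \<sigma> \<noteq> 0" using \<sigma>(2) by (auto simp: \<beta>'_def)
              then obtain \<rho> where "\<rho> \<in> {\<rho>. \<rho> permutes D}"
                  "(if \<sigma> = \<tau> \<circ> \<rho> then of_int (sign \<rho>) else 0 :: 'f) \<noteq> 0"
                unfolding coef_def by (rule sum.not_neutral_contains_not_neutral)
              then have \<rho>: "\<rho> permutes D" "\<sigma> = \<tau> \<circ> \<rho>" by (auto split: if_splits)
              then have ex: "\<exists>i. \<rho> i \<noteq> i" using \<open>\<sigma> \<noteq> \<tau>\<close> by auto
              \<comment> \<open>The first slot moved by \<rho> can only move upwards, as all smaller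
                slots are fixed. Since \<tau> decreases on \<open>D\<close>, composing with \<rho>
                lowers the value at \<open>i\<close>, which makes the permutation lexicographically
                smaller.\<close>
              define i where "i = (LEAST i. \<rho> i \<noteq> i)"
              have i: "\<rho> i \<noteq> i" unfolding i_def using ex by (rule LeastI_ex)
              have less: "\<rho> k = k" if "k < i" for k using not_less_Least that unfolding i_def by auto
              have "i \<in> D" using i \<rho>(1) by (metis permutes_not_in)
              moreover from this have "\<rho> i \<in> D" using \<rho>(1) by (simp add: permutes_in_image)
              moreover have "i < \<rho> i"
              proof (rule ccontr)
                assume "\<not> i < \<rho> i"
                then have "\<rho> i < i" using i by simp
                then have "\<rho> (\<rho> i) = \<rho> i" by (rule less)
                then show False using i permutes_inj[OF \<rho>(1)] by (simp add: inj_eq)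
              qed
              ultimately have "\<tau> (\<rho> i) < \<tau> i" using dec(4) by blast
              then have "lex_less \<sigma> \<tau>" unfolding lex_less_def \<rho>(2) using less by (intro exI[of _ i]) simp
              then show ?thesis using lex_rank_less[OF finS \<sigma>(1)] \<tau>(3) by blast
            qed (use other[OF \<sigma>(1)] \<open>\<sigma> \<noteq> \<tau>\<close> in blast)
          qed
          moreover have "(\<Sum>\<sigma> | \<sigma> permutes S. sc (\<beta>' \<sigma>) * T \<sigma>) =
              (\<Sum>\<sigma> | \<sigma> permutes S. sc (\<beta> \<sigma>) * T \<sigma>) - sc (\<beta> \<tau>) * (\<Sum>\<sigma> | \<sigma> permutes S. sc (coef \<sigma>) * T \<sigma>)"
          proof -
            have "sc (\<beta>' \<sigma>) * T \<sigma> = sc (\<beta> \<sigma>) * T \<sigma> - sc (\<beta> \<tau>) * (sc (coef \<sigma>) * T \<sigma>)" for \<sigma>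
              unfolding \<beta>'_def diff_conv_add_uminus sc_add sc_minus sc_mult
              by (simp add: distrib_right left_diff_distrib mult.assoc)
            then show ?thesis by (simp add: sum_subtractf sum_distrib_left)
          qed
          ultimately show ?thesis using rel by simp
        next
          case (lab h)
          \<comment> \<open>Slot \<open>j\<close> receives the basis vector with label
            \<open>h j\<close> of block \<open>b j\<close>. Defining \<open>p\<close> by transport
            along \<tau> makes \<tau> contribute 1 to this matrix coefficient; any other permutation
            contributing to it would be lexicographically larger than \<tau> and hence outside the
            support.\<close>
          define q where "q j = sum_list (take (b j) ns) + h j" for j
          define p where "p k = q (inv \<tau> k)" for k
          have q_block: "in_block ns (b j) (q j)" if "j \<in> S" for j
            unfolding in_block_iff q_def using lab(1)[OF that] b that unfolding S_def by blast
          have p\<tau>: "p (\<tau> j) = q j" for j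
            by (simp add: p_def permutes_inverses[OF \<tau>(1)])
          have "in_block ns (a k) (p k)" if "k \<in> S" for k
          proof -
            have "inv \<tau> k \<in> S" using permutes_in_image[OF permutes_inv[OF \<tau>(1)]] that by simp
            then show ?thesis
              using q_block[of "inv \<tau> k"] compat[of "inv \<tau> k"] by (simp add: p_def permutes_inverses[OF \<tau>(1)])
          qed
          then have pq: "good_pair ns S a b p q" using q_block by (simp add: good_pair_def)
          have zero: "\<beta> \<sigma> * ind p q \<sigma> = 0" if "\<sigma> permutes S" "\<sigma> \<noteq> \<tau>" for \<sigma>
          proof (rule ccontr)
            assume "\<beta> \<sigma> * ind p q \<sigma> \<noteq> 0"
            then have nz: "\<beta> \<sigma> \<noteq> 0" and eq: "q j = p (\<sigma> j)" if "j \<in> S" for j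
              using that by (auto simp: ind_def split: if_splits)
            have "r \<in> S" by (simp add: S_def)
            have "\<not> lex_less \<tau> \<sigma>"
              using lex_rank_less[OF finS \<tau>(1), of \<sigma>] other[OF \<open>\<sigma> permutes S\<close> nz[OF \<open>r \<in> S\<close>] \<open>\<sigma> \<noteq> \<tau>\<close>] \<tau>(3) by auto
            moreover have "\<not> \<tau> j < \<tau> i" if "i \<in> S" "j \<in> S" "i < j" "q i = q j" for i j
            proof -
              have "b i = b j"
                using q_block[OF that(1)] q_block[OF that(2)] that(4) by (auto intro: in_block_unique)
              then show ?thesis using lab(2)[OF that(1-3)] that(4) by (auto simp: q_def)
            qed
            ultimately have "\<sigma> = \<tau>"
              using labelled_lex_least[OF \<tau>(1) \<open>\<sigma> permutes S\<close>, of q] eq unfolding p_def by blast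
            then show False using \<open>\<sigma> \<noteq> \<tau>\<close> by simp
          qed
          have "(\<Sum>\<sigma> | \<sigma> permutes S. \<beta> \<sigma> * ind p q \<sigma>) = (\<Sum>\<sigma> | \<sigma> permutes S. if \<sigma> = \<tau> then \<beta> \<tau> else 0)"
            using zero by (intro sum.cong) (auto simp: ind_def p\<tau>)
          also have "\<dots> = \<beta> \<tau>" using finP \<tau>(1) by (simp add: sum.delta)
          finally have "\<beta> \<tau> = 0" using kerD[OF Suc.prems(1) pq] by simp
          then show ?thesis using \<tau>(2) by simp
        qed
      qed
    qed
  qed
  have "(\<Sum>\<tau> | \<tau> permutes S. sc (\<beta> \<tau>) * T \<tau>) = 0"
  proof (rule main)
    show "in_kernel ns S a b \<beta>" using \<beta> by (simp add: S_def)
    show "lex_rank S \<tau> < Suc (Max (lex_rank S ` {\<tau>. \<tau> permutes S}))" if "\<tau> permutes S" for \<tau>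
      using that finP by (simp add: less_Suc_eq_le)
  qed
  then show ?thesis
    by (simp only: T_def S_def sum_distrib_left sc_left_comm)
qed

end

subsection \<open>Cycle decompositions\<close>

text \<open>The map steps through the list and then arrives at \<open>z\<close>. With the head of
  the list as \<open>z\<close> this is a closed cycle; with the open slot as \<open>z\<close> it is
  the open word.\<close>

fun chain :: "('a \<Rightarrow> 'a) \<Rightarrow> 'a list \<Rightarrow> 'a \<Rightarrow> bool" where
  "chain \<tau> [] z \<longleftrightarrow> True"
| "chain \<tau> (j # c) z \<longleftrightarrow> \<tau> j = hd (c @ [z]) \<and> chain \<tau> c z"

text \<open>Used for a cycle \<open>j # c\<close>: after \<open>j\<close> is cut out, the remaining
  list closes up at its own head \<open>\<tau> j\<close>.\<close>

lemma chain_skip_closed: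
  assumes "chain \<tau> c j" "\<tau> j \<notin> set (tl c)" "j \<notin> set c"
  shows "chain (skip j \<tau>) c (\<tau> j)"
  using assms
proof (induction c)
  case (Cons i c)
  then have "chain (skip j \<tau>) c (\<tau> j)" by (cases c) auto
  moreover have "skip j \<tau> i = hd (c @ [\<tau> j])"
    using Cons.prems by (cases c) (auto simp: skip_apply)
  ultimately show ?case by simp
qed simp

lemma chain_skip_open:
  assumes "chain \<tau> c z" "\<tau> j \<notin> set (tl c)" "j \<notin> set c" "j \<noteq> z" "c \<noteq> [] \<Longrightarrow> \<tau> j \<noteq> z"
  shows "chain (skip j \<tau>) c z"
  using assms
proof (induction c)
  case (Cons i c)
  then have "chain (skip j \<tau>) c z" by (cases c) auto
  moreover have "skip j \<tau> i = hd (c @ [z])"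
    using Cons.prems by (cases c) (auto simp: skip_apply)
  ultimately show ?case by simp
qed simp

lemma chain_last: "chain \<tau> c z \<Longrightarrow> c \<noteq> [] \<Longrightarrow> \<tau> (last c) = z"
proof (induction c)
  case (Cons i c)
  then show ?case by (cases c) auto
qed simp

context trace_ring
begin

text \<open>Each slot of the cycle is multiplied into the next, so the last one carries the whole
  product and, being fixed by then, contributes its trace.\<close>

lemma tmon_closed_cycle:
  assumes "inj \<tau>" "c \<noteq> []" "distinct c" "chain \<tau> c (hd c)" "set c \<inter> insert r (set js) = {}"
  shows "tmon r (c @ js) \<tau> x = tr (prod_list (map x c)) * tmon r js \<tau> x"
  using assms
proof (induction "length c" arbitrary: c \<tau> x)
  case (Suc n)
  then obtain j c' where c: "c = j # c'" by (cases c) auto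
  show ?case
  proof (cases c')
    case Nil
    then show ?thesis using Suc.prems c by simp
  next
    case (Cons k c'')
    let ?\<tau> = "skip j \<tau>" and ?x = "x(k := x j * x k)"
    have \<tau>j: "\<tau> j = k" using Suc.prems c Cons by simp
    have "chain ?\<tau> c' (\<tau> j)"
      using Suc.prems c Cons \<tau>j by (intro chain_skip_closed) auto
    then have "tmon r (c' @ js) ?\<tau> ?x = tr (prod_list (map ?x c')) * tmon r js ?\<tau> ?x"
      using Suc.prems Suc.hyps(2) c Cons \<tau>j by (intro Suc.hyps(1)) auto
    moreover have "prod_list (map ?x c') = prod_list (map x c)"
    proof -
      have "map ?x c'' = map x c''"
        using Suc.prems c Cons by (intro map_cong) (auto simp: fun_upd_apply)
      then show ?thesis by (simp add: c Cons mult.assoc del: map_eq_conv)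
    qed
    \<comment> \<open>The only other argument changed by the cut is the predecessor of
      \<open>j\<close>, which lies in the cycle and not in \<open>js\<close>.\<close>
    moreover have "tmon r js ?\<tau> ?x = tmon r js \<tau> x"
    proof (rule tmon_cong)
      fix i assume i: "i \<in> set js"
      obtain l where l: "l \<in> set c" "\<tau> l = j"
      proof -
        have "\<tau> (last c) = hd c" using Suc.prems(2,4) by (intro chain_last)
        then show thesis using that[of "last c"] Suc.prems(2) c by simp
      qed
      have "i \<noteq> l" "i \<noteq> j" using i l(1) Suc.prems(5) c by auto
      then have "\<tau> i \<noteq> j" "\<tau> i \<noteq> \<tau> j"
        unfolding l(2)[symmetric] using Suc.prems(1) l(2) by (auto simp: inj_eq)
      then show "?\<tau> i = \<tau> i" by (simp add: skip_apply)
    next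
      fix i assume "i \<in> insert r (set js)"
      then have "i \<noteq> k" using Suc.prems c Cons by auto
      then show "?x i = x i" by simp
    qed
    ultimately show ?thesis using \<tau>j c Cons Suc.prems(3) by auto
  qed
qed simp

lemma tmon_open_cycle:
  assumes "inj \<tau>" "distinct w" "chain \<tau> w r" "r \<notin> set w"
  shows "tmon r w \<tau> x = prod_list (map x w) * x r"
  using assms
proof (induction w arbitrary: \<tau> x)
  case (Cons j w)
  let ?\<tau> = "skip j \<tau>" and ?x = "x(\<tau> j := x j * x (\<tau> j))"
  have \<tau>j: "\<tau> j = hd (w @ [r])" using Cons.prems by simp
  have ne: "\<tau> j \<noteq> j" using \<tau>j Cons.prems by (cases w) auto
  have "chain ?\<tau> w r"
    using Cons.prems \<tau>j by (intro chain_skip_open) (cases w; auto)+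
  then have "tmon r w ?\<tau> ?x = prod_list (map ?x w) * ?x r"
    using Cons.prems by (intro Cons.IH) auto
  also have "\<dots> = prod_list (map x (j # w)) * x r"
  proof (cases w)
    case (Cons k w')
    have "map ?x w' = map x w'"
      using Cons.prems \<tau>j Cons by (intro map_cong) (auto simp: fun_upd_apply)
    moreover have "r \<noteq> k" using Cons.prems Cons by auto
    ultimately show ?thesis using Cons \<tau>j by (simp add: mult.assoc del: map_eq_conv)
  qed (use \<tau>j in simp)
  finally show ?case using ne by simp
qed simp

lemma tmon_cycles:
  assumes "inj \<tau>" "distinct (concat cs @ w)" "r \<notin> set (concat cs @ w)"
    and "\<And>c. c \<in> set cs \<Longrightarrow> c \<noteq> [] \<and> chain \<tau> c (hd c)" "chain \<tau> w r"
  shows "tmon r (concat cs @ w) \<tau> x =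
    prod_list (map (\<lambda>c. tr (prod_list (map x c))) cs) * (prod_list (map x w) * x r)"
  using assms(2-4)
proof (induction cs)
  case Nil
  then show ?case using assms by (simp add: tmon_open_cycle)
next
  case (Cons c cs)
  then have "tmon r (c @ (concat cs @ w)) \<tau> x = tr (prod_list (map x c)) * tmon r (concat cs @ w) \<tau> x"
    using assms(1) by (intro tmon_closed_cycle) auto
  then show ?case using Cons by (simp add: mult.assoc)
qed

end

lemma cyc_eq_support: "cyc \<tau> i = support \<tau> i"
  by (simp add: cyc_def cyc_len_def least_power_def conj_commute)

context
  fixes \<tau> :: "nat \<Rightarrow> nat" and l :: nat
  assumes \<tau>: "\<tau> permutes {..l}"
begin

lemma perm\<tau>: "permutation \<tau>"
  unfolding permutation_permutes using \<tau> by (intro exI[of _ "{..l}"]) simp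

lemma set_cyc: "set (cyc \<tau> i) = range (\<lambda>k. (\<tau> ^^ k) i)"
  unfolding cyc_eq_support by (rule support_set[OF perm\<tau>])

lemma distinct_cyc: "distinct (cyc \<tau> i)"
  unfolding cyc_eq_support by (rule cycle_of_permutation[OF perm\<tau>])

lemma cyc_Cons: "cyc \<tau> i = i # tl (cyc \<tau> i)"
proof -
  have "least_power \<tau> i > 0" by (rule least_power_of_permutation[OF perm\<tau>])
  then show ?thesis unfolding cyc_eq_support by (cases "least_power \<tau> i") (simp_all add: upt_rec[of 0] del: upt_Suc)
qed

lemma chain_upt:
  "chain \<tau> (map (\<lambda>k. (\<tau> ^^ k) i) [m..<n]) ((\<tau> ^^ n) i)"
proof (induction "n - m" arbitrary: m)
  case (Suc d)
  then have mn: "m < n" by simp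
  have IH: "chain \<tau> (map (\<lambda>k. (\<tau> ^^ k) i) [Suc m..<n]) ((\<tau> ^^ n) i)"
    using Suc(2) by (intro Suc(1)) simp
  have "\<tau> ((\<tau> ^^ m) i) = hd (map (\<lambda>k. (\<tau> ^^ k) i) [Suc m..<n] @ [(\<tau> ^^ n) i])"
  proof (cases "Suc m < n")
    case True
    then show ?thesis by (simp add: upt_conv_Cons)
  next
    case False
    then have "n = Suc m" using mn by simp
    then show ?thesis by simp
  qed
  then show ?case using IH mn by (simp add: upt_conv_Cons)
qed simp

lemma chain_cyc: "chain \<tau> (cyc \<tau> i) i"
  using chain_upt[of i 0 "least_power \<tau> i"] least_power_of_permutation(1)[OF perm\<tau>, of i]
  unfolding cyc_eq_support by simp

lemma chain_tl_cyc: "chain \<tau> (tl (cyc \<tau> i)) i"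
  using chain_cyc[of i] cyc_Cons[of i] by (metis chain.simps(2))

lemma funpow_in: "i \<le> l \<Longrightarrow> (\<tau> ^^ k) i \<le> l"
  using permutes_in_image[OF permutes_funpow[OF \<tau>, of k], of i] by simp

lemma cyc_disjoint_iff: "set (cyc \<tau> i) \<inter> set (cyc \<tau> j) = {} \<longleftrightarrow> i \<notin> set (cyc \<tau> j)"
  unfolding cyc_eq_support by (rule disjoint_support'[OF perm\<tau>])

definition closed_leaders where
  "closed_leaders = filter (\<lambda>i. l \<notin> set (cyc \<tau> i)) (cyc_leaders \<tau> (Suc l))"

text \<open>A leader is the least element of its cycle, so different leaders have disjoint cycles,
  and the minimum of any cycle avoiding \<open>l\<close> is a leader. The cycle through
  \<open>l\<close> contributes all its elements except \<open>l\<close> itself.\<close>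

lemma cycles_partition:
  "distinct (concat (map (cyc \<tau>) closed_leaders) @ tl (cyc \<tau> l))"
  "set (concat (map (cyc \<tau>) closed_leaders) @ tl (cyc \<tau> l)) = {..<l}"
proof -
  have leader: "i \<le> l" "\<And>k. i \<le> (\<tau> ^^ k) i" "l \<notin> set (cyc \<tau> i)" if "i \<in> set closed_leaders" for i
    using that unfolding closed_leaders_def cyc_leaders_def by (auto simp del: upt_Suc)
  have disj: "set (cyc \<tau> i) \<inter> set (cyc \<tau> j) = {}"
    if "i \<in> set closed_leaders" "j \<in> set closed_leaders" "i \<noteq> j" for i j
  proof (rule ccontr)
    assume "set (cyc \<tau> i) \<inter> set (cyc \<tau> j) \<noteq> {}"
    then have "i \<in> set (cyc \<tau> j)" "j \<in> set (cyc \<tau> i)"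
      using cyc_disjoint_iff by blast+
    then obtain m m' where "i = (\<tau> ^^ m) j" "j = (\<tau> ^^ m') i" unfolding set_cyc by blast
    then have "j \<le> i" "i \<le> j" using leader(2)[OF that(1), of m'] leader(2)[OF that(2), of m] by simp_all
    then show False using that by simp
  qed
  have dist: "distinct (concat (map (cyc \<tau>) is))" if "set is \<subseteq> set closed_leaders" "distinct is" for "is"
    using that
  proof (induction "is")
    case (Cons i "is")
    then have "set (cyc \<tau> i) \<inter> set (cyc \<tau> j) = {}" if "j \<in> set is" for j
      using that disj by auto
    then show ?case using Cons distinct_cyc by auto
  qed simp
  have dl: "distinct closed_leaders"
    by (simp add: closed_leaders_def cyc_leaders_def del: upt_Suc)
  have open_disj: "set (cyc \<tau> l) \<inter> set (cyc \<tau> i) = {}" if "i \<in> set closed_leaders" for i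
    using leader(3)[OF that] cyc_disjoint_iff by blast
  have tl_sub: "set (tl (cyc \<tau> l)) \<subseteq> set (cyc \<tau> l)" by (metis cyc_Cons set_subset_Cons)
  have "distinct (tl (cyc \<tau> l))" using distinct_cyc distinct_tl by blast
  then show "distinct (concat (map (cyc \<tau>) closed_leaders) @ tl (cyc \<tau> l))"
    using dist[OF subset_refl dl] open_disj tl_sub by auto
  have l_tl: "l \<notin> set (tl (cyc \<tau> l))" using distinct_cyc[of l] cyc_Cons[of l] by (metis distinct.simps(2))
  show "set (concat (map (cyc \<tau>) closed_leaders) @ tl (cyc \<tau> l)) = {..<l}"
  proof (intro equalityI subsetI)
    fix j assume j: "j \<in> set (concat (map (cyc \<tau>) closed_leaders) @ tl (cyc \<tau> l))"
    have "j \<noteq> l" using j leader(3) l_tl by auto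
    moreover have "j \<le> l"
      using j leader(1) funpow_in tl_sub by (auto simp: set_cyc dest!: subsetD)
    ultimately show "j \<in> {..<l}" by simp
  next
    fix j assume "j \<in> {..<l}"
    then have j: "j < l" by simp
    show "j \<in> set (concat (map (cyc \<tau>) closed_leaders) @ tl (cyc \<tau> l))"
    proof (cases "j \<in> set (cyc \<tau> l)")
      case True
      then show ?thesis using j cyc_Cons[of l] by (metis UnI2 less_irrefl set_ConsD set_append)
    next
      case False
      define i where "i = Min (set (cyc \<tau> j))"
      have ne: "set (cyc \<tau> j) \<noteq> {}" by (subst cyc_Cons) simp
      then have i: "i \<in> set (cyc \<tau> j)" unfolding i_def by (intro Min_in) auto
      then have meet: "set (cyc \<tau> i) \<inter> set (cyc \<tau> j) \<noteq> {}" using cyc_disjoint_iff by blast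
      then have ji: "j \<in> set (cyc \<tau> i)" using cyc_disjoint_iff by blast
      have sub: "set (cyc \<tau> i) \<subseteq> set (cyc \<tau> j)"
      proof
        fix k assume "k \<in> set (cyc \<tau> i)"
        then obtain m where m: "k = (\<tau> ^^ m) i" by (auto simp: set_cyc)
        obtain m' where "i = (\<tau> ^^ m') j" using i by (auto simp: set_cyc)
        then have "k = (\<tau> ^^ (m + m')) j" using m by (simp add: funpow_add)
        then show "k \<in> set (cyc \<tau> j)" by (auto simp: set_cyc)
      qed
      have "i \<le> (\<tau> ^^ k) i" for k
      proof -
        have "(\<tau> ^^ k) i \<in> set (cyc \<tau> j)" using sub by (auto simp: set_cyc)
        then show ?thesis unfolding i_def by (intro Min_le) auto
      qed
      moreover have "i \<le> l" using i j funpow_in[of j] by (auto simp: set_cyc)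
      moreover have "l \<notin> set (cyc \<tau> i)"
      proof
        assume "l \<in> set (cyc \<tau> i)"
        then have "l \<in> set (cyc \<tau> j)" using sub by blast
        then have "set (cyc \<tau> l) \<inter> set (cyc \<tau> j) \<noteq> {}" using cyc_disjoint_iff by blast
        then show False using False cyc_disjoint_iff by blast
      qed
      ultimately have "i \<in> set closed_leaders" by (simp add: closed_leaders_def cyc_leaders_def del: upt_Suc)
      then show ?thesis using ji by auto
    qed
  qed
qed

text \<open>Identifies the value computed by elimination with the cycle formula from which
  \<open>MCH\<close> is built.\<close>

lemma tmon_eq_cycles:
  assumes "trace_ring tr"
  shows "trace_ring.tmon tr l [0..<l] \<tau> x =
    prod_list (map (\<lambda>i. tr (prod_list (map x (cyc \<tau> i)))) closed_leaders) *
      (prod_list (map x (tl (cyc \<tau> l))) * x l)"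
proof -
  interpret trace_ring tr by (fact assms)
  have inj: "inj \<tau>" using \<tau> by (rule permutes_inj)
  have "l \<notin> {..<l}" by simp
  then have l: "l \<notin> set (concat (map (cyc \<tau>) closed_leaders) @ tl (cyc \<tau> l))"
    by (simp only: cycles_partition(2)) simp
  have "tmon l [0..<l] \<tau> x = tmon l (concat (map (cyc \<tau>) closed_leaders) @ tl (cyc \<tau> l)) \<tau> x"
    using inj cycles_partition by (intro tmon_perm) auto
  also have "\<dots> = prod_list (map (\<lambda>c. tr (prod_list (map x c))) (map (cyc \<tau>) closed_leaders)) *
      (prod_list (map x (tl (cyc \<tau> l))) * x l)"
  proof (rule tmon_cycles[OF inj cycles_partition(1) l _ chain_tl_cyc])
    show "c \<noteq> [] \<and> chain \<tau> c (hd c)" if c: "c \<in> set (map (cyc \<tau>) closed_leaders)" for c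
    proof -
      obtain i where i: "c = cyc \<tau> i" using c by auto
      have "hd c = i" "c \<noteq> []" unfolding i by (subst cyc_Cons, simp)+
      then show ?thesis using chain_cyc[of i] i by simp
    qed
  qed
  finally show ?thesis by (simp add: comp_def)
qed

end

lemma perm_of_list_permutes:
  assumes "set p = {0..<n}" "distinct p"
  shows "perm_of_list p permutes {..<n}"
proof -
  have len: "length p = n" using assms by (metis card_atLeastLessThan diff_zero distinct_card)
  have "bij_betw (perm_of_list p) {..<n} {..<n}"
  proof -
    have "bij_betw ((!) p) {..<length p} (set p)" using assms by (simp add: bij_betw_nth)
    then have "bij_betw ((!) p) {..<n} {..<n}" using assms len by (simp add: atLeast0LessThan)
    then show ?thesis
      by (subst bij_betw_cong[of _ _ "(!) p"]) (auto simp: perm_of_list_def len)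
  qed
  then show ?thesis by (rule bij_imp_permutes) (simp add: perm_of_list_def len)
qed

lemma sum_list_permutations:
  fixes F :: "(nat \<Rightarrow> nat) \<Rightarrow> 'b::comm_monoid_add"
  shows "sum_list (map (\<lambda>p. F (perm_of_list p)) (permutations_of_set_list [0..<n])) =
    (\<Sum>\<sigma> | \<sigma> permutes {..<n}. F \<sigma>)"
proof -
  have set: "set (permutations_of_set_list [0..<n]) = {p. set p = {0..<n} \<and> distinct p}"
    using permutations_of_list[of "[0..<n]"] by (simp add: permutations_of_set_def)
  have "sum_list (map (\<lambda>p. F (perm_of_list p)) (permutations_of_set_list [0..<n])) =
      (\<Sum>p \<in> {p. set p = {0..<n} \<and> distinct p}. F (perm_of_list p))"
    unfolding set[symmetric]
    by (rule sum.distinct_set_conv_list[symmetric]) (simp add: distinct_permutations_of_set_list)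
  also have "\<dots> = (\<Sum>\<sigma> | \<sigma> permutes {..<n}. F \<sigma>)"
  proof (rule sum.reindex_bij_witness[of _ "\<lambda>\<sigma>. map \<sigma> [0..<n]" perm_of_list])
    fix p assume "p \<in> {p. set p = {0..<n} \<and> distinct p}"
    then have p: "set p = {0..<n}" "distinct p" by auto
    then have len: "length p = n" by (metis card_atLeastLessThan diff_zero distinct_card)
    show "map (perm_of_list p) [0..<n] = p"
      by (rule nth_equalityI) (auto simp: perm_of_list_def len)
    show "perm_of_list p \<in> {\<sigma>. \<sigma> permutes {..<n}}" using perm_of_list_permutes[OF p] by simp
  next
    fix \<sigma> assume "\<sigma> \<in> {\<sigma>. \<sigma> permutes {..<n}}"
    then have \<sigma>: "\<sigma> permutes {..<n}" by simp
    show "perm_of_list (map \<sigma> [0..<n]) = \<sigma>"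
      using \<sigma> by (auto simp: fun_eq_iff perm_of_list_def permutes_not_in)
    show "map \<sigma> [0..<n] \<in> {p. set p = {0..<n} \<and> distinct p}"
      using permutes_image[OF \<sigma>] permutes_inj[OF \<sigma>]
      by (auto simp: distinct_map atLeast0LessThan intro: inj_on_subset)
  qed simp
  finally show ?thesis .
qed

section \<open>Evaluation of E-trace polynomials in an abstract algebra\<close>

context etrace_alg
begin

text \<open>Variables and constants are cut down by \<open>eps\<close>, so all values lie in the
  factor whose unit is \<open>eps\<close>.\<close>

primrec ev :: "(nat \<Rightarrow> 'r) \<Rightarrow> 'f etp \<Rightarrow> 'r" where
  "ev y (Var i) = eps * y i"
| "ev y (etp.E a) = E a"
| "ev y (Const c) = sc c * eps"
| "ev y (Add u v) = ev y u + ev y v"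
| "ev y (Mult u v) = ev y u * ev y v"
| "ev y (Tr u) = tr (ev y u)"

lemma eps_E: "eps * E a = E a"
proof (cases "a < length ns")
  case True
  have "eps * E a = (\<Sum>b<length ns. if b = a then E a else 0)"
    unfolding eps_sum sum_distrib_right by (intro sum.cong) (auto simp: E_mult)
  then show ?thesis using True by simp
qed (simp add: E_out)

lemma E_eps: "E a * eps = E a"
  using eps_comm[of "E a"] eps_E by simp

lemma eps_eps: "eps * eps = eps"
proof -
  have "eps * eps = (\<Sum>a<length ns. eps * E a)"
    by (subst (2) eps_sum) (rule sum_distrib_left)
  then show ?thesis by (simp only: eps_E flip: eps_sum)
qed

lemma eps_absorb: "x * eps * (y * eps) = x * y * eps"
  by (metis eps_comm eps_eps mult.assoc)

lemma eps_ev: "eps * ev y f = ev y f"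
proof (induction f)
  case (Var i)
  show ?case by (simp add: eps_eps flip: mult.assoc)
next
  case (Const c)
  show ?case by (simp add: sc_left_comm eps_eps)
next
  case (Mult u v)
  then show ?case by (metis ev.simps(5) mult.assoc)
next
  case (Tr u)
  then show ?case by (simp only: ev.simps tr_eps[symmetric])
qed (simp_all add: eps_E distrib_left)

lemma ev_eps: "ev y f * eps = ev y f"
  using eps_comm[of "ev y f"] eps_ev by simp

lemma ev_sumT: "ev y (sumT us) = sum_list (map (ev y) us)"
  by (induction us) (simp_all add: sumT_def)

text \<open>The factor \<open>eps\<close> comes from the final \<open>Const 1\<close> of the
  product; it is absorbed as soon as the product is nonempty.\<close>

lemma ev_prodT: "ev y (prodT us) = prod_list (map (ev y) us) * eps"
  by (induction us) (simp_all add: prodT_def mult.assoc)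

lemma prod_list_eps: "us \<noteq> [] \<Longrightarrow> prod_list (map (ev y) us) * eps = prod_list (map (ev y) us)"
  by (induction us rule: rev_nonempty_induct) (simp_all add: ev_eps mult.assoc)

text \<open>\<open>MCH\<close> reads the cycles of the inverse permutation, whereas
  \<open>tmon\<close> reads those of its argument. Inversion is a bijection that preserves signs, so
  the sums agree. The open slot holds 1 because the variable of index \<open>length us\<close> has
  been stripped off.\<close>

lemma ev_MCH:
  assumes x: "\<And>j. j < length us \<Longrightarrow> x j = ev y (us ! j)"
  shows "ev y (MCH us) = (\<Sum>\<sigma> | \<sigma> permutes {..length us}. sc (of_int (sign \<sigma>)) *
      tmon (length us) [0..<length us] \<sigma> (x(length us := 1))) * eps"
proof -
  let ?l = "length us" and ?x = "x(length us := 1)"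
  define F where "F \<tau> = tmon ?l [0..<?l] \<tau> ?x * eps" for \<tau>
  define P where "P \<tau> = Mult (prodT (map (\<lambda>i. Tr (prodT (map (\<lambda>j. us ! j) (cyc \<tau> i))))
      (filter (\<lambda>i. ?l \<notin> set (cyc \<tau> i)) (cyc_leaders \<tau> (Suc ?l)))))
      (prodT (map (\<lambda>j. us ! j) (tl (cyc \<tau> ?l))))" for \<tau>
  have P: "ev y (P \<tau>) = F \<tau>" if \<tau>: "\<tau> permutes {..?l}" for \<tau>
  proof -
    have sub: "j < ?l" if "i \<in> set (closed_leaders \<tau> ?l)" "j \<in> set (cyc \<tau> i)" for i j
      using cycles_partition(2)[OF \<tau>] that by auto
    have sub': "j < ?l" if "j \<in> set (tl (cyc \<tau> ?l))" for j
      using cycles_partition(2)[OF \<tau>] that by auto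
    have closed: "ev y (prodT (map (\<lambda>j. us ! j) (cyc \<tau> i))) = prod_list (map ?x (cyc \<tau> i))"
      if "i \<in> set (closed_leaders \<tau> ?l)" for i
    proof -
      have ne: "cyc \<tau> i \<noteq> []" by (subst cyc_Cons[OF \<tau>]) simp
      have "map (\<lambda>j. ev y (us ! j)) (cyc \<tau> i) = map ?x (cyc \<tau> i)"
        using sub[OF that] x by (intro map_cong) (auto simp: fun_upd_apply)
      then show ?thesis
        using prod_list_eps[of "map (\<lambda>j. us ! j) (cyc \<tau> i)" y] ne by (simp add: ev_prodT comp_def del: map_eq_conv)
    qed
    have "ev y (prodT (map (\<lambda>i. Tr (prodT (map (\<lambda>j. us ! j) (cyc \<tau> i)))) (closed_leaders \<tau> ?l))) =
        prod_list (map (\<lambda>i. tr (prod_list (map ?x (cyc \<tau> i)))) (closed_leaders \<tau> ?l)) * eps"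
    proof -
      have "map (\<lambda>i. tr (ev y (prodT (map (\<lambda>j. us ! j) (cyc \<tau> i))))) (closed_leaders \<tau> ?l) =
          map (\<lambda>i. tr (prod_list (map ?x (cyc \<tau> i)))) (closed_leaders \<tau> ?l)"
        by (intro map_cong refl) (simp only: closed)
      then show ?thesis by (simp add: ev_prodT comp_def del: map_eq_conv)
    qed
    moreover have "ev y (prodT (map (\<lambda>j. us ! j) (tl (cyc \<tau> ?l)))) = prod_list (map ?x (tl (cyc \<tau> ?l))) * eps"
    proof -
      have "map (\<lambda>j. ev y (us ! j)) (tl (cyc \<tau> ?l)) = map ?x (tl (cyc \<tau> ?l))"
        using sub' x by (intro map_cong) (auto simp: fun_upd_apply)
      then show ?thesis by (simp add: ev_prodT comp_def del: map_eq_conv)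
    qed
    ultimately show ?thesis
      unfolding P_def F_def tmon_eq_cycles[OF \<tau> trace_ring_axioms]
      by (simp only: ev.simps eps_absorb fun_upd_same mult_1_right flip: closed_leaders_def[OF \<tau>])
  qed
  have "ev y (MCH us) = sum_list (map (\<lambda>p. ev y (Mult (Const (of_int (sign (perm_of_list p))))
      (P (inv (perm_of_list p))))) (permutations_of_set_list [0..<Suc ?l]))"
    by (simp add: MCH_def Let_def ev_sumT comp_def P_def del: ev.simps)
  also have "\<dots> = (\<Sum>\<sigma> | \<sigma> permutes {..<Suc ?l}. ev y (Mult (Const (of_int (sign \<sigma>))) (P (inv \<sigma>))))"
    by (rule sum_list_permutations)
  also have "\<dots> = (\<Sum>\<sigma> | \<sigma> permutes {..?l}. sc (of_int (sign (inv \<sigma>))) * F (inv \<sigma>))"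
    unfolding lessThan_Suc_atMost
  proof (intro sum.cong refl)
    fix \<sigma> assume "\<sigma> \<in> {\<sigma>. \<sigma> permutes {..?l}}"
    then have \<sigma>: "\<sigma> permutes {..?l}" by simp
    have "sign (inv \<sigma>) = sign \<sigma>" by (rule sign_inverse[OF perm\<tau>[OF \<sigma>]])
    moreover have "eps * F (inv \<sigma>) = F (inv \<sigma>)"
      using P[OF permutes_inv[OF \<sigma>]] eps_ev[of y] by metis
    ultimately show "ev y (Mult (Const (of_int (sign \<sigma>))) (P (inv \<sigma>))) = sc (of_int (sign (inv \<sigma>))) * F (inv \<sigma>)"
      by (simp add: P[OF permutes_inv[OF \<sigma>]] mult.assoc)
  qed
  also have "\<dots> = (\<Sum>\<sigma> | \<sigma> permutes {..?l}. sc (of_int (sign \<sigma>)) * F \<sigma>)"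
    by (rule sum_permutations_inverse[symmetric])
  finally show ?thesis by (simp add: F_def sum_distrib_right mult.assoc)
qed

end

subsection \<open>Normal form of E-trace polynomials\<close>

type_synonym letter = "nat \<times> nat \<times> nat"

context etrace_alg
begin

lemma ev_generator:
  assumes "a < length ns"
  shows "ev y (Mult (etp.E a) (Mult (MCH (map (\<lambda>i. Mult (etp.E a) (Mult (Var i) (etp.E a))) [0..<ns ! a])) (etp.E a))) =
    E a * (\<Sum>\<rho> | \<rho> permutes {..ns ! a}. sc (of_int (sign \<rho>)) *
      tmon (ns ! a) [0..<ns ! a] \<rho> ((\<lambda>i. E a * y i * E a)(ns ! a := 1))) * E a"
proof -
  have Ee: "E a * (eps * z) = E a * z" for z by (simp add: E_eps flip: mult.assoc)
  define us :: "'f etp list" where "us = map (\<lambda>i. Mult (etp.E a) (Mult (Var i) (etp.E a))) [0..<ns ! a]"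
  have "ev y (MCH us) = (\<Sum>\<sigma> | \<sigma> permutes {..length us}. sc (of_int (sign \<sigma>)) *
      tmon (length us) [0..<length us] \<sigma> ((\<lambda>i. E a * y i * E a)(length us := 1))) * eps"
    by (rule ev_MCH[where x = "\<lambda>i. E a * y i * E a"]) (simp add: us_def mult.assoc Ee)
  then show ?thesis by (simp only: us_def ev.simps length_map length_upt diff_zero mult.assoc eps_E)
qed

lemma ch_algI:
  assumes "\<And>y g. g \<in> MCH_gens ns \<Longrightarrow> ev y g = 0"
  shows "ch_alg tr sc ns E eps"
proof
  fix a and x :: "nat \<Rightarrow> 'r"
  assume a: "a < length ns" and x: "\<And>i. i < ns ! a \<Longrightarrow> x i = E a * x i * E a"
  let ?x = "(\<lambda>i. E a * x i * E a)(ns ! a := 1)"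
  have "tmon (ns ! a) [0..<ns ! a] \<rho> (x(ns ! a := 1)) = tmon (ns ! a) [0..<ns ! a] \<rho> ?x" for \<rho>
    by (intro tmon_cong refl) (use x in \<open>auto simp: fun_upd_apply\<close>)
  moreover have "ev x (Mult (etp.E a) (Mult (MCH (map (\<lambda>i. Mult (etp.E a) (Mult (Var i) (etp.E a))) [0..<ns ! a])) (etp.E a))) = 0"
    using a by (intro assms) (auto simp: MCH_gens_def)
  ultimately show "E a * (\<Sum>\<rho> | \<rho> permutes {..ns ! a}. sc (of_int (sign \<rho>)) *
      tmon (ns ! a) [0..<ns ! a] \<rho> (x(ns ! a := 1))) * E a = 0"
    unfolding ev_generator[OF a] by simp
qed

definition letter :: "(nat \<Rightarrow> 'r) \<Rightarrow> letter \<Rightarrow> 'r" where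
  "letter y l = (case l of (a, i, b) \<Rightarrow> E a * y i * E b)"

definition wordval :: "(nat \<Rightarrow> 'r) \<Rightarrow> letter list \<Rightarrow> 'r" where
  "wordval y w = prod_list (map (letter y) w)"

text \<open>The closing factor \<open>E c\<close> lets the empty open word represent an idempotent;
  there is no monomial for the bare unit, which is a sum over \<open>c\<close>.\<close>

definition mon :: "(nat \<Rightarrow> 'r) \<Rightarrow> letter list list \<times> letter list \<times> nat \<Rightarrow> 'r" where
  "mon y t = (case t of (ws, w, c) \<Rightarrow> prod_list (map (\<lambda>u. tr (wordval y u)) ws) * (wordval y w * E c))"

lemma wordval_simps [simp]:
  "wordval y [] = 1" "wordval y (l # w) = letter y l * wordval y w" "wordval y (u @ w) = wordval y u * wordval y w"
  by (simp_all add: wordval_def)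

text \<open>The combination is fixed before \<open>y\<close>, so one expansion serves the generic
  point and all specialisations. Empty trace words are excluded because every closed slot must later
  carry a letter.\<close>

definition spanned :: "((nat \<Rightarrow> 'r) \<Rightarrow> 'r) \<Rightarrow> bool" where
  "spanned F \<longleftrightarrow> (\<exists>D. (\<forall>(\<alpha>, ws, w, c) \<in> set D. [] \<notin> set ws) \<and> (\<forall>y. F y = (\<Sum>(\<alpha>, t)\<leftarrow>D. sc \<alpha> * mon y t)))"

lemma spanned_zero: "spanned (\<lambda>_. 0)"
  unfolding spanned_def by (intro exI[of _ "[]"]) simp

lemma spanned_mon: "[] \<notin> set ws \<Longrightarrow> spanned (\<lambda>y. mon y (ws, w, c))"
  unfolding spanned_def by (intro exI[of _ "[(1, ws, w, c)]"]) simp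

lemma spanned_add: "spanned F \<Longrightarrow> spanned G \<Longrightarrow> spanned (\<lambda>y. F y + G y)"
proof -
  assume "spanned F" "spanned G"
  then obtain D D' where
    "\<forall>(\<alpha>, ws, w, c) \<in> set D. [] \<notin> set ws" "\<forall>y. F y = (\<Sum>(\<alpha>, t)\<leftarrow>D. sc \<alpha> * mon y t)"
    "\<forall>(\<alpha>, ws, w, c) \<in> set D'. [] \<notin> set ws" "\<forall>y. G y = (\<Sum>(\<alpha>, t)\<leftarrow>D'. sc \<alpha> * mon y t)"
    unfolding spanned_def by blast
  then show ?thesis unfolding spanned_def by (intro exI[of _ "D @ D'"]) auto
qed

lemma spanned_smult: "spanned F \<Longrightarrow> spanned (\<lambda>y. sc \<alpha> * F y)"
proof -
  assume "spanned F"
  then obtain D where D: "\<forall>(\<alpha>, ws, w, c) \<in> set D. [] \<notin> set ws" "\<forall>y. F y = (\<Sum>(\<alpha>, t)\<leftarrow>D. sc \<alpha> * mon y t)"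
    unfolding spanned_def by blast
  have "sc \<alpha> * (\<Sum>(\<beta>, t)\<leftarrow>D. sc \<beta> * mon y t) = (\<Sum>(\<beta>, t)\<leftarrow>map (\<lambda>(\<beta>, t). (\<alpha> * \<beta>, t)) D. sc \<beta> * mon y t)" for y
    by (induction D) (auto simp: distrib_left sc_mult mult.assoc)
  then show ?thesis using D unfolding spanned_def
    by (intro exI[of _ "map (\<lambda>(\<beta>, t). (\<alpha> * \<beta>, t)) D"]) auto
qed

lemma spanned_sum: "(\<And>a. a \<in> A \<Longrightarrow> spanned (F a)) \<Longrightarrow> spanned (\<lambda>y. \<Sum>a\<in>A. F a y)"
  by (induction A rule: infinite_finite_induct) (auto intro: spanned_add spanned_zero)

lemma spanned_cases:
  assumes "spanned F"
    and "\<And>F G. P F \<Longrightarrow> P G \<Longrightarrow> P (\<lambda>y. F y + G y)" "\<And>\<alpha> F. P F \<Longrightarrow> P (\<lambda>y. sc \<alpha> * F y)" "P (\<lambda>_. 0)"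
    and "\<And>ws w c. [] \<notin> set ws \<Longrightarrow> P (\<lambda>y. mon y (ws, w, c))"
  shows "P F"
proof -
  obtain D where D: "\<forall>(\<alpha>, ws, w, c) \<in> set D. [] \<notin> set ws" and F: "F = (\<lambda>y. \<Sum>(\<alpha>, t)\<leftarrow>D. sc \<alpha> * mon y t)"
    using assms(1) unfolding spanned_def by blast
  show ?thesis
    unfolding F using D
  proof (induction D)
    case Nil
    then show ?case using assms(4) by simp
  next
    case (Cons d D)
    obtain \<alpha> ws w c where d: "d = (\<alpha>, ws, w, c)" by (cases d) auto
    have "P (\<lambda>y. sc \<alpha> * mon y (ws, w, c))"
      using Cons.prems d by (intro assms(3,5)) auto
    moreover have "P (\<lambda>y. \<Sum>(\<alpha>, t)\<leftarrow>D. sc \<alpha> * mon y t)"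
      using Cons by auto
    ultimately show ?case using assms(2) d by fastforce
  qed
qed

lemma traces_central:
  "prod_list (map (\<lambda>u. tr (g u)) us) * x = x * prod_list (map (\<lambda>u. tr (g u)) us)"
proof (induction us)
  case (Cons u us)
  have "tr (g u) * prod_list (map (\<lambda>u. tr (g u)) us) * x = tr (g u) * (x * prod_list (map (\<lambda>u. tr (g u)) us))"
    by (simp only: mult.assoc Cons.IH)
  also have "\<dots> = x * (tr (g u) * prod_list (map (\<lambda>u. tr (g u)) us))"
    by (simp only: tr_commute_left)
  finally show ?case by (simp add: mult.assoc)
qed simp

lemma tr_traces:
  "tr (prod_list (map (\<lambda>u. tr (g u)) us) * x) = prod_list (map (\<lambda>u. tr (g u)) us) * tr x"
  by (induction us) (simp_all add: tr_tr mult.assoc)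

text \<open>The traces are central, so only the idempotent at the junction matters:
  \<open>E c\<close> meets either \<open>E c'\<close> or the left idempotent of the first letter of
  \<open>w'\<close>.\<close>

lemma mon_mult:
  "mon y (ws, w, c) * mon y (ws', w', c') =
    (if w' = [] then if c = c' then mon y (ws @ ws', w, c) else 0
     else if c = fst (hd w') then mon y (ws @ ws', w @ w', c') else 0)"
proof -
  define P where "P ws = prod_list (map (\<lambda>u. tr (wordval y u)) ws)" for ws
  have "mon y (ws, w, c) * mon y (ws', w', c') = P ws * (wordval y w * E c * P ws') * (wordval y w' * E c')"
    by (simp add: mon_def P_def mult.assoc)
  also have "wordval y w * E c * P ws' = P ws' * (wordval y w * E c)"
    unfolding P_def by (rule traces_central[symmetric])
  finally have eq: "mon y (ws, w, c) * mon y (ws', w', c') =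
      P (ws @ ws') * (wordval y w * (E c * (wordval y w' * E c')))"
    by (simp add: P_def mult.assoc)
  show ?thesis
  proof (cases w')
    case Nil
    then show ?thesis unfolding eq by (simp add: E_mult mon_def P_def)
  next
    case (Cons l w'')
    obtain a i b where l: "l = (a, i, b)" by (cases l)
    show ?thesis unfolding eq
      by (simp add: Cons l letter_def mult.assoc E_mult_left mon_def P_def)
  qed
qed

lemma spanned_mult: "spanned F \<Longrightarrow> spanned G \<Longrightarrow> spanned (\<lambda>y. F y * G y)"
proof (erule spanned_cases[where P = "\<lambda>F. spanned (\<lambda>y. F y * G y)"])
  assume G: "spanned G"
  show "spanned (\<lambda>y. mon y (ws, w, c) * G y)" if ws: "[] \<notin> set ws" for ws w c
    using G
  proof (rule spanned_cases[where P = "\<lambda>G. spanned (\<lambda>y. mon y (ws, w, c) * G y)"])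
    show "spanned (\<lambda>y. mon y (ws, w, c) * mon y (ws', w', c'))" if "[] \<notin> set ws'" for ws' w' c'
      unfolding mon_mult using ws that
      by (cases "w' = []"; cases "c = c'"; cases "c = fst (hd w')") (simp_all add: spanned_mon spanned_zero)
  qed (auto simp: distrib_left sc_left_comm intro: spanned_add spanned_smult spanned_zero)
qed (auto simp: distrib_right mult.assoc intro: spanned_add spanned_smult spanned_zero)

lemma wordval_eps: "w \<noteq> [] \<Longrightarrow> eps * wordval y w = wordval y w"
proof (cases w)
  case (Cons l w')
  have "eps * letter y l = letter y l" by (cases l) (simp add: letter_def eps_E flip: mult.assoc)
  then show ?thesis by (simp add: Cons flip: mult.assoc)
qed simp

lemma spanned_pure: "[] \<notin> set ws \<Longrightarrow> spanned (\<lambda>y. prod_list (map (\<lambda>u. tr (wordval y u)) ws) * eps)"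
proof -
  assume "[] \<notin> set ws"
  then have "spanned (\<lambda>y. \<Sum>c<length ns. mon y (ws, [], c))" by (intro spanned_sum spanned_mon)
  then show ?thesis by (simp add: mon_def eps_sum sum_distrib_left)
qed

text \<open>An empty open word gives the scalar n_c. A nonempty one gives a new trace word, or zero
  if its last letter does not end in \<open>E c\<close>. Purely scalar or pure trace results are
  brought back to monomials by writing \<open>eps\<close> as the sum of the
  \<open>E_c\<close>.\<close>

lemma spanned_tr: "spanned F \<Longrightarrow> spanned (\<lambda>y. tr (F y))"
proof (erule spanned_cases[where P = "\<lambda>F. spanned (\<lambda>y. tr (F y))"])
  fix ws w c assume ws: "[] \<notin> set (ws :: letter list list)"
  define P where "P y = prod_list (map (\<lambda>u. tr (wordval y u)) ws)" for y
  have eq: "tr (mon y (ws, w, c)) = P y * tr (wordval y w * E c)" for y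
    by (simp add: mon_def P_def tr_traces)
  show "spanned (\<lambda>y. tr (mon y (ws, w, c)))"
  proof (cases w rule: rev_cases)
    case Nil
    show ?thesis
    proof (cases "c < length ns")
      case True
      then have "tr (mon y (ws, w, c)) = sc (of_nat (ns ! c)) * (P y * eps)" for y
        unfolding eq by (simp add: Nil tr_E sc_left_comm)
      then show ?thesis using spanned_smult[OF spanned_pure[OF ws]] by (simp add: P_def)
    next
      case False
      then show ?thesis unfolding eq by (simp add: E_out spanned_zero)
    qed
  next
    case (snoc w' l)
    obtain a i b where l: "l = (a, i, b)" by (cases l)
    show ?thesis
    proof (cases "b = c")
      case True
      have "wordval y w * E c = wordval y w" for y
        by (simp add: snoc l letter_def mult.assoc E_mult True)
      moreover have "tr (wordval y w) = tr (wordval y w) * eps" for y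
        using wordval_eps[of w y] snoc tr_eps[of "wordval y w"] eps_comm[of "tr (wordval y w)"] by simp
      ultimately have "tr (mon y (ws, w, c)) = prod_list (map (\<lambda>u. tr (wordval y u)) (ws @ [w])) * eps" for y
        unfolding eq by (simp add: P_def mult.assoc)
      moreover have "[] \<notin> set (ws @ [w])" using ws snoc by auto
      ultimately show ?thesis using spanned_pure[of "ws @ [w]"] by simp
    next
      case False
      then have "wordval y w * E c = 0" for y
        by (simp add: snoc l letter_def mult.assoc E_mult)
      then show ?thesis unfolding eq by (simp add: spanned_zero)
    qed
  qed
qed (auto simp: tr_add tr_sc intro: spanned_add spanned_smult spanned_zero)

lemma spanned_ev: "spanned (\<lambda>y. ev y f)"
proof (induction f)
  case (Var i)
  have "eps * y i = (\<Sum>a<length ns. \<Sum>b<length ns. mon y ([], [(a, i, b)], b))" for y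
  proof -
    have "eps * y i = eps * y i * eps" by (metis eps_comm eps_eps mult.assoc)
    also have "\<dots> = (\<Sum>a<length ns. \<Sum>b<length ns. E a * y i * E b)"
      unfolding eps_sum sum_distrib_right sum_distrib_left by (subst sum.swap) simp
    also have "\<dots> = (\<Sum>a<length ns. \<Sum>b<length ns. mon y ([], [(a, i, b)], b))"
      by (intro sum.cong) (simp_all add: mon_def letter_def mult.assoc E_mult)
    finally show ?thesis .
  qed
  moreover have "spanned (\<lambda>y. \<Sum>a<length ns. \<Sum>b<length ns. mon y ([], [(a, i, b)], b))"
    by (intro spanned_sum spanned_mon) simp
  ultimately show ?case by simp
next
  case (E a)
  then show ?case using spanned_mon[of "[]" "[]" a] by (simp add: mon_def)
next
  case (Const c)
  then show ?case using spanned_smult[OF spanned_pure[of "[]"], of c] by simp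
qed (simp_all add: spanned_add spanned_mult spanned_tr)

section \<open>From words in slots to a single letter in each slot\<close>

definition tuple :: "(nat \<Rightarrow> 'r) \<Rightarrow> (nat \<Rightarrow> letter) \<Rightarrow> nat \<Rightarrow> nat \<Rightarrow> 'r" where
  "tuple y l c j = (if j = 0 then E c else letter y (l j))"

definition wtuple :: "(nat \<Rightarrow> 'r) \<Rightarrow> (nat \<Rightarrow> letter list) \<Rightarrow> nat \<Rightarrow> nat \<Rightarrow> 'r" where
  "wtuple y wd c j = (if j = 0 then wordval y (wd 0) * E c else wordval y (wd j))"

text \<open>Elimination run backwards: the first letter of a word is moved to a fresh slot inserted
  before it in its cycle. The number of surplus letters drops each time. Slot 0 is emptied
  completely because it keeps \<open>E c\<close>; the other slots keep one letter.\<close>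

lemma split_words:
  assumes "\<tau> permutes {..m}" "\<And>j. 1 \<le> j \<Longrightarrow> j \<le> m \<Longrightarrow> wd j \<noteq> []"
  shows "\<exists>m' \<tau>' l. \<tau>' permutes {..m'} \<and>
    (\<forall>y. tmon 0 [1..<Suc m] \<tau> (wtuple y wd c) = tmon 0 [1..<Suc m'] \<tau>' (tuple y l c))"
  using assms
proof (induction "length (wd 0) + (\<Sum>j=1..m. length (wd j) - 1)" arbitrary: m \<tau> wd rule: less_induct)
  case less
  show ?case
  proof (cases "wd 0 = [] \<and> (\<forall>j\<in>{1..m}. length (wd j) = 1)")
    case True
    have "wtuple y wd c j = tuple y (\<lambda>j. hd (wd j)) c j" if "j \<in> insert 0 (set [1..<Suc m])" for y j
    proof (cases "j = 0")
      case False
      then have "length (wd j) = 1" using True that by auto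
      then obtain l where "wd j = [l]" by (auto simp: length_Suc_conv)
      then show ?thesis using False by (simp add: wtuple_def tuple_def)
    qed (use True in \<open>simp add: wtuple_def tuple_def\<close>)
    then have "tmon 0 [1..<Suc m] \<tau> (wtuple y wd c) = tmon 0 [1..<Suc m] \<tau> (tuple y (\<lambda>j. hd (wd j)) c)" for y
      by (intro tmon_cong) blast+
    then show ?thesis using less.prems(1) by blast
  next
    case False
    then obtain k where k: "k \<le> m" "if k = 0 then wd k \<noteq> [] else length (wd k) \<ge> 2"
    proof (cases "wd 0 = []")
      case True
      then obtain j where "1 \<le> j" "j \<le> m" "length (wd j) \<noteq> 1" using False by auto
      moreover from this have "length (wd j) \<noteq> 0" using less.prems(2) by simp
      ultimately have "2 \<le> length (wd j)" by linarith
      then show thesis using that[of j] \<open>1 \<le> j\<close> \<open>j \<le> m\<close> by simp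
    qed (use that[of 0] in auto)
    then obtain l rest where lr: "wd k = l # rest" "k \<noteq> 0 \<Longrightarrow> rest \<noteq> []"
    proof (cases "wd k")
      case (Cons l rest)
      then show thesis using k(2) by (intro that[of l rest]) (auto split: if_splits)
    qed (use k(2) in \<open>auto split: if_splits\<close>)
    let ?j = "Suc m"
    \<comment> \<open>Chosen so that the fresh slot \<open>?j\<close> precedes \<open>k\<close> and
      \<open>skip ?j \<tau>'\<close> is \<tau> again.\<close>
    define \<tau>' where "\<tau>' = transpose ?j k \<circ> \<tau>"
    define wd' where "wd' = wd(k := rest, ?j := [l])"
    have \<tau>j: "\<tau> ?j = ?j" using less.prems(1) by (auto intro: permutes_not_in)
    have \<tau>': "\<tau>' permutes {..Suc m}"
      unfolding \<tau>'_def using k(1)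
      by (intro permutes_compose permutes_subset[OF less.prems(1)] permutes_swap_id) auto
    have \<tau>'j: "\<tau>' ?j = k" by (simp add: \<tau>'_def \<tau>j)
    have skip: "skip ?j \<tau>' = \<tau>"
      unfolding skip_def \<tau>'j by (simp add: \<tau>'_def flip: comp_assoc)
    have "\<exists>m' \<tau>'' l. \<tau>'' permutes {..m'} \<and>
        (\<forall>y. tmon 0 [1..<Suc (Suc m)] \<tau>' (wtuple y wd' c) = tmon 0 [1..<Suc m'] \<tau>'' (tuple y l c))"
    proof (rule less.hyps)
      show "wd' j \<noteq> []" if "1 \<le> j" "j \<le> Suc m" for j
        using that less.prems(2)[of j] lr(2) by (auto simp: wd'_def fun_upd_apply)
      show "length (wd' 0) + (\<Sum>j=1..Suc m. length (wd' j) - 1) < length (wd 0) + (\<Sum>j=1..m. length (wd j) - 1)"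
      proof (cases "k = 0")
        case True
        have "(\<Sum>j=1..m. length (wd' j) - 1) = (\<Sum>j=1..m. length (wd j) - 1)"
          using True by (intro sum.cong) (auto simp: wd'_def fun_upd_apply)
        then show ?thesis using True lr(1) by (simp add: wd'_def)
      next
        case False
        have "(\<Sum>j=1..m. length (wd' j) - 1) < (\<Sum>j=1..m. length (wd j) - 1)"
        proof (rule sum_strict_mono_ex1)
          show "\<forall>j\<in>{1..m}. length (wd' j) - 1 \<le> length (wd j) - 1"
            using lr(1) by (auto simp: wd'_def fun_upd_apply)
          show "\<exists>j\<in>{1..m}. length (wd' j) - 1 < length (wd j) - 1"
          proof (intro bexI[of _ k])
            have "length rest \<ge> 1" using lr(2)[OF False] by (cases rest) auto
            then show "length (wd' k) - 1 < length (wd k) - 1" using k(1) lr(1) by (simp add: wd'_def)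
          qed (use k(1) False in simp)
        qed simp
        then show ?thesis using False by (simp add: wd'_def)
      qed
    qed (rule \<tau>')
    moreover have "tmon 0 [1..<Suc (Suc m)] \<tau>' (wtuple y wd' c) = tmon 0 [1..<Suc m] \<tau> (wtuple y wd c)" for y
    proof -
      let ?x = "wtuple y wd' c"
      have "tmon 0 [1..<Suc (Suc m)] \<tau>' ?x = tmon 0 (?j # [1..<Suc m]) \<tau>' ?x"
        using permutes_inj[OF \<tau>'] by (intro tmon_perm) auto
      also have "\<dots> = tmon 0 [1..<Suc m] \<tau> (?x(k := ?x ?j * ?x k))"
        unfolding tmon_Cons \<tau>'j skip using k(1) by simp
      also have "\<dots> = tmon 0 [1..<Suc m] \<tau> (wtuple y wd c)"
      proof (rule tmon_cong)
        fix i assume "i \<in> insert 0 (set [1..<Suc m])"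
        then have "i \<noteq> ?j" by auto
        then show "(?x(k := ?x ?j * ?x k)) i = wtuple y wd c i"
          using k(1) lr(1) by (cases "i = k") (auto simp: wtuple_def wd'_def fun_upd_apply mult.assoc)
      qed simp
      finally show ?thesis .
    qed
    ultimately show ?thesis by simp
  qed
qed

lemma tmon_id: "tmon r js id x = prod_list (map (\<lambda>j. tr (x j)) js) * x r"
  by (induction js) (simp_all add: mult.assoc)

text \<open>The starting point is the identity permutation with whole words in the slots: its closed
  slots give the traces and slot 0 gives the open word.\<close>

lemma mon_eq_tmon:
  assumes "[] \<notin> set ws"
  shows "\<exists>m \<tau> l. \<tau> permutes {..m} \<and> (\<forall>y. mon y (ws, w, c) = tmon 0 [1..<Suc m] \<tau> (tuple y l c))"
proof -
  let ?m = "length ws"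
  define wd where "wd j = (if j = 0 then w else ws ! (j - 1))" for j
  have "wd j \<noteq> []" if "1 \<le> j" "j \<le> ?m" for j
  proof -
    have "ws ! (j - 1) \<in> set ws" using that by (intro nth_mem) auto
    then have "ws ! (j - 1) \<noteq> []" using assms by metis
    then show ?thesis using that by (simp add: wd_def)
  qed
  then obtain m \<tau> l where "\<tau> permutes {..m}"
    and eq: "\<And>y. tmon 0 [1..<Suc ?m] id (wtuple y wd c) = tmon 0 [1..<Suc m] \<tau> (tuple y l c)"
    using split_words[of id ?m wd c] permutes_id by blast
  moreover have "mon y (ws, w, c) = tmon 0 [1..<Suc ?m] id (wtuple y wd c)" for y
  proof -
    have "map (\<lambda>j. tr (wtuple y wd c j)) [1..<Suc ?m] = map (\<lambda>u. tr (wordval y u)) ws"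
      by (rule nth_equalityI) (auto simp: wtuple_def wd_def simp del: upt_Suc)
    then show ?thesis
      unfolding tmon_id by (simp add: mon_def wtuple_def wd_def del: upt_Suc)
  qed
  ultimately show ?thesis by metis
qed

definition normal_form :: "'f etp \<Rightarrow> nat set \<Rightarrow> (nat \<Rightarrow> nat \<Rightarrow> nat) \<Rightarrow> (nat \<Rightarrow> nat) \<Rightarrow> (nat \<Rightarrow> 'f) \<Rightarrow>
    (nat \<Rightarrow> nat \<Rightarrow> letter) \<Rightarrow> (nat \<Rightarrow> nat) \<Rightarrow> bool" where
  "normal_form f K \<tau> m \<alpha> l c \<longleftrightarrow> finite K \<and> (\<forall>k\<in>K. \<tau> k permutes {..m k}) \<and>
    (\<forall>y. ev y f = (\<Sum>k\<in>K. sc (\<alpha> k) * tmon 0 [1..<Suc (m k)] (\<tau> k) (tuple y (l k) (c k))))"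

lemma normal_form_exists: "\<exists>K \<tau> m \<alpha> l c. normal_form f K \<tau> m \<alpha> l c"
proof -
  obtain D where D: "\<forall>(\<alpha>, ws, w, c) \<in> set D. [] \<notin> set ws"
    and ev: "\<And>y. ev y f = (\<Sum>(\<alpha>, t)\<leftarrow>D. sc \<alpha> * mon y t)"
    using spanned_ev[of f] unfolding spanned_def by blast
  define \<alpha> where "\<alpha> k = fst (D ! k)" for k
  define c where "c k = snd (snd (snd (D ! k)))" for k
  have "\<exists>m \<tau> l. \<tau> permutes {..m} \<and> (\<forall>y. mon y (snd (D ! k)) = tmon 0 [1..<Suc m] \<tau> (tuple y l (c k)))"
    if k: "k < length D" for k
  proof -
    obtain \<beta> ws w b where Dk: "D ! k = (\<beta>, ws, w, b)" by (cases "D ! k") auto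
    then have "[] \<notin> set ws" using D nth_mem[OF k] by fastforce
    from mon_eq_tmon[OF this, of w b] show ?thesis by (simp add: Dk c_def)
  qed
  then obtain m \<tau> l where *: "\<And>k. k < length D \<Longrightarrow> \<tau> k permutes {..m k} \<and>
      (\<forall>y. mon y (snd (D ! k)) = tmon 0 [1..<Suc (m k)] (\<tau> k) (tuple y (l k) (c k)))"
    by metis
  have "ev y f = (\<Sum>k<length D. sc (\<alpha> k) * tmon 0 [1..<Suc (m k)] (\<tau> k) (tuple y (l k) (c k)))" for y
  proof -
    have "ev y f = (\<Sum>k<length D. sc (\<alpha> k) * mon y (snd (D ! k)))"
      unfolding ev by (simp add: sum_list_sum_nth \<alpha>_def case_prod_beta atLeast0LessThan)
    also have "\<dots> = (\<Sum>k<length D. sc (\<alpha> k) * tmon 0 [1..<Suc (m k)] (\<tau> k) (tuple y (l k) (c k)))"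
      using * by (intro sum.cong) (auto simp del: upt_Suc)
    finally show ?thesis .
  qed
  then have "normal_form f {..<length D} \<tau> m \<alpha> l c"
    unfolding normal_form_def using * by simp
  then show ?thesis by blast
qed

end

subsection \<open>Identities of matrices\<close>

text \<open>One variable at a time: the sum is a polynomial in \<open>s i\<close> that vanishes at
  every scalar of an infinite field, so each of its coefficients vanishes.\<close>

lemma coefficient_extraction:
  fixes \<beta> :: "'z \<Rightarrow> 'f::field_char_0" and e :: "'z \<Rightarrow> 'j \<Rightarrow> nat"
  assumes "finite J" "finite Z" "\<And>s. (\<Sum>z\<in>Z. \<beta> z * (\<Prod>j\<in>J. s j ^ e z j)) = 0"
  shows "(\<Sum>z | z \<in> Z \<and> (\<forall>j\<in>J. e z j = d j). \<beta> z) = 0"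
  using assms
proof (induction J arbitrary: Z rule: finite_induct)
  case empty
  then show ?case by simp
next
  case (insert i J)
  let ?Z = "{z \<in> Z. e z i = d i}"
  have "(\<Sum>z | z \<in> ?Z \<and> (\<forall>j\<in>J. e z j = d j). \<beta> z) = 0"
  proof (rule insert.IH)
    fix s :: "'j \<Rightarrow> 'f"
    define P where "P = (\<Sum>z\<in>Z. monom (\<beta> z * (\<Prod>j\<in>J. s j ^ e z j)) (e z i))"
    have "poly P t = 0" for t
    proof -
      have "(\<Prod>j\<in>insert i J. (s(i := t)) j ^ e z j) = t ^ e z i * (\<Prod>j\<in>J. s j ^ e z j)" for z
      proof -
        have "(\<Prod>j\<in>J. (s(i := t)) j ^ e z j) = (\<Prod>j\<in>J. s j ^ e z j)"
          using insert.hyps by (intro prod.cong) (auto simp: fun_upd_apply)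
        then show ?thesis using insert.hyps by simp
      qed
      then have "poly P t = (\<Sum>z\<in>Z. \<beta> z * (\<Prod>j\<in>insert i J. (s(i := t)) j ^ e z j))"
        by (simp add: P_def poly_sum poly_monom mult_ac)
      then show ?thesis using insert.prems(2) by simp
    qed
    then have "P = 0" using poly_all_0_iff_0 by blast
    then have "coeff P (d i) = 0" by simp
    moreover have "coeff P (d i) = (\<Sum>z\<in>Z. if e z i = d i then \<beta> z * (\<Prod>j\<in>J. s j ^ e z j) else 0)"
      by (simp add: P_def coeff_sum)
    moreover have "\<dots> = (\<Sum>z\<in>?Z. \<beta> z * (\<Prod>j\<in>J. s j ^ e z j))"
      using insert.prems(1) by (rule sum.inter_filter[symmetric])
    ultimately show "(\<Sum>z\<in>?Z. \<beta> z * (\<Prod>j\<in>J. s j ^ e z j)) = 0" by simp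
  qed (use insert.prems in simp)
  moreover have "{z. z \<in> ?Z \<and> (\<forall>j\<in>J. e z j = d j)} = {z. z \<in> Z \<and> (\<forall>j\<in>insert i J. e z j = d j)}"
    by auto
  ultimately show ?case by simp
qed

lemma etp_eval_carrier:
  assumes "\<And>i. \<rho> i \<in> carrier_mat (sum_list ns) (sum_list ns)"
  shows "etp_eval ns \<rho> u \<in> carrier_mat (sum_list ns) (sum_list ns)"
  by (induction u) (use assms in \<open>auto simp: eblock_def\<close>)

context trace_ring
begin

lemma tmon_sum:
  assumes "i \<in> insert r (set js)" "distinct js" "r \<notin> set js" "\<tau> permutes insert r (set js)"
  shows "tmon r js \<tau> (x(i := \<Sum>k\<in>K. u k)) = (\<Sum>k\<in>K. tmon r js \<tau> (x(i := u k)))"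
  by (induction K rule: infinite_finite_induct)
    (simp_all add: tmon_add[OF assms] tmon_zero[OF assms])

text \<open>Multilinear expansion over all ways \<pi> to choose a summand in each slot of
  \<open>A\<close>.\<close>

lemma tmon_expand:
  assumes "distinct js" "r \<notin> set js" "\<tau> permutes insert r (set js)" "finite A" "A \<subseteq> set js"
  shows "tmon r js \<tau> (\<lambda>j. if j \<in> A then \<Sum>k\<in>K. z j k else x j) =
    (\<Sum>\<pi>\<in>PiE A (\<lambda>_. K). tmon r js \<tau> (\<lambda>j. if j \<in> A then z j (\<pi> j) else x j))"
  using assms(4,5)
proof (induction A arbitrary: x rule: finite_induct)
  case (insert i A)
  let ?X = "\<lambda>x A \<pi> j. if j \<in> A then z j (\<pi> j) else x j"
  have i: "i \<in> insert r (set js)" using insert.prems by auto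
  have "(\<lambda>j. if j \<in> insert i A then \<Sum>k\<in>K. z j k else x j) =
      (\<lambda>j. if j \<in> A then \<Sum>k\<in>K. z j k else x j)(i := \<Sum>k\<in>K. z i k)"
    by (auto simp: fun_eq_iff fun_upd_apply)
  then have "tmon r js \<tau> (\<lambda>j. if j \<in> insert i A then \<Sum>k\<in>K. z j k else x j) =
      (\<Sum>k\<in>K. tmon r js \<tau> ((\<lambda>j. if j \<in> A then \<Sum>k\<in>K. z j k else x j)(i := z i k)))"
    by (simp only: tmon_sum[OF i assms(1-3)])
  also have "\<dots> = (\<Sum>k\<in>K. tmon r js \<tau> (\<lambda>j. if j \<in> A then \<Sum>k\<in>K. z j k else (x(i := z i k)) j))"
    using insert.hyps(2) by (intro sum.cong refl arg_cong[where f = "tmon r js \<tau>"]) (auto simp: fun_eq_iff fun_upd_apply)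
  also have "\<dots> = (\<Sum>k\<in>K. \<Sum>\<pi>\<in>PiE A (\<lambda>_. K). tmon r js \<tau> (?X (x(i := z i k)) A \<pi>))"
    using insert.prems by (intro sum.cong refl insert.IH) auto
  also have "\<dots> = (\<Sum>(k, \<pi>)\<in>K \<times> PiE A (\<lambda>_. K). tmon r js \<tau> (?X x (insert i A) (\<pi>(i := k))))"
    unfolding sum.cartesian_product using insert.hyps(2)
    by (intro sum.cong refl) (auto intro!: arg_cong[where f = "tmon r js \<tau>"] simp: fun_eq_iff fun_upd_apply)
  also have "\<dots> = (\<Sum>\<pi>\<in>(\<lambda>(k, \<pi>). \<pi>(i := k)) ` (K \<times> PiE A (\<lambda>_. K)). tmon r js \<tau> (?X x (insert i A) \<pi>))"
    using insert.hyps(2) by (subst sum.reindex) (auto intro!: inj_combinator sum.cong)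
  also have "(\<lambda>(k, \<pi>). \<pi>(i := k)) ` (K \<times> PiE A (\<lambda>_. K)) = PiE (insert i A) (\<lambda>_. K)"
    by (rule PiE_insert_eq[symmetric])
  finally show ?case .
qed simp

end

text \<open>\<^term>\<open>\<Phi> \<rho>\<close> evaluates at the matrices \<^term>\<open>\<rho>\<close>, assigned to the generic elements
  \<^term>\<open>Y\<close>; only the entries with indices below \<^term>\<open>sum_list ns\<close> are meaningful.\<close>

locale matrix_model = etrace_alg tr sc ns E eps
  for tr :: "'r::{ring,monoid_mult} \<Rightarrow> 'r" and sc :: "'f::field_char_0 \<Rightarrow> 'r" and ns E eps +
  fixes \<Phi> :: "(nat \<Rightarrow> nat \<Rightarrow> nat \<Rightarrow> 'f) \<Rightarrow> 'r \<Rightarrow> nat \<Rightarrow> nat \<Rightarrow> 'f" and Y :: "nat \<Rightarrow> 'r"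
  assumes \<Phi>_add: "P < sum_list ns \<Longrightarrow> Q < sum_list ns \<Longrightarrow> \<Phi> \<rho> (u + v) P Q = \<Phi> \<rho> u P Q + \<Phi> \<rho> v P Q"
    and \<Phi>_mult: "P < sum_list ns \<Longrightarrow> Q < sum_list ns \<Longrightarrow>
      \<Phi> \<rho> (u * v) P Q = (\<Sum>k<sum_list ns. \<Phi> \<rho> u P k * \<Phi> \<rho> v k Q)"
    and \<Phi>_tr: "P < sum_list ns \<Longrightarrow> Q < sum_list ns \<Longrightarrow>
      \<Phi> \<rho> (tr u) P Q = (if P = Q then \<Sum>k<sum_list ns. \<Phi> \<rho> u k k else 0)"
    and \<Phi>_sc: "P < sum_list ns \<Longrightarrow> Q < sum_list ns \<Longrightarrow> \<Phi> \<rho> (sc c * u) P Q = c * \<Phi> \<rho> u P Q"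
    and \<Phi>_E: "P < sum_list ns \<Longrightarrow> Q < sum_list ns \<Longrightarrow>
      \<Phi> \<rho> (E a) P Q = (if P = Q \<and> in_block ns a P then 1 else 0)"
    and \<Phi>_eps: "P < sum_list ns \<Longrightarrow> Q < sum_list ns \<Longrightarrow> \<Phi> \<rho> eps P Q = (if P = Q then 1 else 0)"
    and \<Phi>_Y: "P < sum_list ns \<Longrightarrow> Q < sum_list ns \<Longrightarrow> \<Phi> \<rho> (Y j) P Q = \<rho> j P Q"
begin

abbreviation "N \<equiv> sum_list ns"

lemma \<Phi>_zero: "P < N \<Longrightarrow> Q < N \<Longrightarrow> \<Phi> \<rho> 0 P Q = 0"
  using \<Phi>_add[of P Q \<rho> 0 0] by simp

lemma \<Phi>_sum: "P < N \<Longrightarrow> Q < N \<Longrightarrow> \<Phi> \<rho> (sum u A) P Q = (\<Sum>i\<in>A. \<Phi> \<rho> (u i) P Q)"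
  by (induction A rule: infinite_finite_induct) (simp_all add: \<Phi>_zero \<Phi>_add)

lemma \<Phi>_ev:
  "P < N \<Longrightarrow> Q < N \<Longrightarrow>
    \<Phi> \<rho> (ev y f) P Q = etp_eval ns (\<lambda>i. mat N N (\<lambda>(P, Q). \<Phi> \<rho> (y i) P Q)) f $$ (P, Q)"
proof (induction f arbitrary: P Q)
  case (Var i)
  have "\<Phi> \<rho> (eps * y i) P Q = (\<Sum>k<N. if k = P then \<Phi> \<rho> (y i) P Q else 0)"
    unfolding \<Phi>_mult[OF Var] using Var by (intro sum.cong refl) (simp add: \<Phi>_eps)
  then show ?case using Var by simp
next
  case (E a)
  then show ?case by (auto simp: \<Phi>_E eblock_def in_block_def)
next
  case (Const c)
  then show ?case by (simp add: \<Phi>_sc \<Phi>_eps)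
next
  case (Add u v)
  define \<sigma> where "\<sigma> = (\<lambda>i. mat N N (\<lambda>(P, Q). \<Phi> \<rho> (y i) P Q))"
  have "etp_eval ns \<sigma> w \<in> carrier_mat N N" for w by (rule etp_eval_carrier) (simp add: \<sigma>_def)
  then have "dim_row (etp_eval ns \<sigma> w) = N" "dim_col (etp_eval ns \<sigma> w) = N" for w by auto
  then show ?case using Add unfolding \<sigma>_def[symmetric] by (simp add: \<Phi>_add)
next
  case (Mult u v)
  define \<sigma> where "\<sigma> = (\<lambda>i. mat N N (\<lambda>(P, Q). \<Phi> \<rho> (y i) P Q))"
  have "etp_eval ns \<sigma> w \<in> carrier_mat N N" for w by (rule etp_eval_carrier) (simp add: \<sigma>_def)
  then have "dim_row (etp_eval ns \<sigma> w) = N" "dim_col (etp_eval ns \<sigma> w) = N" for w by auto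
  then show ?case using Mult unfolding \<sigma>_def[symmetric] by (simp add: \<Phi>_mult scalar_prod_def atLeast0LessThan)
next
  case (Tr u)
  define \<sigma> where "\<sigma> = (\<lambda>i. mat N N (\<lambda>(P, Q). \<Phi> \<rho> (y i) P Q))"
  have "etp_eval ns \<sigma> u \<in> carrier_mat N N" by (rule etp_eval_carrier) (simp add: \<sigma>_def)
  then have "dim_row (etp_eval ns \<sigma> u) = N" by auto
  then show ?case using Tr unfolding \<sigma>_def[symmetric] by (simp add: \<Phi>_tr mtrace_def)
qed

lemma \<Phi>_ev_identity:
  assumes "is_etp_identity ns f" "P < N" "Q < N"
  shows "\<Phi> \<rho> (ev y f) P Q = 0"
  unfolding \<Phi>_ev[OF assms(2,3)] using assms unfolding is_etp_identity_def by simp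

text \<open>\<kappa> times the matrix unit at row \<open>p\<close> and column \<open>q\<close>.
  Allowing \<kappa> = 0 keeps row and column available even when a product vanishes, so products
  need no case distinction.\<close>

definition is_unit :: "(nat \<Rightarrow> nat \<Rightarrow> nat \<Rightarrow> 'f) \<Rightarrow> 'r \<Rightarrow> 'f \<Rightarrow> nat \<Rightarrow> nat \<Rightarrow> bool" where
  "is_unit \<rho> u \<kappa> p q \<longleftrightarrow> (\<forall>P<N. \<forall>Q<N. \<Phi> \<rho> u P Q = (if P = p \<and> Q = q then \<kappa> else 0))"

lemma is_unit_mult:
  assumes "is_unit \<rho> u \<kappa> p q" "is_unit \<rho> v \<kappa>' p' q'" "q < N"
  shows "is_unit \<rho> (u * v) (if q = p' then \<kappa> * \<kappa>' else 0) p q'"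
  unfolding is_unit_def
proof (intro allI impI)
  fix P Q assume PQ: "P < N" "Q < N"
  have "\<Phi> \<rho> (u * v) P Q = (\<Sum>k<N. if k = q then (if P = p \<and> Q = q' \<and> q = p' then \<kappa> * \<kappa>' else 0) else 0)"
    unfolding \<Phi>_mult[OF PQ] using assms PQ by (intro sum.cong refl) (auto simp: is_unit_def)
  then show "\<Phi> \<rho> (u * v) P Q = (if P = p \<and> Q = q' then if q = p' then \<kappa> * \<kappa>' else 0 else 0)"
    using assms(3) by simp
qed

text \<open>A product of matrix units survives exactly when each column matches the row of the next
  factor. The conditions at the closed slots enter the coefficient; at the open slot there is none,
  and its successor's row and its own column give the position of the result.\<close>

lemma tmon_units:
  assumes "\<tau> permutes insert r (set js)" "distinct js" "r \<notin> set js"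
    and "\<And>j. j \<in> insert r (set js) \<Longrightarrow> is_unit \<rho> (x j) (\<kappa> j) (p j) (q j) \<and> p j < N \<and> q j < N"
  shows "is_unit \<rho> (tmon r js \<tau> x)
    (if \<forall>j\<in>set js. q j = p (\<tau> j) then \<Prod>j\<in>insert r (set js). \<kappa> j else 0) (p (\<tau> r)) (q r)"
  using assms
proof (induction js arbitrary: \<tau> x \<kappa> p)
  case Nil
  then have "\<tau> r = r" using permutes_in_image[OF Nil(1), of r] by simp
  then show ?case using Nil by simp
next
  case (Cons j js)
  have set_eq: "insert r (set (j # js)) - {j} = insert r (set js)" using Cons.prems by auto
  have perm: "skip j \<tau> permutes insert r (set js)"
    using skip_permutes[OF Cons.prems(1), of j] set_eq by simp
  have inj: "inj \<tau>" using Cons.prems(1) by (rule permutes_inj)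
  have prod_eq: "(\<Prod>i\<in>insert r (set (j # js)). \<kappa> i) = \<kappa> j * (\<Prod>i\<in>insert r (set js). \<kappa> i)" for \<kappa> :: "nat \<Rightarrow> 'f"
    using set_eq by (subst prod.remove[of _ j]) auto
  show ?case
  proof (cases "\<tau> j = j")
    case True
    have IH: "is_unit \<rho> (tmon r js \<tau> x)
      (if \<forall>j\<in>set js. q j = p (\<tau> j) then \<Prod>j\<in>insert r (set js). \<kappa> j else 0) (p (\<tau> r)) (q r)"
      using perm Cons.prems True by (intro Cons.IH) (auto simp: skip_fixed)
    have j: "is_unit \<rho> (x j) (\<kappa> j) (p j) (q j)" "p j < N" using Cons.prems(4)[of j] by auto
    show ?thesis
      unfolding is_unit_def
    proof (intro allI impI)
      fix P Q assume PQ: "P < N" "Q < N"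
      have tr: "(\<Sum>k<N. \<Phi> \<rho> (x j) k k) = (if p j = q j then \<kappa> j else 0)"
      proof -
        have "(\<Sum>k<N. \<Phi> \<rho> (x j) k k) = (\<Sum>k<N. if k = p j then (if p j = q j then \<kappa> j else 0) else 0)"
          using j(1) by (intro sum.cong refl) (auto simp: is_unit_def)
        then show ?thesis using j(2) by simp
      qed
      have "\<Phi> \<rho> (tr (x j) * tmon r js \<tau> x) P Q =
          (\<Sum>k<N. if k = P then (if p j = q j then \<kappa> j else 0) * \<Phi> \<rho> (tmon r js \<tau> x) P Q else 0)"
        unfolding \<Phi>_mult[OF PQ] using PQ by (intro sum.cong refl) (auto simp: \<Phi>_tr tr)
      also have "\<dots> = (if p j = q j then \<kappa> j else 0) * \<Phi> \<rho> (tmon r js \<tau> x) P Q"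
        using PQ by simp
      finally show "\<Phi> \<rho> (tmon r (j # js) \<tau> x) P Q = (if P = p (\<tau> r) \<and> Q = q r then
          if \<forall>j\<in>set (j # js). q j = p (\<tau> j) then \<Prod>j\<in>insert r (set (j # js)). \<kappa> j else 0 else 0)"
        unfolding prod_eq using True IH PQ by (auto simp: is_unit_def)
    qed
  next
    case False
    let ?k = "\<tau> j"
    have k: "?k \<in> insert r (set js)" using permutes_in_image[OF Cons.prems(1), of j] False set_eq by auto
    \<comment> \<open>The merged letter starts at the row of \<open>j\<close> and ends at the column
      of \<open>?k\<close>. The matching condition at \<open>j\<close> moves into its
      coefficient.\<close>
    define \<kappa>' where "\<kappa>' = \<kappa>(?k := if q j = p ?k then \<kappa> j * \<kappa> ?k else 0)"
    define p' where "p' = p(?k := p j)"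
    have p': "p' (skip j \<tau> i) = p (\<tau> i)" if "i \<noteq> j" for i
      using that inj by (auto simp: p'_def skip_apply fun_upd_apply inj_eq)
    have "is_unit \<rho> (tmon r js (skip j \<tau>) (x(?k := x j * x ?k)))
      (if \<forall>i\<in>set js. q i = p' (skip j \<tau> i) then \<Prod>i\<in>insert r (set js). \<kappa>' i else 0) (p' (skip j \<tau> r)) (q r)"
    proof (rule Cons.IH[OF perm])
      fix i assume i: "i \<in> insert r (set js)"
      then have ii: "is_unit \<rho> (x i) (\<kappa> i) (p i) (q i) \<and> p i < N \<and> q i < N"
        and jj: "is_unit \<rho> (x j) (\<kappa> j) (p j) (q j) \<and> p j < N \<and> q j < N"
        using Cons.prems(4) by auto
      show "is_unit \<rho> ((x(?k := x j * x ?k)) i) (\<kappa>' i) (p' i) (q i) \<and> p' i < N \<and> q i < N"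
        using ii jj is_unit_mult[of \<rho> "x j" "\<kappa> j" "p j" "q j" "x ?k" "\<kappa> ?k" "p ?k" "q ?k"]
        by (cases "i = ?k") (auto simp: \<kappa>'_def p'_def)
    qed (use Cons.prems in auto)
    moreover have "(\<forall>i\<in>set js. q i = p' (skip j \<tau> i)) \<longleftrightarrow> (\<forall>i\<in>set js. q i = p (\<tau> i))"
      using p' Cons.prems(2) by (metis distinct.simps(2))
    moreover have "p' (skip j \<tau> r) = p (\<tau> r)" using p' Cons.prems(3) by auto
    moreover have "(\<Prod>i\<in>insert r (set js). \<kappa>' i) = (if q j = p ?k then \<Prod>i\<in>insert r (set (j # js)). \<kappa> i else 0)"
    proof -
      have "(\<Prod>i\<in>insert r (set js) - {?k}. \<kappa>' i) = (\<Prod>i\<in>insert r (set js) - {?k}. \<kappa> i)"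
        by (intro prod.cong) (auto simp: \<kappa>'_def)
      then show ?thesis
        unfolding prod_eq using k by (simp add: prod.remove[of _ ?k] \<kappa>'_def mult.assoc)
    qed
    ultimately show ?thesis using False by (auto split: if_splits)
  qed
qed

end

section \<open>Matrix coefficients of an identity\<close>

context matrix_model
begin

lemma is_unit_E_left:
  assumes "is_unit \<rho> u \<kappa> p q" shows "is_unit \<rho> (E a * u) (if in_block ns a p then \<kappa> else 0) p q"
  unfolding is_unit_def
proof (intro allI impI)
  fix P Q assume PQ: "P < N" "Q < N"
  have "\<Phi> \<rho> (E a * u) P Q = (\<Sum>k<N. if k = P then (if in_block ns a P then \<Phi> \<rho> u P Q else 0) else 0)"
    unfolding \<Phi>_mult[OF PQ] using PQ by (intro sum.cong refl) (auto simp: \<Phi>_E)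
  then show "\<Phi> \<rho> (E a * u) P Q = (if P = p \<and> Q = q then if in_block ns a p then \<kappa> else 0 else 0)"
    using assms PQ by (auto simp: is_unit_def)
qed

lemma is_unit_E_right:
  assumes "is_unit \<rho> u \<kappa> p q" shows "is_unit \<rho> (u * E b) (if in_block ns b q then \<kappa> else 0) p q"
  unfolding is_unit_def
proof (intro allI impI)
  fix P Q assume PQ: "P < N" "Q < N"
  have "\<Phi> \<rho> (u * E b) P Q = (\<Sum>k<N. if k = Q then (if in_block ns b Q then \<Phi> \<rho> u P Q else 0) else 0)"
    unfolding \<Phi>_mult[OF PQ] using PQ by (intro sum.cong refl) (auto simp: \<Phi>_E)
  then show "\<Phi> \<rho> (u * E b) P Q = (if P = p \<and> Q = q then if in_block ns b q then \<kappa> else 0 else 0)"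
    using assms PQ by (auto simp: is_unit_def)
qed

lemma is_unit_sc: "is_unit \<rho> u \<kappa> p q \<Longrightarrow> is_unit \<rho> (sc c * u) (c * \<kappa>) p q"
  by (simp add: is_unit_def \<Phi>_sc)

lemma is_unit_zero: "is_unit \<rho> 0 0 p q"
  by (simp add: is_unit_def \<Phi>_zero)

text \<open>Polarization. Each variable is replaced by the sum of \<open>s k\<close> times matrix
  units \<open>Y k\<close>, over the target slots \<open>k\<close> whose letter \<open>t k\<close>
  contains that variable. The coefficient of s_1 ... s_M keeps only the terms with M letters
  together with the bijections \<sigma> that place these letters in the target slots. What remains
  for each is the product of the matching conditions.\<close>

lemma normal_form_coefficients:
  fixes K :: "nat set" and \<alpha> :: "nat \<Rightarrow> 'f"
  assumes f: "is_etp_identity ns f"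
    and K: "finite K" "\<And>k. k \<in> K \<Longrightarrow> \<tau> k permutes {..m k}"
    and ev: "\<And>y. ev y f = (\<Sum>k\<in>K. sc (\<alpha> k) * tmon 0 [1..<Suc (m k)] (\<tau> k) (tuple y (l k) (c k)))"
    and pq: "in_block ns c0 (p 0)" "q 0 < N"
      "\<And>j. j \<in> {1..M} \<Longrightarrow> in_block ns (fst (t j)) (p j) \<and> in_block ns (snd (snd (t j))) (q j)"
  shows "(\<Sum>k | k \<in> K \<and> m k = M \<and> c k = c0. \<Sum>\<sigma> | \<sigma> permutes {1..M}.
    if (\<forall>j\<in>{1..M}. l k j = t (\<sigma> j)) \<and> (\<forall>j\<le>M. q (\<sigma> j) = p (\<sigma> (\<tau> k j))) then \<alpha> k else 0) = 0"
proof -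
  define \<rho> :: "nat \<Rightarrow> nat \<Rightarrow> nat \<Rightarrow> 'f" where "\<rho> j P Q = (if P = p j \<and> Q = q j then 1 else 0)" for j P Q
  have Y: "is_unit \<rho> (Y j) 1 (p j) (q j)" for j
    by (simp add: is_unit_def \<Phi>_Y \<rho>_def)
  have pN: "p j < N" and qN: "q j < N" if "j \<in> {0..M}" for j
    using pq(1,2) pq(3)[of j] that by (cases "j = 0"; auto dest: in_block_less)+
  define y where "y s i = (\<Sum>k=1..M. if fst (snd (t k)) = i then sc (s k) * Y k else 0)" for s i
  \<comment> \<open>The summand of slot \<open>j\<close> of term \<open>k\<close> in which target
    slot \<open>i\<close> is chosen. The blocks of \<open>p i\<close> and \<open>q i\<close> make it
    nonzero only if the full letters agree, not merely the variables.\<close>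
  define z where "z s k j i = (if fst (snd (t i)) = fst (snd (l k j))
      then sc (s i) * (E (fst (l k j)) * Y i * E (snd (snd (l k j)))) else 0)" for s k j i
  have letter_y: "letter (y s) (l k j) = (\<Sum>i=1..M. z s k j i)" for s k j
    by (simp add: letter_def case_prod_beta y_def z_def sum_distrib_left sum_distrib_right
        if_distrib[of "\<lambda>x. _ * x"] if_distrib[of "\<lambda>x. x * _"] sc_left_comm mult.assoc cong: if_cong)
  have z: "is_unit \<rho> (z s k j i) (if l k j = t i then s i else 0) (p i) (q i)" if i: "i \<in> {1..M}" for s k j i
  proof -
    have "in_block ns a (p i) \<longleftrightarrow> a = fst (t i)" "in_block ns a (q i) \<longleftrightarrow> a = snd (snd (t i))" for a
      using pq(3)[OF i] in_block_unique by blast+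
    then have "is_unit \<rho> (sc (s i) * (E (fst (l k j)) * Y i * E (snd (snd (l k j)))))
        (s i * (if snd (snd (l k j)) = snd (snd (t i)) then if fst (l k j) = fst (t i) then 1 else 0 else 0)) (p i) (q i)"
      using is_unit_sc[OF is_unit_E_right[OF is_unit_E_left[OF Y[of i], of "fst (l k j)"], of "snd (snd (l k j))"], of "s i"]
      by (simp only:)
    then show ?thesis
      by (cases "l k j"; cases "t i") (auto simp: z_def is_unit_zero split: if_splits)
  qed
  define A where "A k = {1..m k}" for k
  \<comment> \<open>A placement \<pi> of the closed slots, extended by sending the open slot 0 to
    itself.\<close>
  define ext where "ext k \<pi> j = (if j \<in> A k then \<pi> j else (0::nat))" for k and \<pi> :: "nat \<Rightarrow> nat" and j
  define w where "w k \<pi> \<longleftrightarrow> c k = c0 \<and> (\<forall>j\<in>A k. l k j = t (\<pi> j)) \<and> (\<forall>j\<le>m k. q (ext k \<pi> j) = p (ext k \<pi> (\<tau> k j)))"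
    for k \<pi>
  \<comment> \<open>How often the placement uses target slot \<open>i\<close>, which is the degree
    of the term in \<open>s i\<close>.\<close>
  define e where "e z i = card {j \<in> A (fst z). snd z j = i}" for z :: "nat \<times> (nat \<Rightarrow> nat)" and i
  have entry: "\<Phi> \<rho> (tmon 0 [1..<Suc (m k)] (\<tau> k) (\<lambda>j. if j \<in> A k then z s k j (\<pi> j) else E (c k) * Y 0)) (q 0) (q 0) =
      (if w k \<pi> then \<Prod>i=1..M. s i ^ e (k, \<pi>) i else 0)"
    if k: "k \<in> K" and \<pi>: "\<pi> \<in> PiE (A k) (\<lambda>_. {1..M})" for k \<pi> s
  proof -
    let ?x = "\<lambda>j. if j \<in> A k then z s k j (\<pi> j) else E (c k) * Y 0"
    let ?\<kappa> = "\<lambda>j. if j \<in> A k then (if l k j = t (\<pi> j) then s (\<pi> j) else 0) else (if c k = c0 then 1 else 0)"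
    have set_eq: "set [1..<Suc (m k)] = A k" "insert 0 (A k) = {..m k}" by (auto simp: A_def)
    have units: "is_unit \<rho> (?x j) (?\<kappa> j) (p (ext k \<pi> j)) (q (ext k \<pi> j)) \<and> p (ext k \<pi> j) < N \<and> q (ext k \<pi> j) < N" for j
    proof (cases "j \<in> A k")
      case True
      then have "\<pi> j \<in> {1..M}" using \<pi> by auto
      then show ?thesis using True z[of "\<pi> j" s k j] pN[of "\<pi> j"] qN[of "\<pi> j"] by (simp add: ext_def)
    next
      case False
      have "in_block ns (c k) (p 0) \<longleftrightarrow> c k = c0" using pq(1) in_block_unique by blast
      then show ?thesis using False is_unit_E_left[OF Y, of "c k" 0] pN[of 0] qN[of 0] by (simp add: ext_def)
    qed
    have prod: "(\<Prod>j\<in>{..m k}. ?\<kappa> j) = (if c k = c0 \<and> (\<forall>j\<in>A k. l k j = t (\<pi> j)) then \<Prod>i=1..M. s i ^ e (k, \<pi>) i else 0)"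
    proof -
      have "{..m k} = insert 0 (A k)" "0 \<notin> A k" "finite (A k)" by (auto simp: A_def)
      then have "(\<Prod>j\<in>{..m k}. ?\<kappa> j) = (if c k = c0 then 1 else 0) * (\<Prod>j\<in>A k. if l k j = t (\<pi> j) then s (\<pi> j) else 0)"
        by simp
      also have "(\<Prod>j\<in>A k. if l k j = t (\<pi> j) then s (\<pi> j) else 0) =
          (if \<forall>j\<in>A k. l k j = t (\<pi> j) then \<Prod>j\<in>A k. s (\<pi> j) else 0)"
        using \<open>finite (A k)\<close> by (auto intro: prod.cong simp: prod_zero_iff)
      also have "(\<Prod>j\<in>A k. s (\<pi> j)) = (\<Prod>i=1..M. \<Prod>j | j \<in> A k \<and> \<pi> j = i. s (\<pi> j))"
        using \<pi> \<open>finite (A k)\<close> by (intro prod.group[symmetric]) auto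
      also have "\<dots> = (\<Prod>i=1..M. s i ^ e (k, \<pi>) i)"
        by (intro prod.cong refl) (simp add: e_def)
      finally show ?thesis by simp
    qed
    have "is_unit \<rho> (tmon 0 [1..<Suc (m k)] (\<tau> k) ?x)
        (if \<forall>j\<in>set [1..<Suc (m k)]. q (ext k \<pi> j) = p (ext k \<pi> (\<tau> k j))
         then \<Prod>j\<in>insert 0 (set [1..<Suc (m k)]). ?\<kappa> j else 0)
        (p (ext k \<pi> (\<tau> k 0))) (q (ext k \<pi> 0))"
    proof (rule tmon_units[where p = "\<lambda>j. p (ext k \<pi> j)" and q = "\<lambda>j. q (ext k \<pi> j)"])
      show "\<tau> k permutes insert 0 (set [1..<Suc (m k)])"
        unfolding set_eq by (rule K(2)[OF k])
    qed (simp_all only: units, simp_all del: upt_Suc)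
    then have "is_unit \<rho> (tmon 0 [1..<Suc (m k)] (\<tau> k) ?x)
        (if \<forall>j\<in>A k. q (ext k \<pi> j) = p (ext k \<pi> (\<tau> k j)) then \<Prod>j\<in>{..m k}. ?\<kappa> j else 0)
        (p (ext k \<pi> (\<tau> k 0))) (q (ext k \<pi> 0))"
      unfolding set_eq .
    moreover have "ext k \<pi> 0 = 0" by (simp add: ext_def A_def)
    moreover have "(\<forall>j\<le>m k. Q j) \<longleftrightarrow> Q 0 \<and> (\<forall>j\<in>A k. Q j)" for Q
      unfolding A_def by (metis One_nat_def Suc_le_eq atLeastAtMost_iff bot_nat_0.not_eq_extremum le0)
    ultimately show ?thesis
      using qN[of 0] by (auto simp: is_unit_def prod w_def)
  qed
  define Z where "Z = (SIGMA k:K. PiE (A k) (\<lambda>_. {1..M}))"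
  define \<beta> where "\<beta> z = (if w (fst z) (snd z) then \<alpha> (fst z) else 0)" for z
  have finZ: "finite Z" unfolding Z_def A_def using K(1) by (intro finite_SigmaI finite_PiE) auto
  have "(\<Sum>z\<in>Z. \<beta> z * (\<Prod>i=1..M. s i ^ e z i)) = 0" for s
  proof -
    \<comment> \<open>Multiplying by \<open>Y 0\<close> turns the open letter \<open>E (c k)\<close>
      into a multiple of a matrix unit. The diagonal entry at \<open>q 0\<close> then tests the
      matching condition at the open slot, as the coefficient does at the closed ones.\<close>
    have "\<Phi> \<rho> (ev (y s) f * Y 0) (q 0) (q 0) = 0"
      unfolding \<Phi>_mult[OF pq(2,2)] using \<Phi>_ev_identity[OF f pq(2)] by simp
    moreover have "ev (y s) f * Y 0 = (\<Sum>k\<in>K. sc (\<alpha> k) * (\<Sum>\<pi>\<in>PiE (A k) (\<lambda>_. {1..M}).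
        tmon 0 [1..<Suc (m k)] (\<tau> k) (\<lambda>j. if j \<in> A k then z s k j (\<pi> j) else E (c k) * Y 0)))"
      unfolding ev sum_distrib_right mult.assoc
    proof (intro sum.cong refl arg_cong[where f = "\<lambda>x. sc _ * x"])
      fix k assume k: "k \<in> K"
      let ?js = "[1..<Suc (m k)]"
      have sets: "A k = set ?js" "insert 0 (set ?js) = {..m k}" by (auto simp: A_def)
      let ?tt = "tuple (y s) (l k) (c k)"
      have "tmon 0 ?js (\<tau> k) ?tt * Y 0 = tmon 0 ?js (\<tau> k) (?tt(0 := ?tt 0 * Y 0))"
        by (rule tmon_mult_right[symmetric]) simp
      also have "\<dots> = tmon 0 ?js (\<tau> k) (\<lambda>j. if j \<in> A k then \<Sum>i=1..M. z s k j i else E (c k) * Y 0)"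
        by (intro tmon_cong refl) (auto simp: sets(1) tuple_def letter_y fun_upd_apply simp del: upt_Suc)
      also have "\<dots> = (\<Sum>\<pi>\<in>PiE (A k) (\<lambda>_. {1..M}).
          tmon 0 ?js (\<tau> k) (\<lambda>j. if j \<in> A k then z s k j (\<pi> j) else E (c k) * Y 0))"
        by (rule tmon_expand) (use K(2)[OF k] sets in \<open>auto simp del: upt_Suc\<close>)
      finally show "tmon 0 ?js (\<tau> k) ?tt * Y 0 = \<dots>" .
    qed
    ultimately have "0 = (\<Sum>k\<in>K. \<alpha> k * (\<Sum>\<pi>\<in>PiE (A k) (\<lambda>_. {1..M}).
        \<Phi> \<rho> (tmon 0 [1..<Suc (m k)] (\<tau> k) (\<lambda>j. if j \<in> A k then z s k j (\<pi> j) else E (c k) * Y 0)) (q 0) (q 0)))"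
      using pq(2) by (simp add: \<Phi>_sum \<Phi>_sc del: upt_Suc)
    also have "\<dots> = (\<Sum>k\<in>K. \<alpha> k * (\<Sum>\<pi>\<in>PiE (A k) (\<lambda>_. {1..M}).
        if w k \<pi> then \<Prod>i=1..M. s i ^ e (k, \<pi>) i else 0))"
      by (intro sum.cong refl arg_cong[where f = "\<lambda>x. _ * x"]) (simp only: entry)
    also have "\<dots> = (\<Sum>k\<in>K. \<Sum>\<pi>\<in>PiE (A k) (\<lambda>_. {1..M}). \<beta> (k, \<pi>) * (\<Prod>i=1..M. s i ^ e (k, \<pi>) i))"
      unfolding sum_distrib_left by (intro sum.cong refl) (simp add: \<beta>_def)
    also have "\<dots> = (\<Sum>z\<in>Z. \<beta> z * (\<Prod>i=1..M. s i ^ e z i))"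
      unfolding Z_def using K(1) by (subst sum.Sigma) (auto simp: A_def finite_PiE case_prod_beta)
    finally show ?thesis by simp
  qed
  \<comment> \<open>Degree one in every \<open>s i\<close> means that each target slot is used
    exactly once. Such placements are bijections, which forces the number of letters to be
    \<open>M\<close>.\<close>
  then have "(\<Sum>z | z \<in> Z \<and> (\<forall>i\<in>{1..M}. e z i = 1). \<beta> z) = 0"
    by (intro coefficient_extraction[OF _ finZ]) auto
  also have "(\<Sum>z | z \<in> Z \<and> (\<forall>i\<in>{1..M}. e z i = 1). \<beta> z) =
      (\<Sum>(k, \<sigma>) \<in> {k \<in> K. m k = M} \<times> {\<sigma>. \<sigma> permutes {1..M}}. \<beta> (k, restrict \<sigma> {1..M}))"
  proof (rule sum.reindex_bij_witness[of _ "\<lambda>(k, \<sigma>). (k, restrict \<sigma> {1..M})"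
        "\<lambda>(k, \<pi>). (k, \<lambda>i. if i \<in> {1..M} then \<pi> i else i)"])
    fix zz assume "zz \<in> {z \<in> Z. \<forall>i\<in>{1..M}. e z i = 1}"
    then obtain k \<pi> where zz: "zz = (k, \<pi>)" "k \<in> K" "\<pi> \<in> PiE (A k) (\<lambda>_. {1..M})" "\<And>i. i \<in> {1..M} \<Longrightarrow> e (k, \<pi>) i = 1"
      by (auto simp: Z_def)
    have "\<exists>j. {j \<in> A k. \<pi> j = i} = {j}" if "i \<in> {1..M}" for i
      using zz(4)[OF that] by (simp add: e_def card_1_singleton_iff)
    then have uniq: "\<exists>!j. j \<in> A k \<and> \<pi> j = i" if "i \<in> {1..M}" for i
      using that by (metis (mono_tags, lifting) mem_Collect_eq singleton_iff)
    have bij: "bij_betw \<pi> (A k) {1..M}"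
    proof (rule bij_betwI')
      fix i j assume ij: "i \<in> A k" "j \<in> A k"
      have "\<pi> j \<in> {1..M}" using PiE_mem[OF zz(3) ij(2)] .
      from uniq[OF this] ij show "(\<pi> i = \<pi> j) = (i = j)" by metis
    next
      show "\<pi> j \<in> {1..M}" if "j \<in> A k" for j using PiE_mem[OF zz(3) that] .
    next
      show "\<exists>j\<in>A k. i = \<pi> j" if "i \<in> {1..M}" for i using uniq[OF that] by metis
    qed
    then have mk: "m k = M" using bij_betw_same_card[OF bij] by (simp add: A_def)
    then have A: "A k = {1..M}" by (simp add: A_def)
    have "bij_betw (\<lambda>i. if i \<in> {1..M} then \<pi> i else i) {1..M} {1..M}"
      using bij unfolding A by (subst bij_betw_cong[of _ _ \<pi>]) auto
    then have "(\<lambda>i. if i \<in> {1..M} then \<pi> i else i) permutes {1..M}"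
      by (rule bij_imp_permutes) auto
    then show "(case zz of (k, \<pi>) \<Rightarrow> (k, \<lambda>i. if i \<in> {1..M} then \<pi> i else i)) \<in> {k \<in> K. m k = M} \<times> {\<sigma>. \<sigma> permutes {1..M}}"
      using zz mk by simp
    have restr: "restrict (\<lambda>i. if i \<in> {1..M} then \<pi> i else i) {1..M} = \<pi>"
      using zz(3) unfolding A by (auto simp: fun_eq_iff restrict_def PiE_def extensional_def)
    then show "(case case zz of (k, \<pi>) \<Rightarrow> (k, \<lambda>i. if i \<in> {1..M} then \<pi> i else i) of (k, \<sigma>) \<Rightarrow> (k, restrict \<sigma> {1..M})) = zz"
      by (simp add: zz(1))
    show "(case case zz of (k, \<pi>) \<Rightarrow> (k, \<lambda>i. if i \<in> {1..M} then \<pi> i else i) of (k, \<sigma>) \<Rightarrow> \<beta> (k, restrict \<sigma> {1..M})) = \<beta> zz"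
      by (simp only: zz(1) restr prod.case)
  next
    fix zz assume "zz \<in> {k \<in> K. m k = M} \<times> {\<sigma>. \<sigma> permutes {1..M}}"
    then obtain k \<sigma> where zz: "zz = (k, \<sigma>)" "k \<in> K" "m k = M" "\<sigma> permutes {1..M}" by auto
    have A: "A k = {1..M}" using zz(3) by (simp add: A_def)
    show "(case case zz of (k, \<sigma>) \<Rightarrow> (k, restrict \<sigma> {1..M}) of (k, \<pi>) \<Rightarrow> (k, \<lambda>i. if i \<in> {1..M} then \<pi> i else i)) = zz"
      using zz(4) by (auto simp: zz(1) fun_eq_iff permutes_not_in)
    have "restrict \<sigma> {1..M} \<in> PiE {1..M} (\<lambda>_. {1..M})"
      using permutes_in_image[OF zz(4)] by auto
    moreover have "e (k, restrict \<sigma> {1..M}) i = 1" if "i \<in> {1..M}" for i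
    proof -
      have "inv \<sigma> i \<in> {1..M}" using permutes_in_image[OF permutes_inv[OF zz(4)]] that by blast
      have iff: "\<sigma> j = i \<longleftrightarrow> j = inv \<sigma> i" for j
        using permutes_inv_eq[OF zz(4), of i j] by auto
      have "{j \<in> {1..M}. restrict \<sigma> {1..M} j = i} = {j \<in> {1..M}. \<sigma> j = i}"
        by (intro Collect_cong) auto
      also have "\<dots> = {inv \<sigma> i}"
        unfolding iff using \<open>inv \<sigma> i \<in> {1..M}\<close> by blast
      finally have "{j \<in> {1..M}. restrict \<sigma> {1..M} j = i} = {inv \<sigma> i}" .
      then show ?thesis by (simp add: e_def A)
    qed
    ultimately show "(case zz of (k, \<sigma>) \<Rightarrow> (k, restrict \<sigma> {1..M})) \<in> {z \<in> Z. \<forall>i\<in>{1..M}. e z i = 1}"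
      using zz by (simp add: Z_def A)
  qed
  also have "\<dots> = (\<Sum>k | k \<in> K \<and> m k = M. \<Sum>\<sigma> | \<sigma> permutes {1..M}. \<beta> (k, restrict \<sigma> {1..M}))"
    by (rule sum.cartesian_product[symmetric])
  also have "\<dots> = (\<Sum>k | k \<in> K \<and> m k = M. if c k = c0 then \<Sum>\<sigma> | \<sigma> permutes {1..M}.
    if (\<forall>j\<in>{1..M}. l k j = t (\<sigma> j)) \<and> (\<forall>j\<le>M. q (\<sigma> j) = p (\<sigma> (\<tau> k j))) then \<alpha> k else 0 else 0)"
  proof (intro sum.cong refl)
    fix k assume "k \<in> {k. k \<in> K \<and> m k = M}"
    then have k: "k \<in> K" "m k = M" by auto
    then have A: "A k = {1..M}" by (simp add: A_def)
    have "w k (restrict \<sigma> {1..M}) \<longleftrightarrow> c k = c0 \<and> (\<forall>j\<in>{1..M}. l k j = t (\<sigma> j)) \<and> (\<forall>j\<le>M. q (\<sigma> j) = p (\<sigma> (\<tau> k j)))"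
      if \<sigma>: "\<sigma> permutes {1..M}" for \<sigma>
    proof -
      have "\<sigma> 0 = 0" using \<sigma> by (auto intro: permutes_not_in)
      then have ext: "ext k (restrict \<sigma> {1..M}) j = \<sigma> j" if "j \<le> M" for j
        using that by (cases "j = 0") (auto simp: ext_def A)
      have "\<tau> k j \<le> M" if "j \<le> M" for j using permutes_in_image[OF K(2)[OF k(1)], of j] that k(2) by simp
      then show ?thesis using ext by (auto simp: w_def A k(2))
    qed
    then show "(\<Sum>\<sigma> | \<sigma> permutes {1..M}. \<beta> (k, restrict \<sigma> {1..M})) = (if c k = c0 then \<Sum>\<sigma> | \<sigma> permutes {1..M}.
        if (\<forall>j\<in>{1..M}. l k j = t (\<sigma> j)) \<and> (\<forall>j\<le>M. q (\<sigma> j) = p (\<sigma> (\<tau> k j))) then \<alpha> k else 0 else 0)"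
      by (auto simp: \<beta>_def intro!: sum.cong)
  qed
  also have "\<dots> = (\<Sum>k | k \<in> K \<and> m k = M \<and> c k = c0. \<Sum>\<sigma> | \<sigma> permutes {1..M}.
    if (\<forall>j\<in>{1..M}. l k j = t (\<sigma> j)) \<and> (\<forall>j\<le>M. q (\<sigma> j) = p (\<sigma> (\<tau> k j))) then \<alpha> k else 0)"
    using K(1) by (subst sum.inter_filter[symmetric]) (auto intro!: sum.cong)
  finally show ?thesis .
qed

end

section \<open>Vanishing of matrix identities modulo the Cayley-Hamilton relations\<close>

locale ch_matrix_model = ch_alg tr sc ns E eps + matrix_model tr sc ns E eps \<Phi> Y
  for tr :: "'r::{ring,monoid_mult} \<Rightarrow> 'r" and sc :: "'f::field_char_0 \<Rightarrow> 'r" and ns E eps \<Phi> Y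
begin

lemma eps_tmon_tuple: "eps * tmon 0 [1..<Suc M] \<tau> (tuple y t c) = tmon 0 [1..<Suc M] \<tau> (tuple y t c)"
proof -
  have "(tuple y t c)(0 := tuple y t c 0 * eps) = tuple y t c"
    by (auto simp: fun_eq_iff fun_upd_apply tuple_def E_eps)
  then show ?thesis
    using tmon_mult_right[of 0 "[1..<Suc M]" \<tau> "tuple y t c" eps] eps_comm by simp
qed

text \<open>Conjugation by \<sigma> carries every term with the letters of \<open>t\<close> to the
  common arrangement \<open>t\<close>, where the terms form one element \<beta> of the group
  algebra. The extracted coefficients say that \<beta> lies in the kernel for every choice of
  colours, so its monomials sum to zero. Terms are counted once for every \<sigma> that matches the
  letters.\<close>

lemma identity_class_sum_eq_0:
  fixes K :: "nat set" and \<alpha> :: "nat \<Rightarrow> 'f"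
  assumes f: "is_etp_identity ns f"
    and K: "finite K" "\<And>k. k \<in> K \<Longrightarrow> \<tau> k permutes {..m k}"
    and ev: "\<And>y. ev y f = (\<Sum>k\<in>K. sc (\<alpha> k) * tmon 0 [1..<Suc (m k)] (\<tau> k) (tuple y (l k) (c k)))"
  shows "(\<Sum>k | k \<in> K \<and> m k = M \<and> c k = c0. \<Sum>\<sigma> | \<sigma> permutes {1..M}.
    if \<forall>j\<in>{1..M}. l k j = t (\<sigma> j) then sc (\<alpha> k) * tmon 0 [1..<Suc (m k)] (\<tau> k) (tuple y (l k) (c k)) else 0) = 0"
proof (cases "\<forall>j\<in>{1..M}. snd (snd (t j)) < length ns")
  case False
  \<comment> \<open>A letter with an out-of-range right index is zero, so every monomial matching
    \<open>t\<close> vanishes; the kernel argument is reserved for genuine colours.\<close>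
  then obtain i where i: "i \<in> {1..M}" "length ns \<le> snd (snd (t i))" by auto
  have "tmon 0 [1..<Suc (m k)] (\<tau> k) (tuple y (l k) (c k)) = 0"
    if k: "k \<in> K" "m k = M" and \<sigma>: "\<sigma> permutes {1..M}" "\<forall>j\<in>{1..M}. l k j = t (\<sigma> j)" for k \<sigma>
  proof -
    have j: "inv \<sigma> i \<in> {1..M}" using permutes_in_image[OF permutes_inv[OF \<sigma>(1)]] i(1) by blast
    have "l k (inv \<sigma> i) = t i" using \<sigma>(2) j permutes_inverses[OF \<sigma>(1)] by metis
    then have "tuple y (l k) (c k) (inv \<sigma> i) = 0"
      using j i(2) by (simp add: tuple_def letter_def case_prod_beta E_out)
    moreover have "insert 0 (set [1..<Suc (m k)]) = {..m k}" by auto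
    ultimately show ?thesis
      using j k K(2)[OF k(1)] by (intro tmon_zero[of "inv \<sigma> i"]) (auto simp del: upt_Suc)
  qed
  then show ?thesis by (intro sum.neutral ballI) (auto intro!: sum.neutral simp del: upt_Suc)
next
  case True
  define K' where "K' = {k. k \<in> K \<and> m k = M \<and> c k = c0}"
  let ?js = "[1..<Suc M]" and ?x = "tuple y t c0"
  have set_js: "insert 0 (set ?js) = {..M}" by auto
  define \<omega> where "\<omega> k \<sigma> = \<sigma> \<circ> \<tau> k \<circ> inv \<sigma>" for k and \<sigma> :: "nat \<Rightarrow> nat"
  define fits where "fits k \<sigma> \<longleftrightarrow> (\<forall>j\<in>{1..M}. l k j = t (\<sigma> j))" for k \<sigma>
  define \<beta> where "\<beta> u = (\<Sum>k\<in>K'. \<Sum>\<sigma> | \<sigma> permutes {1..M}. if fits k \<sigma> \<and> u = \<omega> k \<sigma> then \<alpha> k else 0)" for u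
  have \<omega>: "\<omega> k \<sigma> permutes {..M}" if "k \<in> K'" "\<sigma> permutes {1..M}" for k \<sigma>
  proof -
    have "\<sigma> permutes {..M}" using that(2) by (rule permutes_subset) auto
    then show ?thesis unfolding \<omega>_def using K(2)[of k] that(1)
      by (intro permutes_compose permutes_inv) (auto simp: K'_def)
  qed
  have swap: "(\<Sum>u | u permutes {..M}. \<Sum>k\<in>K'. \<Sum>\<sigma> | \<sigma> permutes {1..M}. if fits k \<sigma> \<and> u = \<omega> k \<sigma> then F k u else 0) =
      (\<Sum>k\<in>K'. \<Sum>\<sigma> | \<sigma> permutes {1..M}. if fits k \<sigma> then F k (\<omega> k \<sigma>) else 0)"
    for F :: "nat \<Rightarrow> (nat \<Rightarrow> nat) \<Rightarrow> 'z::comm_monoid_add"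
  proof -
    have "(\<Sum>u | u permutes {..M}. \<Sum>k\<in>K'. \<Sum>\<sigma> | \<sigma> permutes {1..M}. if fits k \<sigma> \<and> u = \<omega> k \<sigma> then F k u else 0) =
        (\<Sum>k\<in>K'. \<Sum>\<sigma> | \<sigma> permutes {1..M}. \<Sum>u | u permutes {..M}. if fits k \<sigma> \<and> u = \<omega> k \<sigma> then F k u else 0)"
      by (subst sum.swap) (intro sum.cong refl sum.swap)
    also have "\<dots> = (\<Sum>k\<in>K'. \<Sum>\<sigma> | \<sigma> permutes {1..M}. if fits k \<sigma> then F k (\<omega> k \<sigma>) else 0)"
    proof (intro sum.cong refl)
      fix k \<sigma> assume k: "k \<in> K'" and "\<sigma> \<in> {\<sigma>. \<sigma> permutes {1..M}}"
      then have "\<omega> k \<sigma> permutes {..M}" using \<omega> by simp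
      then show "(\<Sum>u | u permutes {..M}. if fits k \<sigma> \<and> u = \<omega> k \<sigma> then F k u else 0) =
          (if fits k \<sigma> then F k (\<omega> k \<sigma>) else 0)"
        by (cases "fits k \<sigma>") (simp_all add: finite_permutations)
    qed
    finally show ?thesis .
  qed
  have T\<omega>: "tmon 0 ?js (\<omega> k \<sigma>) ?x = tmon 0 [1..<Suc (m k)] (\<tau> k) (tuple y (l k) (c k))"
    if k: "k \<in> K'" and \<sigma>: "\<sigma> permutes {1..M}" "fits k \<sigma>" for k \<sigma>
  proof -
    have mk: "m k = M" "c k = c0" using k by (auto simp: K'_def)
    have \<sigma>0: "\<sigma> 0 = 0" using \<sigma>(1) by (auto intro: permutes_not_in)
    have "tmon 0 ?js (\<tau> k) (tuple y (l k) c0) =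
        tmon (\<sigma> 0) (map \<sigma> ?js) (\<omega> k \<sigma>) (tuple y (l k) c0 \<circ> inv \<sigma>)"
      unfolding \<omega>_def by (rule tmon_conj[symmetric]) (rule permutes_bij[OF \<sigma>(1)])
    also have "\<dots> = tmon 0 ?js (\<omega> k \<sigma>) (tuple y (l k) c0 \<circ> inv \<sigma>)"
      unfolding \<sigma>0
    proof (rule tmon_perm)
      show "inj (\<omega> k \<sigma>)" using \<omega>[OF k \<sigma>(1)] by (rule permutes_inj)
      show "distinct (map \<sigma> ?js)"
        using permutes_inj_on[OF \<sigma>(1)] by (simp add: distinct_map del: upt_Suc)
      have "set ?js = {1..M}" by auto
      then show set: "set (map \<sigma> ?js) = set ?js" using permutes_image[OF \<sigma>(1)] by (simp del: upt_Suc)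
      show "0 \<notin> set (map \<sigma> ?js)" unfolding set by simp
    qed (rule distinct_upt)
    also have "\<dots> = tmon 0 ?js (\<omega> k \<sigma>) ?x"
    proof (rule tmon_cong)
      fix i assume i: "i \<in> insert 0 (set ?js)"
      have inv0: "inv \<sigma> 0 = 0" using permutes_inv[OF \<sigma>(1)] by (auto intro: permutes_not_in)
      show "(tuple y (l k) c0 \<circ> inv \<sigma>) i = ?x i"
      proof (cases "i = 0")
        case False
        then have "inv \<sigma> i \<in> {1..M}"
          using i permutes_in_image[OF permutes_inv[OF \<sigma>(1)], of i] by (auto simp del: upt_Suc)
        then have "l k (inv \<sigma> i) = t i" "inv \<sigma> i \<noteq> 0"
          using \<sigma>(2) permutes_inverses[OF \<sigma>(1)] by (auto simp: fits_def)
        then show ?thesis using False by (simp add: tuple_def)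
      qed (simp add: tuple_def inv0)
    qed simp
    finally show ?thesis by (simp only: mk)
  qed
  have sum_eq: "(\<Sum>u | u permutes {..M}. sc (\<beta> u) * tmon 0 ?js u ?x) =
      (\<Sum>k\<in>K'. \<Sum>\<sigma> | \<sigma> permutes {1..M}. if fits k \<sigma> then
        sc (\<alpha> k) * tmon 0 [1..<Suc (m k)] (\<tau> k) (tuple y (l k) (c k)) else 0)"
  proof -
    have "sc (\<beta> u) * tmon 0 ?js u ?x = (\<Sum>k\<in>K'. \<Sum>\<sigma> | \<sigma> permutes {1..M}.
        if fits k \<sigma> \<and> u = \<omega> k \<sigma> then sc (\<alpha> k) * tmon 0 ?js u ?x else 0)" for u
      unfolding \<beta>_def sc_sum sum_distrib_right by (intro sum.cong refl) (simp del: upt_Suc)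
    then have "(\<Sum>u | u permutes {..M}. sc (\<beta> u) * tmon 0 ?js u ?x) =
        (\<Sum>k\<in>K'. \<Sum>\<sigma> | \<sigma> permutes {1..M}. if fits k \<sigma> then sc (\<alpha> k) * tmon 0 ?js (\<omega> k \<sigma>) ?x else 0)"
      using swap[of "\<lambda>k u. sc (\<alpha> k) * tmon 0 ?js u ?x"] by (simp only:)
    also have "\<dots> = (\<Sum>k\<in>K'. \<Sum>\<sigma> | \<sigma> permutes {1..M}. if fits k \<sigma> then
        sc (\<alpha> k) * tmon 0 [1..<Suc (m k)] (\<tau> k) (tuple y (l k) (c k)) else 0)"
      by (intro sum.cong refl if_cong) (simp_all only: T\<omega> mem_Collect_eq)
    finally show ?thesis .
  qed
  \<comment> \<open>The letter \<open>E c0\<close> of the open slot determines no colour for the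
    left end of the open word. It is prescribed by \<open>b0\<close>, and summing over all
    \<open>b0\<close> recovers the factor \<open>eps\<close>.\<close>
  have E0: "E b0 * (\<Sum>u | u permutes {..M}. sc (\<beta> u) * tmon 0 ?js u ?x) = 0" if b0: "b0 < length ns" for b0
  proof -
    let ?a = "\<lambda>j. if j = 0 then c0 else fst (t j)" and ?b = "\<lambda>j. if j = 0 then b0 else snd (snd (t j))"
    have "in_kernel ns {..M} ?a ?b \<beta>"
      unfolding in_kernel_def
    proof (intro allI impI)
      fix p q assume pq: "good_pair ns {..M} ?a ?b p q"
      let ?ind = "\<lambda>u. if \<forall>j\<in>{..M}. q j = p (u j) then 1 else 0 :: 'f"
      have "\<beta> u * ?ind u = (\<Sum>k\<in>K'. \<Sum>\<sigma> | \<sigma> permutes {1..M}. if fits k \<sigma> \<and> u = \<omega> k \<sigma> then \<alpha> k * ?ind u else 0)" for u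
        unfolding \<beta>_def sum_distrib_right by (intro sum.cong refl) simp
      then have "(\<Sum>u | u permutes {..M}. \<beta> u * ?ind u) =
          (\<Sum>k\<in>K'. \<Sum>\<sigma> | \<sigma> permutes {1..M}. if fits k \<sigma> then \<alpha> k * ?ind (\<omega> k \<sigma>) else 0)"
        using swap[of "\<lambda>k u. \<alpha> k * ?ind u"] by (simp only:)
      also have "\<dots> = (\<Sum>k\<in>K'. \<Sum>\<sigma> | \<sigma> permutes {1..M}.
          if (\<forall>j\<in>{1..M}. l k j = t (\<sigma> j)) \<and> (\<forall>j\<le>M. q (\<sigma> j) = p (\<sigma> (\<tau> k j))) then \<alpha> k else 0)"
      proof (intro sum.cong refl)
        fix k \<sigma> assume k: "k \<in> K'" and "\<sigma> \<in> {\<sigma>. \<sigma> permutes {1..M}}"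
        then have \<sigma>: "\<sigma> permutes {1..M}" by simp
        then have \<sigma>M: "\<sigma> permutes {..M}" by (rule permutes_subset) auto
        have "(\<forall>j\<in>{..M}. q j = p (\<omega> k \<sigma> j)) \<longleftrightarrow> (\<forall>j\<in>\<sigma> ` {..M}. q j = p (\<omega> k \<sigma> j))"
          by (simp only: permutes_image[OF \<sigma>M])
        also have "\<dots> \<longleftrightarrow> (\<forall>j\<le>M. q (\<sigma> j) = p (\<sigma> (\<tau> k j)))"
          by (auto simp: \<omega>_def permutes_inverses[OF \<sigma>])
        finally have iff: "(\<forall>j\<in>{..M}. q j = p (\<omega> k \<sigma> j)) \<longleftrightarrow> (\<forall>j\<le>M. q (\<sigma> j) = p (\<sigma> (\<tau> k j)))" .
        show "(if fits k \<sigma> then \<alpha> k * ?ind (\<omega> k \<sigma>) else 0) =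
            (if (\<forall>j\<in>{1..M}. l k j = t (\<sigma> j)) \<and> (\<forall>j\<le>M. q (\<sigma> j) = p (\<sigma> (\<tau> k j))) then \<alpha> k else 0)"
          unfolding iff fits_def by auto
      qed
      also have "\<dots> = 0"
        unfolding K'_def
      proof (rule normal_form_coefficients[OF f K ev])
        have "0 \<in> {..M}" by simp
        then have "in_block ns (?a 0) (p 0) \<and> in_block ns (?b 0) (q 0)"
          using pq unfolding good_pair_def by blast
        then show "in_block ns c0 (p 0)" "q 0 < N" by (auto dest: in_block_less)
        show "in_block ns (fst (t j)) (p j) \<and> in_block ns (snd (snd (t j))) (q j)" if "j \<in> {1..M}" for j
        proof -
          have "j \<in> {..M}" using that by simp
          then have "in_block ns (?a j) (p j) \<and> in_block ns (?b j) (q j)"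
            using pq unfolding good_pair_def by blast
          then show ?thesis using that by simp
        qed
      qed
      finally show "(\<Sum>u | u permutes {..M}. \<beta> u * ?ind u) = 0" .
    qed
    then have ker: "in_kernel ns (insert 0 (set ?js)) ?a ?b \<beta>" unfolding set_js .
    have "E (?b 0) * (\<Sum>u | u permutes insert 0 (set ?js). sc (\<beta> u) * tmon 0 ?js u ?x) = 0"
    proof (rule kernel_eq_0[where a = ?a and b = ?b, OF distinct_upt])
      show "?x k = E (?a k) * ?x k" for k
        by (cases "k = 0") (simp_all add: tuple_def letter_def case_prod_beta E_mult E_mult_left mult.assoc)
      show "?x k = ?x k * E (?b k)" if "k \<in> set ?js" for k
        using that by (simp add: tuple_def letter_def case_prod_beta E_mult mult.assoc del: upt_Suc)
      show "?b k < length ns" if "k \<in> insert 0 (set ?js)" for k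
        using that True b0 by (auto simp del: upt_Suc)
    qed (use ker in \<open>simp_all del: upt_Suc\<close>)
    then show ?thesis unfolding set_js by simp
  qed
  let ?S = "\<Sum>u | u permutes {..M}. sc (\<beta> u) * tmon 0 ?js u ?x"
  have "?S = eps * ?S" by (simp only: sum_distrib_left sc_left_comm eps_tmon_tuple)
  also have "\<dots> = (\<Sum>b0<length ns. E b0 * ?S)" unfolding eps_sum by (rule sum_distrib_right)
  also have "\<dots> = 0" by (intro sum.neutral ballI E0) simp
  finally show ?thesis unfolding sum_eq unfolding fits_def K'_def .
qed

text \<open>Terms are grouped by number of letters, final idempotent and multiset of letters. The
  class sum found before counts each term of a group equally often, by a nonzero number that
  characteristic zero allows to cancel. Each group therefore vanishes on its own.\<close>

theorem ev_identity_eq_0: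
  assumes f: "is_etp_identity ns f"
  shows "ev y f = 0"
proof -
  obtain K \<tau> m \<alpha> l c where nf: "normal_form f K \<tau> m \<alpha> l c" using normal_form_exists by blast
  then have K: "finite K" "\<And>k. k \<in> K \<Longrightarrow> \<tau> k permutes {..m k}"
    and ev: "\<And>y. ev y f = (\<Sum>k\<in>K. sc (\<alpha> k) * tmon 0 [1..<Suc (m k)] (\<tau> k) (tuple y (l k) (c k)))"
    unfolding normal_form_def by blast+
  define T where "T k = sc (\<alpha> k) * tmon 0 [1..<Suc (m k)] (\<tau> k) (tuple y (l k) (c k))" for k
  define g where "g k = (m k, c k, image_mset (l k) (mset_set {1..m k}))" for k
  have "(\<Sum>k | k \<in> K \<and> g k = g k0. T k) = 0" if k0: "k0 \<in> K" for k0
  proof -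
    let ?M = "m k0" and ?t = "l k0"
    define fits where "fits k = {\<sigma>. \<sigma> permutes {1..?M} \<and> (\<forall>j\<in>{1..?M}. l k j = ?t (\<sigma> j))}" for k
    have fin: "finite (fits k)" for k
      by (rule finite_subset[OF _ finite_permutations[of "{1..?M}"]]) (auto simp: fits_def)
    \<comment> \<open>The number of slot permutations that preserve the letters of term
      \<open>k0\<close>.\<close>
    define C where "C = card (fits k0)"
    have "id \<in> fits k0" by (simp add: fits_def permutes_id)
    then have "C \<noteq> 0" using fin[of k0] by (auto simp: C_def)
    have count: "card (fits k) = (if g k = g k0 then C else 0)" if mk: "m k = ?M" "c k = c k0" for k
    proof (cases "g k = g k0")
      case True
      then have "image_mset (l k) (mset_set {1..?M}) = image_mset ?t (mset_set {1..?M})"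
        using mk by (simp add: g_def)
      then obtain \<pi> where \<pi>: "\<pi> permutes {1..?M}" "\<forall>j\<in>{1..?M}. l k j = ?t (\<pi> j)"
        by (rule image_mset_eq_implies_permutes[OF finite_atLeastAtMost])
      have inv_in: "inv \<pi> j \<in> {1..?M}" if "j \<in> {1..?M}" for j
        using permutes_in_image[OF permutes_inv[OF \<pi>(1)]] that by blast
      have \<pi>_in: "\<pi> j \<in> {1..?M}" if "j \<in> {1..?M}" for j
        using permutes_in_image[OF \<pi>(1)] that by blast
      \<comment> \<open>The matchings of term \<open>k\<close> form a coset of the stabilizer of the
        letters of \<open>k0\<close>, so there are \<open>C\<close> of them.\<close>
      have "bij_betw (\<lambda>\<sigma>. \<sigma> \<circ> inv \<pi>) (fits k) (fits k0)"
      proof (rule bij_betw_byWitness[of _ "\<lambda>\<sigma>. \<sigma> \<circ> \<pi>"])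
        show "\<forall>\<sigma>\<in>fits k. \<sigma> \<circ> inv \<pi> \<circ> \<pi> = \<sigma>" "\<forall>\<sigma>\<in>fits k0. \<sigma> \<circ> \<pi> \<circ> inv \<pi> = \<sigma>"
          using permutes_inverses[OF \<pi>(1)] by (auto simp: fun_eq_iff)
        show "(\<lambda>\<sigma>. \<sigma> \<circ> inv \<pi>) ` fits k \<subseteq> fits k0"
        proof (rule image_subsetI)
          fix \<sigma> assume "\<sigma> \<in> fits k"
          then have \<sigma>: "\<sigma> permutes {1..?M}" "\<forall>j\<in>{1..?M}. l k j = ?t (\<sigma> j)" by (auto simp: fits_def)
          have "?t j = ?t (\<sigma> (inv \<pi> j))" if "j \<in> {1..?M}" for j
          proof -
            have "?t (\<sigma> (inv \<pi> j)) = l k (inv \<pi> j)" using \<sigma>(2) inv_in[OF that] by metis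
            also have "\<dots> = ?t (\<pi> (inv \<pi> j))" using \<pi>(2) inv_in[OF that] by metis
            finally show ?thesis by (simp add: permutes_inverses[OF \<pi>(1)])
          qed
          then show "\<sigma> \<circ> inv \<pi> \<in> fits k0"
            unfolding fits_def using permutes_compose[OF permutes_inv[OF \<pi>(1)] \<sigma>(1)] by simp
        qed
        show "(\<lambda>\<sigma>. \<sigma> \<circ> \<pi>) ` fits k0 \<subseteq> fits k"
        proof (rule image_subsetI)
          fix \<sigma> assume "\<sigma> \<in> fits k0"
          then have \<sigma>: "\<sigma> permutes {1..?M}" "\<forall>j\<in>{1..?M}. ?t j = ?t (\<sigma> j)" by (auto simp: fits_def)
          have "l k j = ?t (\<sigma> (\<pi> j))" if "j \<in> {1..?M}" for j
            using \<pi>(2) \<sigma>(2) \<pi>_in[OF that] that by metis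
          then show "\<sigma> \<circ> \<pi> \<in> fits k"
            unfolding fits_def using permutes_compose[OF \<pi>(1) \<sigma>(1)] by simp
        qed
      qed
      then show ?thesis using True by (simp add: C_def bij_betw_same_card)
    next
      case False
      have "fits k = {}"
      proof (rule ccontr)
        assume "fits k \<noteq> {}"
        then obtain \<sigma> where \<sigma>: "\<sigma> permutes {1..?M}" "\<forall>j\<in>{1..?M}. l k j = ?t (\<sigma> j)" by (auto simp: fits_def)
        have "image_mset (l k) (mset_set {1..?M}) = image_mset ?t (image_mset \<sigma> (mset_set {1..?M}))"
          using \<sigma>(2) by (simp add: multiset.map_comp) (intro image_mset_cong, simp)
        also have "image_mset \<sigma> (mset_set {1..?M}) = mset_set {1..?M}"
          using \<sigma>(1) by (rule permutes_image_mset)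
        finally show False using False mk by (simp add: g_def)
      qed
      then show ?thesis using False by simp
    qed
    have "0 = (\<Sum>k | k \<in> K \<and> m k = ?M \<and> c k = c k0. \<Sum>\<sigma> | \<sigma> permutes {1..?M}.
        if \<forall>j\<in>{1..?M}. l k j = ?t (\<sigma> j) then T k else 0)"
      unfolding T_def by (rule identity_class_sum_eq_0[OF f K ev, symmetric])
    also have "\<dots> = (\<Sum>k | k \<in> K \<and> m k = ?M \<and> c k = c k0. if g k = g k0 then sc (of_nat C) * T k else 0)"
    proof (intro sum.cong refl)
      fix k assume "k \<in> {k. k \<in> K \<and> m k = ?M \<and> c k = c k0}"
      then have mk: "m k = ?M" "c k = c k0" by auto
      have "(\<Sum>\<sigma> | \<sigma> permutes {1..?M}. if \<forall>j\<in>{1..?M}. l k j = ?t (\<sigma> j) then T k else 0) = (\<Sum>\<sigma>\<in>fits k. T k)"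
        unfolding fits_def using finite_permutations[of "{1..?M}"]
        by (subst sum.inter_filter[symmetric]) (auto intro: sum.cong)
      also have "\<dots> = (\<Sum>\<sigma>\<in>fits k. sc 1) * T k" by (simp add: sum_distrib_right)
      also have "\<dots> = sc (of_nat (card (fits k))) * T k"
        by (simp only: sc_sum[symmetric] sum_constant mult_1_right)
      also have "\<dots> = (if g k = g k0 then sc (of_nat C) * T k else 0)" by (simp add: count[OF mk])
      finally show "(\<Sum>\<sigma> | \<sigma> permutes {1..?M}. if \<forall>j\<in>{1..?M}. l k j = ?t (\<sigma> j) then T k else 0) =
          (if g k = g k0 then sc (of_nat C) * T k else 0)" .
    qed
    also have "\<dots> = (\<Sum>k | k \<in> {k. k \<in> K \<and> m k = ?M \<and> c k = c k0} \<and> g k = g k0. sc (of_nat C) * T k)"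
      using K(1) by (subst sum.inter_filter[symmetric]) auto
    also have "{k. k \<in> {k. k \<in> K \<and> m k = ?M \<and> c k = c k0} \<and> g k = g k0} = {k. k \<in> K \<and> g k = g k0}"
      by (auto simp: g_def)
    finally have "sc (of_nat C) * (\<Sum>k | k \<in> K \<and> g k = g k0. T k) = 0"
      by (simp add: sum_distrib_left)
    moreover have "of_nat C \<noteq> (0 :: 'f)" using \<open>C \<noteq> 0\<close> by simp
    ultimately show ?thesis by (metis sc_cancel)
  qed
  then have "(\<Sum>v\<in>g ` K. \<Sum>k | k \<in> K \<and> g k = v. T k) = 0"
    by (intro sum.neutral) auto
  moreover have "ev y f = (\<Sum>v\<in>g ` K. \<Sum>k | k \<in> K \<and> g k = v. T k)"
    unfolding ev T_def using K(1) by (rule sum.image_gen)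
  ultimately show ?thesis by simp
qed

end

subsection \<open>The quotient by a T-ideal\<close>

declare etp_eqv.trans [trans]

lemmas etp_congs = etp_eqv.cong_add etp_eqv.cong_mult etp_eqv.cong_tr

lemma eqv_add_zero_right: "etp_eqv ns (Add u (Const 0)) u"
  by (rule etp_eqv.trans[OF etp_eqv.add_comm etp_eqv.add_zero])

lemma eqv_add_left_comm: "etp_eqv ns (Add u (Add v w)) (Add v (Add u w))"
proof -
  have "etp_eqv ns (Add u (Add v w)) (Add (Add u v) w)" by (rule etp_eqv.sym[OF etp_eqv.add_assoc])
  also have "etp_eqv ns \<dots> (Add (Add v u) w)" by (intro etp_congs etp_eqv.add_comm etp_eqv.refl)
  also have "etp_eqv ns \<dots> (Add v (Add u w))" by (rule etp_eqv.add_assoc)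
  finally show ?thesis .
qed

lemma eqv_add_add: "etp_eqv ns (Add (Add u v) (Add w x)) (Add (Add u w) (Add v x))"
proof -
  have "etp_eqv ns (Add (Add u v) (Add w x)) (Add u (Add v (Add w x)))" by (rule etp_eqv.add_assoc)
  also have "etp_eqv ns \<dots> (Add u (Add w (Add v x)))"
    by (intro etp_congs eqv_add_left_comm etp_eqv.refl)
  also have "etp_eqv ns \<dots> (Add (Add u w) (Add v x))" by (rule etp_eqv.sym[OF etp_eqv.add_assoc])
  finally show ?thesis .
qed

text \<open>Writing 0 as 1 + (-1) in the scalars reduces this to the axiom for additive
  inverses.\<close>

lemma eqv_zero_mult: "etp_eqv ns (Mult (Const 0) u) (Const (0 :: 'f::field))"
proof -
  have "etp_eqv ns (Const 0 :: 'f etp) (Add (Const 1) (Const (-1)))"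
    using etp_eqv.const_add[of ns 1 "- 1 :: 'f"] by simp
  then have "etp_eqv ns (Mult (Const 0) u) (Mult (Add (Const 1) (Const (-1))) u)"
    by (intro etp_congs etp_eqv.refl)
  also have "etp_eqv ns \<dots> (Add (Mult (Const 1) u) (Mult (Const (-1)) u))" by (rule etp_eqv.distrib_right)
  also have "etp_eqv ns \<dots> (Add u (Mult (Const (-1)) u))"
    by (intro etp_congs etp_eqv.mult_one_left etp_eqv.refl)
  also have "etp_eqv ns \<dots> (Const 0)" by (rule etp_eqv.add_inv)
  finally show ?thesis .
qed

lemma eqv_mult_zero: "etp_eqv ns (Mult u (Const 0)) (Const 0)"
  by (rule etp_eqv.trans[OF etp_eqv.sym[OF etp_eqv.const_central] eqv_zero_mult])

lemma eqv_tr_zero: "etp_eqv ns (Tr (Const 0)) (Const 0)"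
proof -
  have "etp_eqv ns (Tr (Const 0)) (Tr (Mult (Const 0) (Const 0)))"
    by (intro etp_congs etp_eqv.sym[OF eqv_zero_mult])
  also have "etp_eqv ns \<dots> (Mult (Const 0) (Tr (Const 0)))" by (rule etp_eqv.tr_smult)
  also have "etp_eqv ns \<dots> (Const 0)" by (rule eqv_zero_mult)
  finally show ?thesis .
qed

text \<open>Congruence modulo the T-ideal, phrased without a difference: the index \<open>i\<close>
  consists of the block sizes and the generating set.\<close>

definition trel :: "nat list \<times> 'f::field etp set \<Rightarrow> 'f etp \<Rightarrow> 'f etp \<Rightarrow> bool" where
  "trel i u v \<longleftrightarrow> (\<exists>w \<in> etp_Tideal (fst i) (snd i). etp_eqv (fst i) u (Add v w))"

lemma trel_eqv: "etp_eqv (fst i) u v \<Longrightarrow> trel i u v"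
  unfolding trel_def
  by (rule bexI[OF _ etp_Tideal.zero]) (rule etp_eqv.trans[OF _ etp_eqv.sym[OF eqv_add_zero_right]])

lemma trel_refl: "trel i u u"
  by (rule trel_eqv) (rule etp_eqv.refl)

lemma trel_sym: "trel i u v \<Longrightarrow> trel i v u"
proof -
  assume "trel i u v"
  then obtain w where w: "w \<in> etp_Tideal (fst i) (snd i)" "etp_eqv (fst i) u (Add v w)"
    by (auto simp: trel_def)
  let ?w = "Mult (Const (-1)) w"
  have "etp_eqv (fst i) (Add u ?w) (Add (Add v w) ?w)"
    by (intro etp_congs w(2) etp_eqv.refl)
  also have "etp_eqv (fst i) \<dots> (Add v (Add w ?w))" by (rule etp_eqv.add_assoc)
  also have "etp_eqv (fst i) \<dots> (Add v (Const 0))" by (intro etp_congs etp_eqv.add_inv etp_eqv.refl)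
  also have "etp_eqv (fst i) \<dots> v" by (rule eqv_add_zero_right)
  finally have "etp_eqv (fst i) v (Add u ?w)" by (rule etp_eqv.sym)
  then show ?thesis using w(1) by (auto simp: trel_def intro: etp_Tideal.mult_left)
qed

lemma trel_trans: "trel i u v \<Longrightarrow> trel i v x \<Longrightarrow> trel i u x"
proof -
  assume "trel i u v" "trel i v x"
  then obtain w w' where w: "w \<in> etp_Tideal (fst i) (snd i)" "etp_eqv (fst i) u (Add v w)"
    and w': "w' \<in> etp_Tideal (fst i) (snd i)" "etp_eqv (fst i) v (Add x w')"
    by (auto simp: trel_def)
  have "etp_eqv (fst i) u (Add v w)" by (rule w(2))
  also have "etp_eqv (fst i) \<dots> (Add (Add x w') w)" by (intro etp_congs w'(2) etp_eqv.refl)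
  also have "etp_eqv (fst i) \<dots> (Add x (Add w' w))" by (rule etp_eqv.add_assoc)
  finally show ?thesis using etp_Tideal.add[OF w'(1) w(1)] by (auto simp: trel_def)
qed

lemma trel_add: "trel i u u' \<Longrightarrow> trel i v v' \<Longrightarrow> trel i (Add u v) (Add u' v')"
proof -
  assume "trel i u u'" "trel i v v'"
  then obtain w w' where w: "w \<in> etp_Tideal (fst i) (snd i)" "etp_eqv (fst i) u (Add u' w)"
    and w': "w' \<in> etp_Tideal (fst i) (snd i)" "etp_eqv (fst i) v (Add v' w')"
    by (auto simp: trel_def)
  have "etp_eqv (fst i) (Add u v) (Add (Add u' w) (Add v' w'))" by (intro etp_congs w w')
  also have "etp_eqv (fst i) \<dots> (Add (Add u' v') (Add w w'))" by (rule eqv_add_add)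
  finally show ?thesis using etp_Tideal.add[OF w(1) w'(1)] by (auto simp: trel_def)
qed

lemma trel_mult: "trel i u u' \<Longrightarrow> trel i v v' \<Longrightarrow> trel i (Mult u v) (Mult u' v')"
proof -
  assume "trel i u u'" "trel i v v'"
  then obtain w w' where w: "w \<in> etp_Tideal (fst i) (snd i)" "etp_eqv (fst i) u (Add u' w)"
    and w': "w' \<in> etp_Tideal (fst i) (snd i)" "etp_eqv (fst i) v (Add v' w')"
    by (auto simp: trel_def)
  let ?x = "Add v' w'"
  have "etp_eqv (fst i) (Mult u v) (Mult (Add u' w) ?x)" by (intro etp_congs w w')
  also have "etp_eqv (fst i) \<dots> (Add (Mult u' ?x) (Mult w ?x))" by (rule etp_eqv.distrib_right)
  also have "etp_eqv (fst i) \<dots> (Add (Add (Mult u' v') (Mult u' w')) (Mult w ?x))"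
    by (intro etp_congs etp_eqv.distrib_left etp_eqv.refl)
  also have "etp_eqv (fst i) \<dots> (Add (Mult u' v') (Add (Mult u' w') (Mult w ?x)))" by (rule etp_eqv.add_assoc)
  finally show ?thesis
    using etp_Tideal.add[OF etp_Tideal.mult_left[OF w'(1)] etp_Tideal.mult_right[OF w(1)]]
    by (auto simp: trel_def)
qed

lemma trel_tr: "trel i u u' \<Longrightarrow> trel i (Tr u) (Tr u')"
proof -
  assume "trel i u u'"
  then obtain w where w: "w \<in> etp_Tideal (fst i) (snd i)" "etp_eqv (fst i) u (Add u' w)"
    by (auto simp: trel_def)
  have "etp_eqv (fst i) (Tr u) (Tr (Add u' w))" by (intro etp_congs w)
  also have "etp_eqv (fst i) \<dots> (Add (Tr u') (Tr w))" by (rule etp_eqv.tr_add)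
  finally show ?thesis using etp_Tideal.tr[OF w(1)] by (auto simp: trel_def)
qed

lemma trel_zero_iff: "trel (ns, G) u (Const 0) \<longleftrightarrow> u \<in> etp_Tideal ns G"
proof
  assume "trel (ns, G) u (Const 0)"
  then obtain w where w: "w \<in> etp_Tideal ns G" "etp_eqv ns u (Add (Const 0) w)"
    by (auto simp: trel_def)
  have "etp_eqv ns u w" using w(2) etp_eqv.add_zero by (rule etp_eqv.trans)
  then show "u \<in> etp_Tideal ns G" using w(1) etp_Tideal.eqv etp_eqv.sym by blast
next
  assume "u \<in> etp_Tideal ns G"
  then show "trel (ns, G) u (Const 0)"
    unfolding trel_def using etp_eqv.sym[OF etp_eqv.add_zero] by auto
qed

text \<open>A type cannot depend on \<^term>\<open>ns\<close> and the generators, so the quotients of the free algebra for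
  all choices of both are bundled into a single product algebra; the quotient for one choice is
  cut out of it by a central idempotent.\<close>

quotient_type (overloaded) 'f talg = "nat list \<times> 'f::field etp set \<Rightarrow> 'f etp" / "\<lambda>F G. \<forall>i. trel i (F i) (G i)"
  by (intro equivpI reflpI sympI transpI) (blast intro: trel_refl trel_sym trel_trans)+

instantiation talg :: (field) "{ring,monoid_mult}"
begin

lift_definition zero_talg :: "'a talg" is "\<lambda>_. Const 0" .
lift_definition one_talg :: "'a talg" is "\<lambda>_. Const 1" .
lift_definition plus_talg :: "'a talg \<Rightarrow> 'a talg \<Rightarrow> 'a talg" is "\<lambda>F G i. Add (F i) (G i)"
  by (simp add: trel_add)
lift_definition times_talg :: "'a talg \<Rightarrow> 'a talg \<Rightarrow> 'a talg" is "\<lambda>F G i. Mult (F i) (G i)"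
  by (simp add: trel_mult)
lift_definition uminus_talg :: "'a talg \<Rightarrow> 'a talg" is "\<lambda>F i. Mult (Const (-1)) (F i)"
  by (simp add: trel_mult trel_refl)
definition minus_talg :: "'a talg \<Rightarrow> 'a talg \<Rightarrow> 'a talg" where "minus_talg x y = x + - y"

instance
proof
  fix a b c :: "'a talg"
  show "a + b + c = a + (b + c)" by transfer (simp add: trel_eqv etp_eqv.add_assoc)
  show "a + b = b + a" by transfer (simp add: trel_eqv etp_eqv.add_comm)
  show "0 + a = a" by transfer (simp add: trel_eqv etp_eqv.add_zero)
  show "- a + a = 0"
    by transfer (auto intro!: trel_eqv etp_eqv.trans[OF etp_eqv.add_comm etp_eqv.add_inv])
  show "a - b = a + - b" by (rule minus_talg_def)
  show "a * b * c = a * (b * c)" by transfer (simp add: trel_eqv etp_eqv.mult_assoc)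
  show "(a + b) * c = a * c + b * c" by transfer (simp add: trel_eqv etp_eqv.distrib_right)
  show "a * (b + c) = a * b + a * c" by transfer (simp add: trel_eqv etp_eqv.distrib_left)
  show "1 * a = a" by transfer (simp add: trel_eqv etp_eqv.mult_one_left)
  show "a * 1 = a" by transfer (simp add: trel_eqv etp_eqv.mult_one_right)
qed

end

lift_definition ttr :: "'f::field talg \<Rightarrow> 'f talg" is "\<lambda>F i. Tr (F i)"
  by (simp add: trel_tr)

lift_definition tsc :: "'f::field \<Rightarrow> 'f talg" is "\<lambda>c _. Const c" .

text \<open>Embeds the quotient at index \<open>i\<close> into the product, with zero in all other
  factors. The image of \<open>Const 1\<close> is the central idempotent of that factor.\<close>

lift_definition component :: "nat list \<times> 'f::field etp set \<Rightarrow> 'f etp \<Rightarrow> 'f talg" is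
  "\<lambda>i u j. if j = i then u else Const 0" .

lemma component_eq_iff: "component i u = component i v \<longleftrightarrow> trel i u v"
  by transfer (auto simp: trel_refl)

lemma component_eqvI: "etp_eqv (fst i) u v \<Longrightarrow> component i u = component i v"
  by (simp add: component_eq_iff trel_eqv)

lemma component_Const0 [simp]: "component i (Const 0) = 0"
  by transfer (simp add: trel_refl)

lemma component_Add: "component i (Add u v) = component i u + component i v"
  by transfer (auto simp: trel_refl intro!: trel_eqv etp_eqv.sym[OF etp_eqv.add_zero])

lemma component_Mult: "component i (Mult u v) = component i u * component i v"
  by transfer (auto simp: trel_refl intro!: trel_eqv etp_eqv.sym[OF eqv_zero_mult])

lemma component_Tr: "component i (Tr u) = ttr (component i u)"
  by transfer (auto simp: trel_refl intro!: trel_eqv etp_eqv.sym[OF eqv_tr_zero])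

lemma component_Const: "component i (Const c) = tsc c * component i (Const 1)"
  by transfer (auto intro!: trel_eqv etp_eqv.sym[OF eqv_mult_zero] etp_eqv.sym[OF etp_eqv.mult_one_right])

text \<open>Lets any assignment of algebra elements, cut down to one factor, be realised by a
  substitution of polynomials.\<close>

lemma component_surj: "\<exists>u. component i (Const 1) * y = component i u"
proof (transfer, intro exI allI)
  fix i j :: "nat list \<times> 'a etp set" and F
  show "trel j (Mult (if j = i then Const 1 else Const 0) (F j)) (if j = i then F i else Const 0)"
    by (auto intro!: trel_eqv eqv_zero_mult etp_eqv.mult_one_left)
qed

lemma component_sumT: "component i (sumT us) = (\<Sum>u\<leftarrow>us. component i u)"
  by (induction us) (simp_all add: sumT_def component_Add)

lemma E_mult_eqv: "etp_eqv ns (Mult (E a) (E b)) (if a = b then E a else Const 0)"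
proof -
  consider "a < length ns" "b < length ns" | "length ns \<le> a" | "length ns \<le> b" by linarith
  then show ?thesis
  proof cases
    case 1
    then show ?thesis by (rule etp_eqv.E_mult)
  next
    case 2
    have "etp_eqv ns (Mult (E a) (E b)) (Mult (Const 0) (E b))"
      by (intro etp_congs etp_eqv.E_out 2 etp_eqv.refl)
    also have "etp_eqv ns \<dots> (Const 0)" by (rule eqv_zero_mult)
    finally show ?thesis using etp_eqv.sym[OF etp_eqv.E_out[OF 2]] by (auto intro: etp_eqv.trans)
  next
    case 3
    have "etp_eqv ns (Mult (E a) (E b)) (Mult (E a) (Const 0))"
      by (intro etp_congs etp_eqv.E_out 3 etp_eqv.refl)
    also have "etp_eqv ns \<dots> (Const 0)" by (rule eqv_mult_zero)
    finally show ?thesis using etp_eqv.sym[OF etp_eqv.E_out[OF 3]] by (auto intro: etp_eqv.trans)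
  qed
qed

subsection \<open>Evaluation at matrices\<close>

lemma ex_in_block: "P < sum_list ns \<Longrightarrow> \<exists>a. in_block ns a P"
proof -
  assume P: "P < sum_list ns"
  define k where "k = (LEAST k. P < sum_list (take k ns))"
  have k: "P < sum_list (take k ns)"
    unfolding k_def by (rule LeastI[of _ "length ns"]) (simp add: P)
  then obtain a where a: "k = Suc a" by (cases k) auto
  have "\<not> P < sum_list (take a ns)" using not_less_Least[of a "\<lambda>k. P < sum_list (take k ns)"] a unfolding k_def by auto
  moreover from this have "a < length ns" using k a by (cases "a < length ns") auto
  ultimately show ?thesis using k a by (auto simp: in_block_def)
qed

lemma eblock_eq: "eblock ns a = mat (sum_list ns) (sum_list ns) (\<lambda>(P, Q). if P = Q \<and> in_block ns a P then 1 else 0)"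
  by (rule eq_matI) (auto simp: eblock_def in_block_def)

lemma smult_smult_mat: "c \<cdot>\<^sub>m (d \<cdot>\<^sub>m A) = (c * d) \<cdot>\<^sub>m (A :: 'a::comm_ring_1 mat)"
  by (rule eq_matI) (simp_all add: mult.assoc)

lemma scalar_mat_mult:
  assumes "(A :: 'a::comm_ring_1 mat) \<in> carrier_mat n n"
  shows "(c \<cdot>\<^sub>m 1\<^sub>m n) * A = c \<cdot>\<^sub>m A" "A * (c \<cdot>\<^sub>m 1\<^sub>m n) = c \<cdot>\<^sub>m A"
  using assms by (simp_all add: mult_smult_assoc_mat[OF one_carrier_mat assms] mult_smult_distrib[OF assms one_carrier_mat])

lemma mtrace_scalar: "dim_row A = dim_col A \<Longrightarrow> mtrace (c \<cdot>\<^sub>m A) = c * mtrace A"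
  by (simp add: mtrace_def sum_distrib_left)

lemma mtrace_comm:
  assumes "(A :: 'a::comm_ring_1 mat) \<in> carrier_mat n n" "B \<in> carrier_mat n n"
  shows "mtrace (A * B) = mtrace (B * A)"
proof -
  have "mtrace (A * B) = (\<Sum>i<n. \<Sum>k<n. A $$ (i, k) * B $$ (k, i))"
    using assms by (simp add: mtrace_def scalar_prod_def atLeast0LessThan)
  also have "\<dots> = (\<Sum>k<n. \<Sum>i<n. B $$ (k, i) * A $$ (i, k))"
    by (subst sum.swap) (simp add: mult.commute)
  also have "\<dots> = mtrace (B * A)"
    using assms by (simp add: mtrace_def scalar_prod_def atLeast0LessThan)
  finally show ?thesis .
qed

context
  fixes ns :: "nat list" and \<rho> :: "nat \<Rightarrow> 'f::field_char_0 mat"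
  assumes \<rho>: "\<And>i. \<rho> i \<in> carrier_mat (sum_list ns) (sum_list ns)"
begin

abbreviation "eva \<equiv> etp_eval ns \<rho>"

lemma eva_carrier [simp]: "eva u \<in> carrier_mat (sum_list ns) (sum_list ns)"
  using \<rho> by (rule etp_eval_carrier)

lemma eva_dim [simp]: "dim_row (eva u) = sum_list ns" "dim_col (eva u) = sum_list ns"
  using eva_carrier[of u] by (auto simp del: eva_carrier)

lemma eva_sum_E:
  "P < sum_list ns \<Longrightarrow> Q < sum_list ns \<Longrightarrow>
    eva (sumT (map E as)) $$ (P, Q) = (\<Sum>a\<leftarrow>as. if P = Q \<and> in_block ns a P then 1 else 0)"
  by (induction as) (simp_all add: sumT_def eblock_eq)

lemma etp_eqv_sound: "etp_eqv ns u v \<Longrightarrow> eva u = eva v"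
proof (induction rule: etp_eqv.induct)
  case (E_mult a b)
  show ?case
  proof (rule eq_matI)
    fix P Q assume "P < dim_row (eva (if a = b then E a else Const 0))"
      "Q < dim_col (eva (if a = b then E a else Const 0))"
    then have PQ: "P < sum_list ns" "Q < sum_list ns" by (simp_all split: if_splits)
    have "eva (Mult (E a) (E b)) $$ (P, Q) = (\<Sum>k<sum_list ns.
        (if P = k \<and> in_block ns a P then 1 else 0) * (if k = Q \<and> in_block ns b k then 1 else 0))"
      using PQ by (simp add: eblock_eq scalar_prod_def atLeast0LessThan)
    also have "\<dots> = (\<Sum>k<sum_list ns. if k = P then (if P = Q \<and> in_block ns a P \<and> in_block ns b P then 1 else 0) else 0)"
      by (intro sum.cong refl) auto
    finally show "eva (Mult (E a) (E b)) $$ (P, Q) = eva (if a = b then E a else Const 0) $$ (P, Q)"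
      using PQ in_block_unique[of ns a P b] by (auto simp: eblock_eq)
  qed (auto simp del: etp_eval.simps)
next
  case E_sum
  show ?case
  proof (rule eq_matI)
    fix P Q assume "P < dim_row (eva (Const 1))" "Q < dim_col (eva (Const 1))"
    then have PQ: "P < sum_list ns" "Q < sum_list ns" by simp_all
    obtain a where a: "in_block ns a P" using ex_in_block[OF PQ(1)] by auto
    then have b: "in_block ns b P \<longleftrightarrow> b = a" for b using in_block_unique by auto
    have "a < length ns" using a by (simp add: in_block_def)
    have "eva (sumT (map E [0..<length ns])) $$ (P, Q) = (\<Sum>b<length ns. if b = a then (if P = Q then 1 else 0) else 0)"
      unfolding eva_sum_E[OF PQ] interv_sum_list_conv_sum_set_nat atLeast0LessThan set_upt
      by (intro sum.cong) (auto simp: b)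
    then show "eva (sumT (map E [0..<length ns])) $$ (P, Q) = eva (Const 1) $$ (P, Q)"
      using PQ \<open>a < length ns\<close> by simp
  qed (auto simp del: etp_eval.simps)
next
  case (E_tr a)
  have "mtrace (eblock ns a :: 'f mat) = (\<Sum>P<sum_list ns. if P \<in> {P. in_block ns a P} then 1 else 0)"
    by (simp add: mtrace_def eblock_eq)
  also have "\<dots> = (\<Sum>P\<in>{..<sum_list ns} \<inter> {P. in_block ns a P}. 1)"
    by (rule sum.inter_restrict[symmetric]) simp
  also have "{..<sum_list ns} \<inter> {P. in_block ns a P} = {P. in_block ns a P}"
    using in_block_less by auto
  finally show ?case using card_in_block[OF E_tr] by simp
next
  case (E_out a)
  then show ?case by (auto simp: eblock_eq in_block_def intro!: eq_matI)
next
  case (tr_cyclic u v)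
  show ?case using mtrace_comm[OF eva_carrier eva_carrier, of u v] by simp
next
  case (tr_smult c u)
  show ?case by (simp add: scalar_mat_mult mtrace_scalar smult_smult_mat mult.commute)
next
  case (tr_tr u v)
  show ?case by (simp add: scalar_mat_mult mtrace_scalar smult_smult_mat mult.commute)
next
  case (tr_central u v)
  show ?case by (simp add: scalar_mat_mult)
next
  case (const_central c u)
  show ?case by (simp add: scalar_mat_mult)
next
  case (tr_add u v)
  have "mtrace (eva u + eva v) = mtrace (eva u) + mtrace (eva v)"
    by (simp add: mtrace_def sum.distrib)
  then show ?case by (simp add: add_smult_distrib_right_mat[OF one_carrier_mat])
next
  case (const_add c d)
  show ?case by (simp add: add_smult_distrib_right_mat[OF one_carrier_mat])
next
  case (const_mult c d)
  show ?case by (simp add: scalar_mat_mult smult_smult_mat mult.commute)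
next
  case (add_inv u)
  show ?case
    by (rule eq_matI) (simp_all add: scalar_mat_mult)
next
  case (add_assoc u v w)
  show ?case by (simp add: assoc_add_mat[OF eva_carrier eva_carrier eva_carrier])
next
  case (add_comm u v)
  show ?case by (simp add: comm_add_mat[OF eva_carrier eva_carrier])
next
  case (add_zero u)
  show ?case by (rule eq_matI) simp_all
next
  case (mult_assoc u v w)
  show ?case by (simp add: assoc_mult_mat[OF eva_carrier eva_carrier eva_carrier])
next
  case (mult_one_left u)
  show ?case by (rule eq_matI) (simp_all add: scalar_mat_mult)
next
  case (mult_one_right u)
  show ?case by (rule eq_matI) (simp_all add: scalar_mat_mult)
next
  case (distrib_left u v w)
  show ?case by (simp add: mult_add_distrib_mat[OF eva_carrier eva_carrier eva_carrier])
next
  case (distrib_right u v w)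
  show ?case by (simp add: add_mult_distrib_mat[OF eva_carrier eva_carrier eva_carrier])
qed simp_all

end

section \<open>The identities of matrices form a T-ideal\<close>

lemma etp_eval_subst: "etp_eval ns \<rho> (subst s u) = etp_eval ns (\<lambda>i. etp_eval ns \<rho> (s i)) u"
  by (induction u) simp_all

lemma etp_Tideal_sound:
  fixes u :: "'f::field_char_0 etp"
  assumes "u \<in> etp_Tideal ns G" "\<And>g. g \<in> G \<Longrightarrow> is_etp_identity ns g"
  shows "is_etp_identity ns u"
  using assms(1)
proof (induction rule: etp_Tideal.induct)
  case (gen g)
  then show ?case by (rule assms(2))
next
  case (subst u s)
  show ?case
    unfolding is_etp_identity_def etp_eval_subst
  proof (intro allI impI)
    fix \<rho> :: "nat \<Rightarrow> 'f mat" assume "\<forall>i. \<rho> i \<in> carrier_mat (sum_list ns) (sum_list ns)"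
    then have "\<forall>i. etp_eval ns \<rho> (s i) \<in> carrier_mat (sum_list ns) (sum_list ns)"
      by (intro allI etp_eval_carrier) auto
    then show "etp_eval ns (\<lambda>i. etp_eval ns \<rho> (s i)) u = 0\<^sub>m (sum_list ns) (sum_list ns)"
      using subst.IH unfolding is_etp_identity_def by auto
  qed
next
  case (eqv u v)
  then show ?case using etp_eqv_sound[OF _ eqv.hyps(2)] by (simp add: is_etp_identity_def)
next
  case (mult_left u p)
  show ?case
    unfolding is_etp_identity_def
  proof (intro allI impI)
    fix \<rho> :: "nat \<Rightarrow> 'f mat" assume \<rho>: "\<forall>i. \<rho> i \<in> carrier_mat (sum_list ns) (sum_list ns)"
    then have "etp_eval ns \<rho> p \<in> carrier_mat (sum_list ns) (sum_list ns)" by (intro etp_eval_carrier) auto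
    then show "etp_eval ns \<rho> (Mult p u) = 0\<^sub>m (sum_list ns) (sum_list ns)"
      using mult_left.IH \<rho> by (simp add: is_etp_identity_def right_mult_zero_mat)
  qed
next
  case (mult_right u p)
  show ?case
    unfolding is_etp_identity_def
  proof (intro allI impI)
    fix \<rho> :: "nat \<Rightarrow> 'f mat" assume \<rho>: "\<forall>i. \<rho> i \<in> carrier_mat (sum_list ns) (sum_list ns)"
    then have "etp_eval ns \<rho> p \<in> carrier_mat (sum_list ns) (sum_list ns)" by (intro etp_eval_carrier) auto
    then show "etp_eval ns \<rho> (Mult u p) = 0\<^sub>m (sum_list ns) (sum_list ns)"
      using mult_right.IH \<rho> by (simp add: is_etp_identity_def left_mult_zero_mat)
  qed
next
  case zero
  show ?case by (auto simp: is_etp_identity_def intro!: eq_matI)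
next
  case (add u v)
  then show ?case by (auto simp: is_etp_identity_def)
next
  case (tr u)
  then show ?case by (auto simp: is_etp_identity_def mtrace_def intro!: eq_matI)
qed

section \<open>The quotient as a model of the abstract axioms\<close>

abbreviation tE :: "nat list \<times> 'f::field etp set \<Rightarrow> nat \<Rightarrow> 'f talg" where
  "tE i a \<equiv> component i (E a)"

abbreviation teps :: "nat list \<times> 'f::field etp set \<Rightarrow> 'f talg" where
  "teps i \<equiv> component i (Const 1)"

lemma trace_ring_talg: "trace_ring (ttr :: 'f::field talg \<Rightarrow> 'f talg)"
proof
  fix x y :: "'f talg"
  show "ttr (x + y) = ttr x + ttr y" by transfer (simp add: trel_eqv etp_eqv.tr_add)
  show "ttr (x * y) = ttr (y * x)" by transfer (simp add: trel_eqv etp_eqv.tr_cyclic)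
  show "ttr x * y = y * ttr x" by transfer (simp add: trel_eqv etp_eqv.tr_central)
  show "ttr (ttr x * y) = ttr x * ttr y" by transfer (simp add: trel_eqv etp_eqv.tr_tr)
qed

lemma etrace_alg_talg: "etrace_alg (ttr :: 'f::field_char_0 talg \<Rightarrow> 'f talg) tsc (fst i) (tE i) (teps i)"
proof (intro etrace_alg.intro etrace_alg_axioms.intro trace_ring_talg)
  fix c d :: 'f and x :: "'f talg" and a b :: nat
  show "tsc (c + d) = tsc c + tsc d" by transfer (simp add: trel_eqv etp_eqv.const_add)
  show "tsc (c * d) = tsc c * tsc d" by transfer (simp add: trel_eqv etp_eqv.const_mult)
  show "tsc 1 = (1 :: 'f talg)" by transfer (simp add: trel_refl)
  show "tsc c * x = x * tsc c" by transfer (simp add: trel_eqv etp_eqv.const_central)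
  show "ttr (tsc c * x) = tsc c * ttr x" by transfer (simp add: trel_eqv etp_eqv.tr_smult)
  have "tE i a * tE i b = component i (if a = b then E a else Const 0)"
    unfolding component_Mult[symmetric] by (rule component_eqvI[OF E_mult_eqv])
  then show "tE i a * tE i b = (if a = b then tE i a else 0)" by simp
  show "tE i a = 0" if "length (fst i) \<le> a"
    using component_eqvI[OF etp_eqv.E_out[OF that]] by simp
  have "teps i = component i (sumT (map E [0..<length (fst i)]))"
    by (rule component_eqvI[OF etp_eqv.sym[OF etp_eqv.E_sum]])
  then show "teps i = (\<Sum>a<length (fst i). tE i a)"
    by (simp add: component_sumT comp_def interv_sum_list_conv_sum_set_nat atLeast0LessThan)
  show "teps i * x = x * teps i"
    by transfer (auto intro!: trel_eqv etp_eqv.const_central)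
  show "ttr (teps i * x) = teps i * ttr x"
    by transfer (auto intro!: trel_eqv etp_eqv.tr_smult)
  show "ttr (tE i a) = tsc (of_nat (fst i ! a)) * teps i" if "a < length (fst i)"
    unfolding component_Tr[symmetric] component_Const[symmetric]
    by (rule component_eqvI[OF etp_eqv.E_tr[OF that]])
qed

text \<open>Evaluation descends to the quotient once all generators in the index are identities.
  Since the index ranges over arbitrary generating sets, the value 0 is used in the other cases to
  keep the map well defined.\<close>

lift_definition entry :: "nat list \<times> 'f::field_char_0 etp set \<Rightarrow> (nat \<Rightarrow> nat \<Rightarrow> nat \<Rightarrow> 'f) \<Rightarrow> 'f talg \<Rightarrow> nat \<Rightarrow> nat \<Rightarrow> 'f" is
  "\<lambda>i \<rho> F P Q. if \<forall>g\<in>snd i. is_etp_identity (fst i) g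
    then etp_eval (fst i) (\<lambda>k. mat (sum_list (fst i)) (sum_list (fst i)) (\<lambda>(P, Q). \<rho> k P Q)) (F i) $$ (P, Q) else 0"
proof -
  fix i :: "nat list \<times> 'f etp set" and \<rho> :: "nat \<Rightarrow> nat \<Rightarrow> nat \<Rightarrow> 'f" and F G :: "nat list \<times> 'f etp set \<Rightarrow> 'f etp"
  assume FG: "\<And>i. trel i (F i) (G i)"
  let ?\<rho> = "\<lambda>k. mat (sum_list (fst i)) (sum_list (fst i)) (\<lambda>(P, Q). \<rho> k P Q)"
  have "etp_eval (fst i) ?\<rho> (F i) = etp_eval (fst i) ?\<rho> (G i)" if id: "\<forall>g\<in>snd i. is_etp_identity (fst i) g"
  proof -
    obtain w where w: "w \<in> etp_Tideal (fst i) (snd i)" "etp_eqv (fst i) (F i) (Add (G i) w)"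
      using FG[of i] unfolding trel_def by blast
    have "is_etp_identity (fst i) w" using w(1) by (rule etp_Tideal_sound) (use id in auto)
    then have "etp_eval (fst i) ?\<rho> w = 0\<^sub>m (sum_list (fst i)) (sum_list (fst i))"
      by (simp add: is_etp_identity_def)
    moreover have "etp_eval (fst i) ?\<rho> (F i) = etp_eval (fst i) ?\<rho> (Add (G i) w)"
      using w(2) by (rule etp_eqv_sound[rotated]) simp
    moreover have "etp_eval (fst i) ?\<rho> (G i) \<in> carrier_mat (sum_list (fst i)) (sum_list (fst i))"
      by (rule etp_eval_carrier) simp
    ultimately show ?thesis by simp
  qed
  then show "(\<lambda>P Q. if \<forall>g\<in>snd i. is_etp_identity (fst i) g then etp_eval (fst i) ?\<rho> (F i) $$ (P, Q) else 0) =
      (\<lambda>P Q. if \<forall>g\<in>snd i. is_etp_identity (fst i) g then etp_eval (fst i) ?\<rho> (G i) $$ (P, Q) else 0)"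
    by (auto simp: fun_eq_iff)
qed

lemma matrix_model_talg:
  assumes "\<And>g. g \<in> G \<Longrightarrow> is_etp_identity ns (g :: 'f::field_char_0 etp)"
  shows "matrix_model ttr tsc ns (tE (ns, G)) (teps (ns, G)) (entry (ns, G)) (\<lambda>j. component (ns, G) (Var j))"
proof -
  interpret etrace_alg "ttr :: 'f talg \<Rightarrow> 'f talg" tsc ns "tE (ns, G)" "teps (ns, G)"
    using etrace_alg_talg[of "(ns, G)"] by simp
  let ?N = "sum_list ns"
  define M where "M \<rho> = etp_eval ns (\<lambda>k. mat ?N ?N (\<lambda>(P, Q). \<rho> k P Q))" for \<rho> :: "nat \<Rightarrow> nat \<Rightarrow> nat \<Rightarrow> 'f"
  have carrier: "M \<rho> u \<in> carrier_mat ?N ?N" for \<rho> u unfolding M_def by (rule etp_eval_carrier) simp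
  then have dim: "dim_row (M \<rho> u) = ?N" "dim_col (M \<rho> u) = ?N" for \<rho> u by auto
  have M: "M \<rho> (Add u v) = M \<rho> u + M \<rho> v" "M \<rho> (Mult u v) = M \<rho> u * M \<rho> v"
    "M \<rho> (Tr u) = mtrace (M \<rho> u) \<cdot>\<^sub>m 1\<^sub>m ?N" "M \<rho> (Const c) = c \<cdot>\<^sub>m 1\<^sub>m ?N" "M \<rho> (E a) = eblock ns a"
    "M \<rho> (Var j) = mat ?N ?N (\<lambda>(P, Q). \<rho> j P Q)" for \<rho> u v c a j
    by (simp_all add: M_def)
  have id: "\<forall>g\<in>G. is_etp_identity ns g" using assms by blast
  have entry: "entry (ns, G) \<rho> (abs_talg F) P Q = M \<rho> (F (ns, G)) $$ (P, Q)" for \<rho> F P Q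
    using id by (simp add: entry.abs_eq M_def)
  have talg_cases: "\<exists>F. u = abs_talg F" for u :: "'f talg"
    by (rule exI[of _ "rep_talg u"]) (rule Quotient3_abs_rep[OF Quotient3_talg, symmetric])
  show ?thesis
  proof
    fix P Q \<rho> c a j and u v :: "'f talg"
    assume PQ: "P < ?N" "Q < ?N"
    obtain F where u: "u = abs_talg F" using talg_cases by blast
    obtain H where v: "v = abs_talg H" using talg_cases by blast
    show "entry (ns, G) \<rho> (u + v) P Q = entry (ns, G) \<rho> u P Q + entry (ns, G) \<rho> v P Q"
      unfolding u v plus_talg.abs_eq entry using PQ by (simp add: M dim)
    show "entry (ns, G) \<rho> (u * v) P Q = (\<Sum>k<?N. entry (ns, G) \<rho> u P k * entry (ns, G) \<rho> v k Q)"
      unfolding u v times_talg.abs_eq entry M using PQ by (simp add: dim scalar_prod_def atLeast0LessThan)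
    show "entry (ns, G) \<rho> (ttr u) P Q = (if P = Q then \<Sum>k<?N. entry (ns, G) \<rho> u k k else 0)"
      unfolding u ttr.abs_eq entry M using PQ by (simp add: dim mtrace_def)
    show "entry (ns, G) \<rho> (tsc c * u) P Q = c * entry (ns, G) \<rho> u P Q"
      unfolding u tsc.abs_eq times_talg.abs_eq entry M scalar_mat_mult[OF carrier] using PQ by (simp add: dim)
    show "entry (ns, G) \<rho> (tE (ns, G) a) P Q = (if P = Q \<and> in_block ns a P then 1 else 0)"
      unfolding component.abs_eq entry using PQ by (simp add: M eblock_eq)
    show "entry (ns, G) \<rho> (teps (ns, G)) P Q = (if P = Q then 1 else 0)"
      unfolding component.abs_eq entry using PQ by (simp add: M)
    show "entry (ns, G) \<rho> (component (ns, G) (Var j)) P Q = \<rho> j P Q"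
      unfolding component.abs_eq entry using PQ by (simp add: M)
  qed
qed

context etrace_alg
begin

lemma ev_cong: "(\<And>i. eps * y i = eps * y' i) \<Longrightarrow> ev y f = ev y' f"
  by (induction f) simp_all

end

text \<open>Substituting polynomials and taking the class is the same as evaluating at the classes
  of these polynomials.\<close>

lemma component_subst:
  "component i (subst s f) = etrace_alg.ev (ttr :: 'f::field_char_0 talg \<Rightarrow> 'f talg) tsc (tE i) (teps i) (\<lambda>k. component i (s k)) f"
proof -
  interpret etrace_alg "ttr :: 'f talg \<Rightarrow> 'f talg" tsc "fst i" "tE i" "teps i" by (rule etrace_alg_talg)
  show ?thesis
  proof (induction f)
    case (Var k)
    show ?case
      using component_eqvI[OF etp_eqv.mult_one_left, of i "s k"] by (simp add: component_Mult)
  next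
    case (Const c)
    show ?case using component_Const[of i c] by simp
  qed (simp_all add: component_Add component_Mult component_Tr)
qed

text \<open>A generator evaluated at arbitrary elements is the class of a substitution instance of
  it, and the T-ideal contains all such instances.\<close>

lemma ch_alg_talg: "ch_alg (ttr :: 'f::field_char_0 talg \<Rightarrow> 'f talg) tsc ns (tE (ns, MCH_gens ns)) (teps (ns, MCH_gens ns))"
proof -
  let ?i = "(ns, MCH_gens ns) :: nat list \<times> 'f etp set"
  interpret etrace_alg "ttr :: 'f talg \<Rightarrow> 'f talg" tsc ns "tE ?i" "teps ?i"
    using etrace_alg_talg[of ?i] by simp
  show ?thesis
  proof (rule ch_algI)
    fix y :: "nat \<Rightarrow> 'f talg" and g :: "'f etp" assume g: "g \<in> MCH_gens ns"
    have "\<forall>k. \<exists>u. teps ?i * y k = component ?i u" by (intro allI component_surj)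
    from choice[OF this] obtain s where s: "\<And>k. teps ?i * y k = component ?i (s k)" by blast
    have "ev y g = ev (\<lambda>k. component ?i (s k)) g"
    proof (rule ev_cong)
      show "teps ?i * y k = teps ?i * component ?i (s k)" for k
        using eps_eps by (simp flip: s add: mult.assoc[symmetric])
    qed
    also have "\<dots> = component ?i (subst s g)" by (rule component_subst[symmetric])
    also have "\<dots> = component ?i (Const 0)"
      unfolding component_eq_iff trel_zero_iff by (intro etp_Tideal.subst etp_Tideal.gen g)
    finally show "ev y g = 0" by simp
  qed
qed

text \<open>Cayley-Hamilton by pigeonhole: after expanding the matrices in matrix units, the sum
  antisymmetrizes over n_a + 1 indices taken from a block of n_a positions. Here \<open>C\<close>
  holds the matrix entries, and \<open>prod_encode\<close> numbers the matrix positions so that each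
  has its own generic element.\<close>

lemma (in matrix_model) \<Phi>_ev_generator:
  assumes a: "a < length ns" and PQ: "P < N" "Q < N"
    and \<rho>\<^sub>u_def: "\<rho>\<^sub>u = (\<lambda>z P Q. if P = fst (prod_decode z) \<and> Q = snd (prod_decode z) then 1 else 0)"
    and y_def: "y = (\<lambda>i. \<Sum>z\<in>prod_encode ` ({..<N} \<times> {..<N}). sc (C i (fst (prod_decode z)) (snd (prod_decode z))) * Y z)"
  shows "\<Phi> \<rho>\<^sub>u (ev y (Mult (etp.E a) (Mult (MCH (map (\<lambda>i. Mult (etp.E a) (Mult (Var i) (etp.E a))) [0..<ns ! a])) (etp.E a)))) P Q = 0"
proof -
  let ?n = "ns ! a" and ?K = "prod_encode ` ({..<N} \<times> {..<N})"
  let ?p = "\<lambda>z. fst (prod_decode z)" and ?q = "\<lambda>z. snd (prod_decode z)"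
  define z where "z i k = sc (C i (?p k) (?q k)) * (E a * Y k * E a)" for i k
  \<comment> \<open>Right multiplication by the matrix unit at \<open>(Q, Q)\<close> keeps the entry
    in question and fills the open slot with a matrix unit.\<close>
  define Q' where "Q' = prod_encode (Q, Q)"
  have unit_Y: "is_unit \<rho>\<^sub>u (Y k) 1 (?p k) (?q k)" for k
    by (simp add: is_unit_def \<Phi>_Y \<rho>\<^sub>u_def)
  define \<kappa> where "\<kappa> i k = C i (?p k) (?q k) * (if in_block ns a (?q k) then if in_block ns a (?p k) then 1 else 0 else 0)" for i k
  have unit_z: "is_unit \<rho>\<^sub>u (z i k) (\<kappa> i k) (?p k) (?q k)" for i k
    unfolding z_def \<kappa>_def using unit_Y[of k]
    by (intro is_unit_sc is_unit_E_right is_unit_E_left)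
  let ?x = "(\<lambda>i. E a * y i * E a)(?n := 1)"
  define S where "S = E a * (\<Sum>\<sigma> | \<sigma> permutes {..?n}. sc (of_int (sign \<sigma>)) * tmon ?n [0..<?n] \<sigma> ?x) * E a"
  have x: "E a * y i * E a = (\<Sum>k\<in>?K. z i k)" for i
    by (simp add: y_def z_def sum_distrib_left sum_distrib_right sc_left_comm mult.assoc)
  have "S * Y Q' = E a * (\<Sum>\<sigma> | \<sigma> permutes {..?n}. sc (of_int (sign \<sigma>)) * tmon ?n [0..<?n] \<sigma> (?x(?n := E a * Y Q')))"
    using tmon_mult_right[of ?n "[0..<?n]" _ ?x "E a * Y Q'"]
    by (simp add: S_def sum_distrib_right sum_distrib_left mult.assoc)
  also have "(\<Sum>\<sigma> | \<sigma> permutes {..?n}. sc (of_int (sign \<sigma>)) * tmon ?n [0..<?n] \<sigma> (?x(?n := E a * Y Q'))) =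
      (\<Sum>\<pi>\<in>PiE {..<?n} (\<lambda>_. ?K). \<Sum>\<sigma> | \<sigma> permutes {..?n}. sc (of_int (sign \<sigma>)) *
        tmon ?n [0..<?n] \<sigma> (\<lambda>i. if i \<in> {..<?n} then z i (\<pi> i) else E a * Y Q'))"
  proof -
    have "tmon ?n [0..<?n] \<sigma> (?x(?n := E a * Y Q')) = (\<Sum>\<pi>\<in>PiE {..<?n} (\<lambda>_. ?K).
        tmon ?n [0..<?n] \<sigma> (\<lambda>i. if i \<in> {..<?n} then z i (\<pi> i) else E a * Y Q'))"
      if \<sigma>: "\<sigma> permutes {..?n}" for \<sigma>
    proof -
      have "tmon ?n [0..<?n] \<sigma> (?x(?n := E a * Y Q')) =
          tmon ?n [0..<?n] \<sigma> (\<lambda>i. if i \<in> {..<?n} then \<Sum>k\<in>?K. z i k else E a * Y Q')"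
        by (intro tmon_cong refl) (auto simp: x fun_upd_apply)
      also have "insert ?n (set [0..<?n]) = {..?n}" by auto
      then have "tmon ?n [0..<?n] \<sigma> (\<lambda>i. if i \<in> {..<?n} then \<Sum>k\<in>?K. z i k else E a * Y Q') =
          (\<Sum>\<pi>\<in>PiE {..<?n} (\<lambda>_. ?K). tmon ?n [0..<?n] \<sigma> (\<lambda>i. if i \<in> {..<?n} then z i (\<pi> i) else E a * Y Q'))"
        using \<sigma> by (intro tmon_expand) auto
      finally show ?thesis .
    qed
    then show ?thesis by (subst sum.swap) (simp add: sum_distrib_left)
  qed
  finally have S_eq: "S * Y Q' = (\<Sum>\<pi>\<in>PiE {..<?n} (\<lambda>_. ?K). \<Sum>\<sigma> | \<sigma> permutes {..?n}. sc (of_int (sign \<sigma>)) *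
        (E a * tmon ?n [0..<?n] \<sigma> (\<lambda>i. if i \<in> {..<?n} then z i (\<pi> i) else E a * Y Q')))"
    by (simp add: sum_distrib_left sc_left_comm)
  have zero: "(\<Sum>\<sigma> | \<sigma> permutes {..?n}. of_int (sign \<sigma>) *
      \<Phi> \<rho>\<^sub>u (E a * tmon ?n [0..<?n] \<sigma> (\<lambda>i. if i \<in> {..<?n} then z i (\<pi> i) else E a * Y Q')) P Q) = 0"
    if \<pi>: "\<pi> \<in> PiE {..<?n} (\<lambda>_. ?K)" for \<pi>
  proof -
    let ?z = "\<lambda>i. if i \<in> {..<?n} then z i (\<pi> i) else E a * Y Q'"
    define p where "p i = (if i < ?n then ?p (\<pi> i) else Q)" for i
    \<comment> \<open>The open slot gets the value \<open>P\<close>, the row of the entry under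
      consideration. This turns the position of the product into the matching condition missing at
      that slot, so all n_a + 1 slots are treated alike.\<close>
    define q where "q i = (if i < ?n then ?q (\<pi> i) else P)" for i
    define c where "c i = (if i < ?n then \<kappa> i (\<pi> i) else if in_block ns a Q then 1 else 0)" for i
    have set_eq: "insert ?n (set [0..<?n]) = {..?n}" by auto
    have unit: "is_unit \<rho>\<^sub>u (?z i) (c i) (p i) (if i < ?n then q i else Q) \<and> p i < N \<and> (if i < ?n then q i else Q) < N" for i
    proof (cases "i < ?n")
      case True
      then have "\<pi> i \<in> ?K" using \<pi> by auto
      then have "?p (\<pi> i) < N" "?q (\<pi> i) < N" by auto
      then show ?thesis using True unit_z[of i "\<pi> i"] by (simp add: p_def q_def c_def)
    next
      case False
      have "is_unit \<rho>\<^sub>u (E a * Y Q') (if in_block ns a Q then 1 else 0) Q Q"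
        using is_unit_E_left[OF unit_Y[of Q'], of a] by (simp add: Q'_def)
      then show ?thesis using False PQ by (simp add: p_def c_def)
    qed
    show ?thesis
    proof (cases "(\<forall>i<?n. in_block ns a (q i)) \<and> in_block ns a P")
      case False
      have "\<Phi> \<rho>\<^sub>u (E a * tmon ?n [0..<?n] \<sigma> ?z) P Q = 0" if \<sigma>: "\<sigma> permutes {..?n}" for \<sigma>
      proof -
        have u: "is_unit \<rho>\<^sub>u (tmon ?n [0..<?n] \<sigma> ?z)
          (if \<forall>j\<in>set [0..<?n]. (if j < ?n then q j else Q) = p (\<sigma> j) then \<Prod>j\<in>insert ?n (set [0..<?n]). c j else 0)
          (p (\<sigma> ?n)) (if ?n < ?n then q ?n else Q)"
          by (rule tmon_units) (use \<sigma> unit set_eq in auto)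
        show ?thesis
        proof (cases "in_block ns a P")
          case True
          then obtain j where "j < ?n" "\<not> in_block ns a (q j)" using False by auto
          then have "c j = 0" by (simp add: c_def \<kappa>_def q_def)
          then have "(\<Prod>j\<in>insert ?n (set [0..<?n]). c j) = 0"
            using \<open>j < ?n\<close> by (intro prod_zero) auto
          then show ?thesis using is_unit_E_left[OF u, of a] PQ by (auto simp: is_unit_def)
        next
          case f: False
          then show ?thesis using is_unit_E_left[OF u, of a] PQ by (auto simp: is_unit_def)
        qed
      qed
      then show ?thesis by simp
    next
      case True
      have "\<Phi> \<rho>\<^sub>u (E a * tmon ?n [0..<?n] \<sigma> ?z) P Q =
          (\<Prod>j\<in>{..?n}. c j) * (if \<forall>j\<in>{..?n}. q j = p (id (\<sigma> j)) then 1 else 0)" if \<sigma>: "\<sigma> permutes {..?n}" for \<sigma>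
      proof -
        have u: "is_unit \<rho>\<^sub>u (tmon ?n [0..<?n] \<sigma> ?z)
          (if \<forall>j\<in>set [0..<?n]. (if j < ?n then q j else Q) = p (\<sigma> j) then \<Prod>j\<in>insert ?n (set [0..<?n]). c j else 0)
          (p (\<sigma> ?n)) (if ?n < ?n then q ?n else Q)"
          by (rule tmon_units) (use \<sigma> unit set_eq in auto)
        have "(\<forall>j\<in>{..?n}. q j = p (\<sigma> j)) \<longleftrightarrow> P = p (\<sigma> ?n) \<and> (\<forall>j<?n. q j = p (\<sigma> j))"
        proof -
          have "{..?n} = insert ?n {..<?n}" by auto
          moreover have "q ?n = P" by (simp add: q_def)
          ultimately show ?thesis by auto
        qed
        then show ?thesis using is_unit_E_left[OF u, of a] PQ True unfolding set_eq by (auto simp: is_unit_def)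
      qed
      then have "(\<Sum>\<sigma> | \<sigma> permutes {..?n}. of_int (sign \<sigma>) * \<Phi> \<rho>\<^sub>u (E a * tmon ?n [0..<?n] \<sigma> ?z) P Q) =
          (\<Prod>j\<in>{..?n}. c j) * (\<Sum>\<sigma> | \<sigma> permutes {..?n}. of_int (sign \<sigma>) * (if \<forall>j\<in>{..?n}. q j = p (id (\<sigma> j)) then 1 else 0))"
        unfolding sum_distrib_left by (intro sum.cong refl) (simp add: mult_ac)
      also have "\<dots> = 0"
      proof -
        have "q ` {..?n} \<subseteq> {P. in_block ns a P}" using True by (auto simp: q_def)
        then have "(\<Sum>\<sigma> | \<sigma> permutes {..?n}. of_int (sign \<sigma>) *
            (if \<forall>j\<in>{..?n}. q j = p (id (\<sigma> j)) then 1 else 0)) = (0 :: 'f)"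
          by (intro antisymmetrizer_in_kernel[where Q = "{P. in_block ns a P}"])
            (simp_all add: finite_in_block card_in_block[OF a])
        then show ?thesis by (simp only: mult_zero_right)
      qed
      finally show ?thesis .
    qed
  qed
  have "\<Phi> \<rho>\<^sub>u S P Q = \<Phi> \<rho>\<^sub>u (S * Y Q') P Q"
  proof -
    have "\<Phi> \<rho>\<^sub>u (S * Y Q') P Q = (\<Sum>k<N. if k = Q then \<Phi> \<rho>\<^sub>u S P Q else 0)"
      unfolding \<Phi>_mult[OF PQ] using PQ
      by (intro sum.cong refl) (auto simp: \<Phi>_Y \<rho>\<^sub>u_def Q'_def)
    then show ?thesis using PQ by simp
  qed
  also have "\<dots> = 0"
    unfolding S_eq \<Phi>_sum[OF PQ] \<Phi>_sc[OF PQ] by (intro sum.neutral ballI zero)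
  finally show ?thesis unfolding ev_generator[OF a] S_def .
qed

text \<open>Any matrix tuple is reached from generic elements: each matrix is a combination of
  elements \<open>Y z\<close> that are evaluated at the matrix units.\<close>

lemma MCH_gens_identity:
  assumes "g \<in> MCH_gens ns"
  shows "is_etp_identity ns (g :: 'f::field_char_0 etp)"
  unfolding is_etp_identity_def
proof (intro allI impI)
  fix \<rho> :: "nat \<Rightarrow> 'f mat"
  assume \<rho>: "\<forall>i. \<rho> i \<in> carrier_mat (sum_list ns) (sum_list ns)"
  \<comment> \<open>With an empty generating set the requirement that all generators be identities
    is vacuous, so the matrix model is available without circularity.\<close>
  let ?G = "{} :: 'f etp set" and ?N = "sum_list ns"
  interpret matrix_model "ttr :: 'f talg \<Rightarrow> 'f talg" tsc ns "tE (ns, ?G)" "teps (ns, ?G)" "entry (ns, ?G)"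
    "\<lambda>j. component (ns, ?G) (Var j)"
    by (rule matrix_model_talg) simp
  obtain a where a: "a < length ns"
    and g: "g = Mult (E a) (Mult (MCH (map (\<lambda>i. Mult (E a) (Mult (Var i) (E a))) [0..<ns ! a])) (E a))"
    using assms by (auto simp: MCH_gens_def)
  define \<rho>\<^sub>u :: "nat \<Rightarrow> nat \<Rightarrow> nat \<Rightarrow> 'f" where
    "\<rho>\<^sub>u = (\<lambda>z P Q. if P = fst (prod_decode z) \<and> Q = snd (prod_decode z) then 1 else 0)"
  define y where "y = (\<lambda>i. \<Sum>z\<in>prod_encode ` ({..<?N} \<times> {..<?N}).
    tsc (\<rho> i $$ (fst (prod_decode z), snd (prod_decode z))) * component (ns, ?G) (Var z))"
  have y: "entry (ns, ?G) \<rho>\<^sub>u (y i) P Q = \<rho> i $$ (P, Q)" if PQ: "P < ?N" "Q < ?N" for i P Q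
  proof -
    have "entry (ns, ?G) \<rho>\<^sub>u (y i) P Q =
        (\<Sum>z\<in>prod_encode ` ({..<?N} \<times> {..<?N}). if z = prod_encode (P, Q) then \<rho> i $$ (P, Q) else 0)"
      unfolding y_def \<Phi>_sum[OF PQ] \<Phi>_sc[OF PQ] \<Phi>_Y[OF PQ] \<rho>\<^sub>u_def
      by (intro sum.cong refl) auto
    then show ?thesis using PQ by simp
  qed
  have "mat ?N ?N (\<lambda>(P, Q). entry (ns, ?G) \<rho>\<^sub>u (y i) P Q) = \<rho> i" for i
    using \<rho>[rule_format, of i] by (intro eq_matI) (auto simp: y)
  then have eq: "etp_eval ns \<rho> g $$ (P, Q) = entry (ns, ?G) \<rho>\<^sub>u (ev y g) P Q" if "P < ?N" "Q < ?N" for P Q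
    unfolding \<Phi>_ev[OF that] by simp
  have zero: "entry (ns, ?G) \<rho>\<^sub>u (ev y g) P Q = 0" if "P < ?N" "Q < ?N" for P Q
    unfolding g by (rule \<Phi>_ev_generator[OF a that \<rho>\<^sub>u_def, where C = "\<lambda>i P Q. \<rho> i $$ (P, Q)"]) (rule y_def)
  have "etp_eval ns \<rho> g \<in> carrier_mat ?N ?N" using \<rho> by (intro etp_eval_carrier) auto
  then have "dim_row (etp_eval ns \<rho> g) = ?N" "dim_col (etp_eval ns \<rho> g) = ?N" by auto
  then show "etp_eval ns \<rho> g = 0\<^sub>m ?N ?N"
    by (intro eq_matI) (simp_all only: index_zero_mat eq zero)
qed

text \<open>One inclusion is soundness of the T-ideal operations. For the other, the quotient by the
  T-ideal of the generators is both a Cayley-Hamilton algebra and a matrix model, so every identity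
  vanishes there.\<close>

theorem theorem2p6:
  fixes ns :: "nat list"
  assumes "ns \<noteq> []" and "\<forall>a\<in>set ns. 0 < a"
  shows "{f :: 'f::field_char_0 etp. is_etp_identity ns f} = etp_Tideal ns (MCH_gens ns)"
proof (intro equalityI subsetI CollectI)
  fix f :: "'f etp" assume "f \<in> etp_Tideal ns (MCH_gens ns)"
  then show "is_etp_identity ns f" by (rule etp_Tideal_sound) (rule MCH_gens_identity)
next
  fix f :: "'f etp" assume "f \<in> {f. is_etp_identity ns f}"
  then have f: "is_etp_identity ns f" by simp
  let ?i = "(ns, MCH_gens ns) :: nat list \<times> 'f etp set"
  interpret ch_matrix_model "ttr :: 'f talg \<Rightarrow> 'f talg" tsc ns "tE ?i" "teps ?i" "entry ?i" "\<lambda>j. component ?i (Var j)"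
    by (rule ch_matrix_model.intro[OF ch_alg_talg matrix_model_talg[OF MCH_gens_identity]])
  \<comment> \<open>Hence the value of \<open>f\<close> at the classes of the variables is the class
    of \<open>f\<close> itself.\<close>
  have "subst Var f = f" by (induction f) simp_all
  then have "component ?i f = 0"
    using ev_identity_eq_0[OF f] component_subst[of ?i Var f] by simp
  then have "component ?i f = component ?i (Const 0)" by simp
  then show "f \<in> etp_Tideal ns (MCH_gens ns)"
    unfolding component_eq_iff trel_zero_iff .
qed

end
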